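(* The family of Calabi-Yau threefolds given by degree four sections of a smooth quadric $Q_4\subset P_5(\mathbb C)$ (i.e. smooth intersections of $Q_4$ with a quartic hypersurface) contains members which allow a real structure with real locus a 3-torus; that is, there is such a threefold $X$ with an anti-holomorphic involution whose fixed-point set is diffeomorphic to $(S^1)^3$.
   Context: A Calabi-Yau manifold here means a complex projective manifold whose canonical class vanishes modulo torsion. A real structure on a complex manifold is an anti-holomorphic involution, and its real locus is the set of fixed points. *)

theory Defs
  imports "HOL-Analysis.Analysis"
begin

section \<open>Holomorphic and smooth maps in several variables\<close>

text \<open>Holomorphic functions on open subsets of \<open>\<complex>\<^sup>n\<close>: the (Frechet) derivative exists at every
  point and is complex linear.\<close>

definition hol_fun_on :: "(complex^'n) set \<Rightarrow> (complex^'n \<Rightarrow> complex) \<Rightarrow> bool" where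
  "hol_fun_on U f \<longleftrightarrow> open U \<and>
     (\<forall>x\<in>U. \<exists>a::complex^'n. (f has_derivative (\<lambda>h. \<Sum>i\<in>UNIV. a $ i * h $ i)) (at x))"

definition hol_map_on :: "(complex^'n) set \<Rightarrow> (complex^'n \<Rightarrow> complex^'m) \<Rightarrow> bool" where
  "hol_map_on U f \<longleftrightarrow> (\<forall>j. hol_fun_on U (\<lambda>z. f z $ j))"

definition cnj_vec :: "complex^'n \<Rightarrow> complex^'n" where
  "cnj_vec z = (\<chi> i. cnj (z $ i))"

definition antihol_map_on :: "(complex^'n) set \<Rightarrow> (complex^'n \<Rightarrow> complex^'m) \<Rightarrow> bool" where
  "antihol_map_on U f \<longleftrightarrow> hol_map_on U (\<lambda>z. cnj_vec (f z))"

primrec Ck_on :: "nat \<Rightarrow> 'a::real_normed_vector set \<Rightarrow> ('a \<Rightarrow> 'b::real_normed_vector) \<Rightarrow> bool" where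
  "Ck_on 0 U f \<longleftrightarrow> continuous_on U f"
| "Ck_on (Suc k) U f \<longleftrightarrow>
     (\<forall>x\<in>U. f differentiable (at x)) \<and>
     (\<forall>v. Ck_on k U (\<lambda>x. frechet_derivative f (at x) v))"

definition smooth_map_on :: "'a::real_normed_vector set \<Rightarrow> ('a \<Rightarrow> 'b::real_normed_vector) \<Rightarrow> bool" where
  "smooth_map_on U f \<longleftrightarrow> open U \<and> (\<forall>k. Ck_on k U f)"


section \<open>Complex projective space\<close>

text \<open>A point of \<open>P\<^sub>n(\<complex>)\<close> is a one-dimensional complex subspace of \<open>\<complex>\<^sup>n\<^sup>+\<^sup>1\<close>. So \<open>P\<^sub>5(\<complex>)\<close> is
  \<open>proj_space :: (complex^6) set set\<close>.\<close>

definition cline :: "complex^'m \<Rightarrow> (complex^'m) set" where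
  "cline v = {c *s v | c. True}"

definition proj_space :: "(complex^'m) set set" where
  "proj_space = {cline v | v. v \<noteq> 0}"

text \<open>The preimage of a subset of projective space under the projection
  \<open>\<complex>\<^sup>n\<^sup>+\<^sup>1 - {0} \<rightarrow> P\<^sub>n(\<complex>)\<close>. Projective space carries the quotient topology, so a subset \<open>W\<close> of
  \<open>S\<close> is open (closed) in \<open>S\<close> iff \<open>cone W\<close> is open (closed) in \<open>cone S\<close>.\<close>

definition cone :: "(complex^'m) set set \<Rightarrow> (complex^'m) set" where
  "cone S = {v. v \<noteq> 0 \<and> cline v \<in> S}"

text \<open>Maps defined on an arbitrary subset \<open>S\<close> of a vector space are regular (in the sense of \<open>R\<close>:
  holomorphic, antiholomorphic, smooth) if they extend locally, around each point of \<open>S\<close>, to a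
  regular map on an open set. A map into projective space is regular if moreover it lifts
  locally to homogeneous coordinates. A map \<open>g\<close> on a subset \<open>S\<close> of projective space is regular if
  \<open>g \<circ> cline\<close> is regular on \<open>cone S\<close>; as \<open>cline\<close> is a holomorphic submersion on the nonzero
  vectors, this is the usual notion for maps on submanifolds of projective space.\<close>

definition locally_extends ::
  "('a::topological_space set \<Rightarrow> ('a \<Rightarrow> 'b) \<Rightarrow> bool) \<Rightarrow> 'a set \<Rightarrow> ('a \<Rightarrow> 'b) \<Rightarrow> bool" where
  "locally_extends R S f \<longleftrightarrow>
     (\<forall>x\<in>S. \<exists>V F. open V \<and> x \<in> V \<and> R V F \<and> (\<forall>y\<in>V \<inter> S. f y = F y))"

definition locally_lifts ::
  "('a::topological_space set \<Rightarrow> ('a \<Rightarrow> complex^'m) \<Rightarrow> bool)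
     \<Rightarrow> 'a set \<Rightarrow> ('a \<Rightarrow> (complex^'m) set) \<Rightarrow> bool" where
  "locally_lifts R S f \<longleftrightarrow>
     (\<forall>x\<in>S. \<exists>V F. open V \<and> x \<in> V \<and> R V F \<and> (\<forall>y\<in>V \<inter> S. F y \<noteq> 0 \<and> f y = cline (F y)))"


section \<open>Complex submanifolds of projective space and their canonical class\<close>

text \<open>A local holomorphic parametrization of \<open>X\<close> (inverse of a chart): a biholomorphic map from
  an open subset \<open>U\<close> of \<open>\<complex>\<^sup>n\<close> onto an open subset of \<open>X\<close>.\<close>

definition hol_chart ::
  "(complex^'m) set set \<Rightarrow> (complex^'n) set \<Rightarrow> (complex^'n \<Rightarrow> (complex^'m) set) \<Rightarrow> bool" where
  "hol_chart X U \<phi> \<longleftrightarrow>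
     open U \<and> inj_on \<phi> U \<and> \<phi> ` U \<subseteq> X \<and>
     openin (top_of_set (cone X)) (cone (\<phi> ` U)) \<and>
     locally_lifts hol_map_on U \<phi> \<and>
     locally_extends hol_map_on (cone (\<phi> ` U)) (inv_into U \<phi> \<circ> cline)"

definition projective_threefold :: "(complex^'m) set set \<Rightarrow> bool" where
  "projective_threefold X \<longleftrightarrow>
     X \<subseteq> proj_space \<and>
     closedin (top_of_set (cone proj_space)) (cone X) \<and>
     (\<forall>p\<in>X. \<exists>(U :: (complex^3) set) \<phi>. hol_chart X U \<phi> \<and> p \<in> \<phi> ` U)"

text \<open>The canonical class is torsion: for some \<open>k > 0\<close> the line bundle \<open>K\<^sub>X\<^sup>k\<close> is trivial, i.e. has a
  nowhere vanishing holomorphic section. Such a section is given in local coordinates \<open>\<phi>\<close> as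
  \<open>s\<^sub>\<phi> (dx\<^sub>1 \<and> dx\<^sub>2 \<and> dx\<^sub>3)\<^sup>k\<close> with \<open>s\<^sub>\<phi>\<close> holomorphic without zeros, and \<open>s\<^sub>\<phi> = (s\<^sub>\<psi> \<circ> \<tau>) (det \<tau>')\<^sup>k\<close> for
  each coordinate change \<open>\<tau> = \<psi>\<^sup>-\<^sup>1 \<circ> \<phi>\<close>; here \<open>A\<close> is the complex Jacobian matrix of \<open>\<tau>\<close> at \<open>x\<close>.\<close>

definition canonical_class_torsion :: "(complex^'m) set set \<Rightarrow> bool" where
  "canonical_class_torsion X \<longleftrightarrow>
     (\<exists>k>0. \<exists>s :: (complex^3) set \<Rightarrow> (complex^3 \<Rightarrow> (complex^'m) set) \<Rightarrow> complex^3 \<Rightarrow> complex.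
        (\<forall>U \<phi>. hol_chart X U \<phi> \<longrightarrow> hol_fun_on U (s U \<phi>) \<and> (\<forall>x\<in>U. s U \<phi> x \<noteq> 0)) \<and>
        (\<forall>U \<phi> V \<psi>. hol_chart X U \<phi> \<and> hol_chart X V \<psi> \<longrightarrow>
           (\<forall>x\<in>U. \<forall>y\<in>V. \<phi> x = \<psi> y \<longrightarrow>
              (\<forall>A. ((\<lambda>u. inv_into V \<psi> (\<phi> u)) has_derivative (\<lambda>h. A *v h)) (at x) \<longrightarrow>
                 s U \<phi> x = s V \<psi> y * det A ^ k))))"

definition calabi_yau_threefold :: "(complex^'m) set set \<Rightarrow> bool" where
  "calabi_yau_threefold X \<longleftrightarrow> projective_threefold X \<and> canonical_class_torsion X"


section \<open>Hypersurfaces and smooth complete intersections\<close>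

definition homogeneous_poly :: "nat \<Rightarrow> (complex^'m \<Rightarrow> complex) \<Rightarrow> bool" where
  "homogeneous_poly d p \<longleftrightarrow>
     (\<exists>c :: ('m \<Rightarrow> nat) \<Rightarrow> complex.
        p = (\<lambda>z. \<Sum>\<alpha> | sum \<alpha> UNIV = d. c \<alpha> * (\<Prod>i\<in>UNIV. z $ i ^ \<alpha> i)))"

definition cgrad :: "(complex^'m \<Rightarrow> complex) \<Rightarrow> complex^'m \<Rightarrow> complex^'m" where
  "cgrad p z = (\<chi> i. deriv (\<lambda>t. p (z + axis i t)) 0)"

definition zero_locus :: "(complex^'m \<Rightarrow> complex) \<Rightarrow> (complex^'m) set set" where
  "zero_locus p = {cline z | z. z \<noteq> 0 \<and> p z = 0}"

text \<open>Jacobian criterion for the hypersurface with equation \<open>p\<close>, and for the (scheme-theoretic)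
  intersection of the hypersurfaces with equations \<open>p\<close> and \<open>q\<close>.\<close>

definition smooth_hypersurface :: "(complex^'m \<Rightarrow> complex) \<Rightarrow> bool" where
  "smooth_hypersurface p \<longleftrightarrow> (\<forall>z. z \<noteq> 0 \<and> p z = 0 \<longrightarrow> cgrad p z \<noteq> 0)"

definition smooth_intersection :: "(complex^'m \<Rightarrow> complex) \<Rightarrow> (complex^'m \<Rightarrow> complex) \<Rightarrow> bool" where
  "smooth_intersection p q \<longleftrightarrow>
     (\<forall>z. z \<noteq> 0 \<and> p z = 0 \<and> q z = 0 \<longrightarrow>
        (\<forall>a b. a *s cgrad p z + b *s cgrad q z = 0 \<longrightarrow> a = 0 \<and> b = 0))"


section \<open>Real structures and real loci\<close>

definition real_structure :: "(complex^'m) set set \<Rightarrow> ((complex^'m) set \<Rightarrow> (complex^'m) set) \<Rightarrow> bool" where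
  "real_structure X \<sigma> \<longleftrightarrow>
     \<sigma> ` X \<subseteq> X \<and> (\<forall>p\<in>X. \<sigma> (\<sigma> p) = p) \<and>
     locally_lifts antihol_map_on (cone X) (\<sigma> \<circ> cline)"

definition real_locus :: "(complex^'m) set set \<Rightarrow> ((complex^'m) set \<Rightarrow> (complex^'m) set) \<Rightarrow> (complex^'m) set set" where
  "real_locus X \<sigma> = {p\<in>X. \<sigma> p = p}"

definition three_torus :: "(complex \<times> complex \<times> complex) set" where
  "three_torus = sphere 0 1 \<times> sphere 0 1 \<times> sphere 0 1"

definition diffeomorphic_to_proj_subset :: "'a::real_normed_vector set \<Rightarrow> (complex^'m) set set \<Rightarrow> bool" where
  "diffeomorphic_to_proj_subset T L \<longleftrightarrow>
     (\<exists>h. bij_betw h T L \<and> locally_lifts smooth_map_on T h \<and>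
          locally_extends smooth_map_on (cone L) (inv_into T h \<circ> cline))"

end

theory Submission
  imports Defs "HOL-Complex_Analysis.Cauchy_Integral_Formula"
begin

text \<open>The threefold is the common zero locus in \<open>P\<^sub>5\<close> of the diagonal forms

  \<open>q = x\<^sub>0\<^sup>2 + x\<^sub>1\<^sup>2 - x\<^sub>2\<^sup>2 - x\<^sub>3\<^sup>2 - x\<^sub>4\<^sup>2 - x\<^sub>5\<^sup>2\<close> and
  \<open>f = x\<^sub>0\<^sup>4 + x\<^sub>1\<^sup>4 + 9 (x\<^sub>2\<^sup>4 + x\<^sub>3\<^sup>4) - 3 (x\<^sub>4\<^sup>4 + x\<^sub>5\<^sup>4)\<close>,

with complex conjugation as real structure.

Smoothness. If the gradients of \<open>\<Sum> a\<^sub>i x\<^sub>i\<^sup>2\<close> and \<open>\<Sum> b\<^sub>i x\<^sub>i\<^sup>4\<close> are dependent at a common zero, then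
\<open>x\<^sub>i\<^sup>2\<close> is proportional to \<open>a\<^sub>i/b\<^sub>i\<close> on the support of \<open>x\<close>, and the quadratic equation says that the
numbers \<open>a\<^sub>i\<^sup>2/b\<^sub>i\<close> sum to zero over this support. Here these numbers are \<open>1, 1, 1/9, 1/9, -1/3, -1/3\<close>
and no nonempty subfamily has sum zero (\<open>smooth_intersection_diag_forms\<close>).

Calabi-Yau. This holds for every smooth complete intersection of bidegree \<open>(d, e)\<close> with
\<open>d + e = 6\<close> and \<open>d, e > 0\<close>. Charts come from the inverse function theorem (\<open>local_chart\<close>). The canonical
bundle is trivialised by the Poincare residue of the volume form of \<open>\<complex>\<^sup>6\<close>: if \<open>z\<close> is a
holomorphic lift of a chart to the affine cone, with partial derivatives \<open>v\<^sub>1, v\<^sub>2, v\<^sub>3\<close>, then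
\<open>det (z, v\<^sub>1, v\<^sub>2, v\<^sub>3, m, n) = s (dq(m) df(n) - dq(n) df(m))\<close> for all \<open>m, n\<close>, since both sides are
alternating forms on the two-dimensional quotient of \<open>\<complex>\<^sup>6\<close> by the tangent space of the cone.
When the lift is multiplied by a function \<open>c\<close>, the left side is multiplied by \<open>c\<^sup>4\<close> and the right
side by \<open>c\<close> to the power \<open>(d - 1) + (e - 1) = 4\<close>, so \<open>s\<close> depends on the chart only
(\<open>residue_form\<close>). It is holomorphic because partial derivatives of holomorphic functions are
holomorphic (\<open>hol_fun_on_frechet_derivative\<close>).

The real locus. Put \<open>E\<^sub>0 = x\<^sub>0 + i x\<^sub>1\<close>, \<open>E\<^sub>1 = x\<^sub>2 + i x\<^sub>3\<close>, \<open>E\<^sub>2 = x\<^sub>4 + i x\<^sub>5\<close> for real \<open>x\<close>. The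
quadric says \<open>|E\<^sub>0|\<^sup>2 = |E\<^sub>1|\<^sup>2 + |E\<^sub>2|\<^sup>2\<close>. The quartic says
\<open>D |E\<^sub>0|\<^sup>4 + A |E\<^sub>1|\<^sup>4 = B |E\<^sub>2|\<^sup>4\<close>, where \<open>D, A, B > 0\<close> depend on the directions \<open>e\<^sub>j\<close> of the
\<open>E\<^sub>j\<close> only and \<open>B > D\<close>. Given the directions, the ratios of the radii are therefore determined by
a quadratic equation with exactly one admissible solution (\<open>real_point_radii\<close>), and
no radius vanishes. So the real points are the triples \<open>(e\<^sub>0, e\<^sub>1, e\<^sub>2)\<close> of unit complex numbers up
to a common sign, and \<open>(e\<^sub>0\<^sup>2, e\<^sub>1/e\<^sub>0, e\<^sub>2/e\<^sub>0)\<close> identifies the quotient with a 3-torus. The sign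
ambiguity does not obstruct a global formula: \<open>e\<^sub>0\<close> times the real vector with directions \<open>e\<^sub>j\<close>
represents the same point and is polynomial in these three coordinates and their conjugates,
apart from the radii (\<open>torus_lift\<close>).\<close>

section \<open>Smooth maps\<close>

lemma bounded_linear_axis: "bounded_linear (\<lambda>c::complex. axis i c :: complex^'m)"
  by (rule linear_conv_bounded_linear[THEN iffD1], rule linearI) (auto simp: axis_def vec_eq_iff)

lemma vec_eq_sum_axis: "v = (\<Sum>i\<in>UNIV. axis i (v $ i))" for v :: "complex^'m"
  by (simp add: vec_eq_iff axis_def if_distrib cong: if_cong)

lemma frechet_derivative_eqI:
  "(f has_derivative f') (at x) \<Longrightarrow> frechet_derivative f (at x) = f'"
  by (metis frechet_derivative_at)

text \<open>Openness matters: the derivative at a point sees a neighbourhood of it.\<close>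

lemma Ck_on_cong:
  assumes "open U" "\<And>x. x \<in> U \<Longrightarrow> f x = g x" "Ck_on k U f"
  shows "Ck_on k U g"
  using assms(2,3)
proof (induction k arbitrary: f g)
  case 0
  then show ?case by (simp cong: continuous_on_cong)
next
  case (Suc k)
  have D: "(g has_derivative frechet_derivative f (at x)) (at x)" if "x \<in> U" for x
  proof -
    have "(f has_derivative frechet_derivative f (at x)) (at x)"
      using Suc.prems(2) that frechet_derivative_works[THEN iffD1] by auto
    then show ?thesis
      using has_derivative_transform_within_open[OF _ \<open>open U\<close> that] Suc.prems(1) by blast
  qed
  have "Ck_on k U (\<lambda>x. frechet_derivative g (at x) v)" for v
    by (rule Suc.IH[of "\<lambda>x. frechet_derivative f (at x) v"])
       (use Suc.prems(2) in \<open>auto simp: frechet_derivative_eqI[OF D]\<close>)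
  then show ?case
    using D by (auto simp: differentiable_def)
qed

text \<open>Derivatives are unique, so an explicit formula for the derivative may replace
\<open>frechet_derivative\<close> in the recursion. Every closure property below is an induction through this
rule.\<close>

lemma Ck_on_SucI:
  assumes "open U" "\<And>x. x \<in> U \<Longrightarrow> (f has_derivative f' x) (at x)"
    and "\<And>v. Ck_on k U (\<lambda>x. f' x v)"
  shows "Ck_on (Suc k) U f"
proof -
  have "Ck_on k U (\<lambda>x. frechet_derivative f (at x) v)" for v
    by (rule Ck_on_cong[OF assms(1) _ assms(3)[of v]])
       (simp add: frechet_derivative_eqI[OF assms(2)])
  then show ?thesis
    using assms(2) by (auto simp: differentiable_def)
qed

lemma Ck_on_SucD:
  "Ck_on (Suc k) U f \<Longrightarrow> Ck_on k U f"
proof (induction k arbitrary: f)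
  case 0
  then have "continuous (at x) f" if "x \<in> U" for x
    using that by (auto intro: differentiable_imp_continuous_within)
  then show ?case
    by (simp add: continuous_at_imp_continuous_on)
next
  case (Suc k)
  then show ?case by (metis Ck_on.simps(2))
qed

lemma Ck_on_derivative:
  "Ck_on (Suc k) U f \<Longrightarrow> x \<in> U \<Longrightarrow> (f has_derivative frechet_derivative f (at x)) (at x)"
  by (auto intro: frechet_derivative_works[THEN iffD1])

lemma Ck_on_const: "open U \<Longrightarrow> Ck_on k U (\<lambda>x. c)"
proof (induction k arbitrary: c)
  case (Suc k)
  show ?case
    by (rule Ck_on_SucI[where f' = "\<lambda>x v. 0"]) (use Suc in auto)
qed simp

lemma Ck_on_bounded_linear:
  assumes "open U" "bounded_linear L"
  shows "Ck_on k U f \<Longrightarrow> Ck_on k U (\<lambda>x. L (f x))"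
proof (induction k arbitrary: f)
  case 0
  then show ?case
    using assms by (auto intro: bounded_linear.continuous_on)
next
  case (Suc k)
  show ?case
  proof (rule Ck_on_SucI[where f' = "\<lambda>x v. L (frechet_derivative f (at x) v)"])
    show "((\<lambda>x. L (f x)) has_derivative (\<lambda>v. L (frechet_derivative f (at x) v))) (at x)"
      if "x \<in> U" for x
      using bounded_linear.has_derivative[OF assms(2) Ck_on_derivative[OF Suc.prems that]] .
    show "Ck_on k U (\<lambda>x. L (frechet_derivative f (at x) v))" for v
      using Suc by auto
  qed fact
qed

lemma Ck_on_linear:
  assumes "open U" "bounded_linear L"
  shows "Ck_on k U L"
proof (cases k)
  case 0
  then show ?thesis
    using assms by (simp add: linear_continuous_on)
next
  case (Suc m)
  show ?thesis
    unfolding Suc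
    by (rule Ck_on_SucI[where f' = "\<lambda>x. L"])
       (use assms in \<open>auto intro: bounded_linear_imp_has_derivative Ck_on_const\<close>)
qed

lemma Ck_on_add:
  assumes "open U"
  shows "Ck_on k U f \<Longrightarrow> Ck_on k U g \<Longrightarrow> Ck_on k U (\<lambda>x. f x + g x)"
proof (induction k arbitrary: f g)
  case 0
  then show ?case by (auto intro: continuous_intros)
next
  case (Suc k)
  show ?case
    by (rule Ck_on_SucI[where f' = "\<lambda>x v. frechet_derivative f (at x) v + frechet_derivative g (at x) v"])
       (use Suc assms in \<open>auto intro!: has_derivative_add frechet_derivative_works[THEN iffD1]\<close>)
qed

lemma Ck_on_sum:
  assumes "open U" "finite I" "\<And>i. i \<in> I \<Longrightarrow> Ck_on k U (f i)"
  shows "Ck_on k U (\<lambda>x. \<Sum>i\<in>I. f i x)"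
  using assms(2,3) by (induction I) (auto intro: Ck_on_const Ck_on_add assms(1))

lemma Ck_on_mult:
  fixes f g :: "'a::real_normed_vector \<Rightarrow> 'b::real_normed_algebra"
  assumes "open U"
  shows "Ck_on k U f \<Longrightarrow> Ck_on k U g \<Longrightarrow> Ck_on k U (\<lambda>x. f x * g x)"
proof (induction k arbitrary: f g)
  case 0
  then show ?case by (auto intro: continuous_intros)
next
  case (Suc k)
  show ?case
  proof (rule Ck_on_SucI[where f' = "\<lambda>x v. f x * frechet_derivative g (at x) v + frechet_derivative f (at x) v * g x"])
    show "((\<lambda>x. f x * g x) has_derivative
        (\<lambda>v. f x * frechet_derivative g (at x) v + frechet_derivative f (at x) v * g x)) (at x)"
      if "x \<in> U" for x
      using has_derivative_mult[OF Ck_on_derivative[OF Suc.prems(1) that] Ck_on_derivative[OF Suc.prems(2) that]] .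
    show "Ck_on k U (\<lambda>x. f x * frechet_derivative g (at x) v + frechet_derivative f (at x) v * g x)" for v
      using Suc.prems Ck_on_SucD[of k U f] Ck_on_SucD[of k U g]
      by (intro Ck_on_add Suc.IH assms) auto
  qed fact
qed

lemma Ck_on_minus:
  assumes "open U" "Ck_on k U f"
  shows "Ck_on k U (\<lambda>x. - f x)"
  using Ck_on_bounded_linear[OF assms(1) bounded_linear_minus[OF bounded_linear_ident] assms(2)] .

lemma Ck_on_diff:
  assumes "open U" "Ck_on k U f" "Ck_on k U g"
  shows "Ck_on k U (\<lambda>x. f x - g x)"
  using Ck_on_add[OF assms(1,2) Ck_on_minus[OF assms(1,3)]] by simp

lemma Ck_on_power:
  fixes f :: "'a::real_normed_vector \<Rightarrow> 'b::real_normed_algebra_1"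
  assumes "open U" "Ck_on k U f"
  shows "Ck_on k U (\<lambda>x. f x ^ n)"
  by (induction n) (auto intro: Ck_on_const Ck_on_mult assms)

text \<open>The derivative of \<open>1/f\<close> is a polynomial in \<open>1/f\<close> and the derivative of \<open>f\<close>, so the induction
hypothesis for \<open>1/f\<close> itself closes the step. The square root below is treated in the same way.\<close>

lemma Ck_on_inverse:
  fixes f :: "'a::real_normed_vector \<Rightarrow> 'b::real_normed_field"
  assumes "open U" "\<And>x. x \<in> U \<Longrightarrow> f x \<noteq> 0"
  shows "Ck_on k U f \<Longrightarrow> Ck_on k U (\<lambda>x. inverse (f x))"
proof (induction k)
  case 0
  then show ?case using assms by (auto intro: continuous_intros)
next
  case (Suc k)
  show ?case
  proof (rule Ck_on_SucI[where f' = "\<lambda>x v. - (inverse (f x) * frechet_derivative f (at x) v * inverse (f x))"])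
    show "((\<lambda>x. inverse (f x)) has_derivative
        (\<lambda>v. - (inverse (f x) * frechet_derivative f (at x) v * inverse (f x)))) (at x)"
      if "x \<in> U" for x
      using Deriv.has_derivative_inverse[OF assms(2)[OF that] Ck_on_derivative[OF Suc.prems(1) that]] .
    show "Ck_on k U (\<lambda>x. - (inverse (f x) * frechet_derivative f (at x) v * inverse (f x)))" for v
      using Suc.prems Ck_on_SucD[of k U f]
      by (intro Ck_on_minus Ck_on_mult Suc.IH assms(1)) auto
  qed fact
qed

lemma Ck_on_divide:
  fixes f :: "'a::real_normed_vector \<Rightarrow> 'b::real_normed_field"
  assumes "open U" "Ck_on k U f" "Ck_on k U g" "\<And>x. x \<in> U \<Longrightarrow> g x \<noteq> 0"
  shows "Ck_on k U (\<lambda>x. f x / g x)"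
  unfolding divide_inverse
  by (intro Ck_on_mult Ck_on_inverse assms)

lemma Ck_on_sqrt:
  assumes "open U" "\<And>x. x \<in> U \<Longrightarrow> f x > 0"
  shows "Ck_on k U f \<Longrightarrow> Ck_on k U (\<lambda>x. sqrt (f x))"
proof (induction k)
  case 0
  then show ?case by (auto intro: continuous_intros)
next
  case (Suc k)
  show ?case
  proof (rule Ck_on_SucI[where f' = "\<lambda>x v. frechet_derivative f (at x) v * inverse (2 * sqrt (f x))"])
    show "((\<lambda>x. sqrt (f x)) has_derivative
        (\<lambda>v. frechet_derivative f (at x) v * inverse (2 * sqrt (f x)))) (at x)"
      if "x \<in> U" for x
      by (rule has_derivative_eq_rhs[OF has_derivative_real_sqrt[OF assms(2)[OF that] Ck_on_derivative[OF Suc.prems(1) that]]])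
         (auto simp: fun_eq_iff)
    show "Ck_on k U (\<lambda>x. frechet_derivative f (at x) v * inverse (2 * sqrt (f x)))" for v
      using Suc.prems Ck_on_SucD[of k U f] assms(2)
      by (intro Ck_on_mult Ck_on_inverse Ck_on_const Suc.IH assms(1)) (auto simp: less_imp_neq[symmetric])
  qed fact
qed

lemma Ck_on_vec:
  fixes f :: "'a::real_normed_vector \<Rightarrow> complex^'m"
  assumes "open U" "\<And>i. Ck_on k U (\<lambda>x. f x $ i)"
  shows "Ck_on k U f"
proof -
  have "Ck_on k U (\<lambda>x. \<Sum>i\<in>UNIV. axis i (f x $ i))"
    by (intro Ck_on_sum Ck_on_bounded_linear[OF _ bounded_linear_axis] assms) auto
  then show ?thesis by (simp flip: vec_eq_sum_axis)
qed

lemma Ck_on_Pair: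
  assumes "open U" "Ck_on k U f" "Ck_on k U g"
  shows "Ck_on k U (\<lambda>x. (f x, g x))"
proof -
  have "Ck_on k U (\<lambda>x. (f x, 0) + (0, g x))"
    by (intro Ck_on_add Ck_on_bounded_linear[of U "\<lambda>y. (y, 0)"] Ck_on_bounded_linear[of U "\<lambda>y. (0, y)"] assms bounded_linear_intros)
  then show ?thesis by simp
qed

section \<open>Holomorphic functions of several variables\<close>

lemma norm_smult_complex: "norm (c *s v :: complex^'n) = norm c * norm v"
  by (simp add: norm_vec_def norm_mult L2_set_right_distrib)

text \<open>Complex linearity of the derivative is easier to carry through constructions than an explicit
coefficient vector.\<close>

lemma hol_fun_on_iff:
  fixes f :: "complex^'n \<Rightarrow> complex"
  shows "hol_fun_on U f \<longleftrightarrow> open U \<and>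
     (\<forall>x\<in>U. \<exists>f'. (f has_derivative f') (at x) \<and> (\<forall>c h. f' (c *s h) = c * f' h))"
proof -
  have "(\<exists>a::complex^'n. (f has_derivative (\<lambda>h. \<Sum>i\<in>UNIV. a $ i * h $ i)) (at x)) \<longleftrightarrow>
     (\<exists>f'. (f has_derivative f') (at x) \<and> (\<forall>c h. f' (c *s h) = c * f' h))" for x
  proof safe
    fix f' assume f': "(f has_derivative f') (at x)" "\<forall>c h. f' (c *s h) = c * f' h"
    interpret bounded_linear f' using f'(1) by (rule has_derivative_bounded_linear)
    have "f' h = (\<Sum>i\<in>UNIV. (\<chi> i. f' (axis i 1)) $ i * h $ i)" for h
    proof -
      have "h = (\<Sum>i\<in>UNIV. h $ i *s axis i 1)" by (simp add: basis_expansion)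
      then have "f' h = (\<Sum>i\<in>UNIV. f' (h $ i *s axis i 1))"
        by (metis (mono_tags, lifting) sum sum.cong)
      then show ?thesis using f'(2) by (simp add: mult.commute)
    qed
    then have "f' = (\<lambda>h. \<Sum>i\<in>UNIV. (\<chi> i. f' (axis i 1)) $ i * h $ i)" by blast
    then show "\<exists>a::complex^'n. (f has_derivative (\<lambda>h. \<Sum>i\<in>UNIV. a $ i * h $ i)) (at x)"
      using f'(1) by metis
  next
    fix a :: "complex^'n" assume "(f has_derivative (\<lambda>h. \<Sum>i\<in>UNIV. a $ i * h $ i)) (at x)"
    then show "\<exists>f'. (f has_derivative f') (at x) \<and> (\<forall>c h. f' (c *s h) = c * f' h)"
      by (intro exI[of _ "\<lambda>h. \<Sum>i\<in>UNIV. a $ i * h $ i"]) (simp add: sum_distrib_left mult_ac)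
  qed
  then show ?thesis by (simp add: hol_fun_on_def)
qed

lemma hol_fun_on_derivative:
  assumes "hol_fun_on U f" "x \<in> U"
  shows "(f has_derivative frechet_derivative f (at x)) (at x)"
    and "frechet_derivative f (at x) (c *s h) = c * frechet_derivative f (at x) h"
  using assms frechet_derivative_at unfolding hol_fun_on_iff by metis+

lemma hol_fun_onI:
  assumes "open U" "\<And>x. x \<in> U \<Longrightarrow> (f has_derivative f' x) (at x)"
    "\<And>x c h. x \<in> U \<Longrightarrow> f' x (c *s h) = c * f' x h"
  shows "hol_fun_on U f"
  using assms unfolding hol_fun_on_iff by blast

lemma hol_fun_on_cong:
  assumes "hol_fun_on U f" "\<And>x. x \<in> U \<Longrightarrow> f x = g x"
  shows "hol_fun_on U g"
proof (rule hol_fun_onI[where f' = "\<lambda>x. frechet_derivative f (at x)"])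
  show U: "open U" using assms(1) by (simp add: hol_fun_on_def)
  show "(g has_derivative frechet_derivative f (at x)) (at x)" if "x \<in> U" for x
    by (rule has_derivative_transform_within_open[OF hol_fun_on_derivative(1)[OF assms(1) that] U that])
       (use assms(2) in auto)
qed (use hol_fun_on_derivative(2)[OF assms(1)] in auto)

lemma hol_fun_on_subset: "hol_fun_on U f \<Longrightarrow> open V \<Longrightarrow> V \<subseteq> U \<Longrightarrow> hol_fun_on V f"
  unfolding hol_fun_on_def by blast

lemma hol_fun_on_local:
  assumes "\<And>x. x \<in> U \<Longrightarrow> \<exists>V. x \<in> V \<and> V \<subseteq> U \<and> hol_fun_on V f"
  shows "hol_fun_on U f"
  unfolding hol_fun_on_def
proof safe
  show "open U" using assms unfolding hol_fun_on_def by (subst open_subopen) metis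
qed (use assms in \<open>force simp: hol_fun_on_def\<close>)

lemma hol_fun_on_continuous: "hol_fun_on U f \<Longrightarrow> continuous_on U f"
  by (meson continuous_at_imp_continuous_on has_derivative_continuous hol_fun_on_derivative(1))

lemma hol_fun_on_const: "open U \<Longrightarrow> hol_fun_on U (\<lambda>x. c)"
  by (rule hol_fun_onI[where f' = "\<lambda>x h. 0"]) auto

lemma hol_fun_on_nth: "open U \<Longrightarrow> hol_fun_on U (\<lambda>x. x $ i)"
  by (rule hol_fun_onI[where f' = "\<lambda>x h. h $ i"])
     (auto intro: bounded_linear_imp_has_derivative bounded_linear_vec_nth)

lemma hol_fun_on_add:
  assumes "hol_fun_on U f" "hol_fun_on U g" shows "hol_fun_on U (\<lambda>x. f x + g x)"
  by (rule hol_fun_onI[where f' = "\<lambda>x h. frechet_derivative f (at x) h + frechet_derivative g (at x) h"])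
     (use assms in \<open>auto simp: hol_fun_on_derivative(2) distrib_left hol_fun_on_def
       intro!: has_derivative_add hol_fun_on_derivative(1)\<close>)

lemma hol_fun_on_mult:
  assumes "hol_fun_on U f" "hol_fun_on U g" shows "hol_fun_on U (\<lambda>x. f x * g x)"
proof (rule hol_fun_onI[where f' = "\<lambda>x h. f x * frechet_derivative g (at x) h + frechet_derivative f (at x) h * g x"])
  show "((\<lambda>x. f x * g x) has_derivative
      (\<lambda>h. f x * frechet_derivative g (at x) h + frechet_derivative f (at x) h * g x)) (at x)"
    if "x \<in> U" for x
    by (intro has_derivative_mult hol_fun_on_derivative(1)[OF assms(1) that] hol_fun_on_derivative(1)[OF assms(2) that])
qed (use assms in \<open>auto simp: hol_fun_on_derivative(2) algebra_simps hol_fun_on_def\<close>)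

lemma hol_fun_on_inverse:
  assumes "hol_fun_on U f" "\<And>x. x \<in> U \<Longrightarrow> f x \<noteq> 0" shows "hol_fun_on U (\<lambda>x. inverse (f x))"
  by (rule hol_fun_onI[where f' = "\<lambda>x h. - (inverse (f x) * frechet_derivative f (at x) h * inverse (f x))"])
     (use assms in \<open>auto simp: hol_fun_on_derivative(2) hol_fun_on_def
       intro!: Deriv.has_derivative_inverse hol_fun_on_derivative(1)\<close>)

lemma hol_fun_on_divide:
  assumes "hol_fun_on U f" "hol_fun_on U g" "\<And>x. x \<in> U \<Longrightarrow> g x \<noteq> 0"
  shows "hol_fun_on U (\<lambda>x. f x / g x)"
  unfolding divide_inverse by (intro hol_fun_on_mult hol_fun_on_inverse assms)

lemma hol_fun_on_diff:
  assumes "hol_fun_on U f" "hol_fun_on U g" shows "hol_fun_on U (\<lambda>x. f x - g x)"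
  using hol_fun_on_add[OF assms(1) hol_fun_on_mult[OF hol_fun_on_const[of U "-1"] assms(2)]] assms(1)
  by (simp add: hol_fun_on_def)

lemma hol_fun_on_sum:
  assumes "open U" "\<And>i. i \<in> I \<Longrightarrow> hol_fun_on U (f i)"
  shows "hol_fun_on U (\<lambda>x. \<Sum>i\<in>I. f i x)"
  using assms(2) by (induction I rule: infinite_finite_induct) (auto intro: hol_fun_on_const hol_fun_on_add assms(1))

lemma hol_fun_on_prod:
  assumes "open U" "\<And>i. i \<in> I \<Longrightarrow> hol_fun_on U (f i)"
  shows "hol_fun_on U (\<lambda>x. \<Prod>i\<in>I. f i x)"
  using assms(2) by (induction I rule: infinite_finite_induct) (auto intro: hol_fun_on_const hol_fun_on_mult assms(1))

lemma hol_fun_on_power: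
  assumes "hol_fun_on U f" shows "hol_fun_on U (\<lambda>x. f x ^ n)"
  using hol_fun_on_prod[of U "{..<n}" "\<lambda>_. f"] assms by (simp add: hol_fun_on_def)

lemma hol_fun_on_det:
  assumes "open U" "\<And>i j. hol_fun_on U (\<lambda>x. M x $ i $ j)"
  shows "hol_fun_on U (\<lambda>x. det (M x))"
  unfolding det_def by (intro hol_fun_on_sum hol_fun_on_mult hol_fun_on_prod hol_fun_on_const assms)

lemma has_derivative_vecI:
  fixes F :: "'a::real_normed_vector \<Rightarrow> complex^'m"
  assumes "\<And>i. ((\<lambda>x. F x $ i) has_derivative (\<lambda>h. F' h $ i)) (at x)"
  shows "(F has_derivative F') (at x)"
proof -
  have "((\<lambda>x. \<Sum>i\<in>UNIV. axis i (F x $ i)) has_derivative (\<lambda>h. \<Sum>i\<in>UNIV. axis i (F' h $ i))) (at x)"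
    by (intro has_derivative_sum bounded_linear.has_derivative[OF bounded_linear_axis] assms)
  then show ?thesis by (simp flip: vec_eq_sum_axis)
qed

lemma hol_map_on_iff:
  "hol_map_on U F \<longleftrightarrow> open U \<and>
     (\<forall>x\<in>U. \<exists>F'. (F has_derivative F') (at x) \<and> (\<forall>c h. F' (c *s h) = c *s F' h))"
proof safe
  assume F: "hol_map_on U F"
  then have F': "hol_fun_on U (\<lambda>z. F z $ j)" for j unfolding hol_map_on_def by blast
  then show "open U" by (auto simp: hol_fun_on_def)
  fix x assume x: "x \<in> U"
  define F' where "F' h = (\<chi> j. frechet_derivative (\<lambda>z. F z $ j) (at x) h)" for h
  have "(F has_derivative F') (at x)"
    by (rule has_derivative_vecI) (simp add: F'_def hol_fun_on_derivative(1)[OF F' x])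
  moreover have "F' (c *s h) = c *s F' h" for c h
    by (simp add: F'_def vec_eq_iff hol_fun_on_derivative(2)[OF F' x])
  ultimately show "\<exists>F'. (F has_derivative F') (at x) \<and> (\<forall>c h. F' (c *s h) = c *s F' h)" by blast
next
  assume U: "open U" and D: "\<forall>x\<in>U. \<exists>F'. (F has_derivative F') (at x) \<and> (\<forall>c h. F' (c *s h) = c *s F' h)"
  show "hol_map_on U F"
    unfolding hol_map_on_def hol_fun_on_iff
  proof safe
    fix j x assume "x \<in> U"
    with D obtain F' where "(F has_derivative F') (at x)" "\<forall>c h. F' (c *s h) = c *s F' h" by blast
    then show "\<exists>f'. ((\<lambda>z. F z $ j) has_derivative f') (at x) \<and> (\<forall>c h. f' (c *s h) = c * f' h)"
      by (intro exI[of _ "\<lambda>h. F' h $ j"] conjI bounded_linear.has_derivative[OF bounded_linear_vec_nth]) auto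
  qed (use U in auto)
qed

lemma hol_fun_on_compose:
  assumes "hol_fun_on W g" "hol_map_on V F" "\<And>x. x \<in> V \<Longrightarrow> F x \<in> W"
  shows "hol_fun_on V (\<lambda>x. g (F x))"
  unfolding hol_fun_on_iff
proof (intro conjI ballI)
  show "open V" using assms(2) by (simp add: hol_map_on_iff)
  fix x assume x: "x \<in> V"
  then obtain F' where F': "(F has_derivative F') (at x)" "\<And>c h. F' (c *s h) = c *s F' h"
    using assms(2) unfolding hol_map_on_iff by blast
  show "\<exists>f'. ((\<lambda>x. g (F x)) has_derivative f') (at x) \<and> (\<forall>c h. f' (c *s h) = c * f' h)"
    using has_derivative_compose[OF F'(1) hol_fun_on_derivative(1)[OF assms(1) assms(3)[OF x]]]
    by (intro exI conjI) (auto simp: F'(2) hol_fun_on_derivative(2)[OF assms(1) assms(3)[OF x]])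
qed

lemma hol_map_on_ident: "open U \<Longrightarrow> hol_map_on U (\<lambda>z. z)"
  unfolding hol_map_on_def by (simp add: hol_fun_on_nth)

lemma hol_map_on_continuous: "hol_map_on U F \<Longrightarrow> continuous_on U F"
  unfolding hol_map_on_iff
  by (meson continuous_at_imp_continuous_on has_derivative_continuous)

lemma hol_line_derivative:
  assumes "hol_fun_on U f" "x + t *s v \<in> U"
  shows "((\<lambda>t. f (x + t *s v)) has_field_derivative frechet_derivative f (at (x + t *s v)) v) (at t)"
proof -
  have L: "bounded_linear (\<lambda>t::complex. t *s v)"
    by (rule linear_conv_bounded_linear[THEN iffD1], rule linearI) (auto simp: vec_eq_iff algebra_simps)
  have "((\<lambda>t. x + t *s v) has_derivative (\<lambda>h. h *s v)) (at t)"
    using has_derivative_add[OF has_derivative_const bounded_linear_imp_has_derivative[OF L], of x] by simp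
  then have "((\<lambda>t. f (x + t *s v)) has_derivative (\<lambda>h. frechet_derivative f (at (x + t *s v)) (h *s v))) (at t)"
    using has_derivative_compose hol_fun_on_derivative(1)[OF assms] by blast
  then show ?thesis
    unfolding has_field_derivative_def hol_fun_on_derivative(2)[OF assms] by (simp add: mult.commute[of _ "frechet_derivative f _ _"])
qed

lemma hol_line_holomorphic:
  assumes "hol_fun_on U f" "\<And>t. t \<in> S \<Longrightarrow> x + t *s v \<in> U"
  shows "(\<lambda>t. f (x + t *s v)) holomorphic_on S"
  using hol_line_derivative[OF assms(1)] assms(2)
  by (meson field_differentiable_at_within field_differentiable_def holomorphic_on_def)

text \<open>Cauchy's inequality for \<open>f\<close> restricted to the complex line through \<open>x\<close> in direction \<open>v\<close>, where
the disc of radius \<open>r / |v|\<close> is available.\<close>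

lemma hol_derivative_bound:
  assumes f: "hol_fun_on U f" and r: "r > 0" "cball x r \<subseteq> U"
    and B: "\<And>y. y \<in> cball x r \<Longrightarrow> norm (f y) \<le> B"
  shows "norm (frechet_derivative f (at x) v) \<le> B / r * norm v"
proof (cases "v = 0")
  case True
  have "x \<in> U" using r by auto
  then have "frechet_derivative f (at x) 0 = 0"
    using hol_fun_on_derivative(1)[OF f] has_derivative_bounded_linear linear_simps(3) by blast
  then show ?thesis using True by simp
next
  case False
  define \<rho> where "\<rho> = r / norm v"
  have \<rho>: "\<rho> > 0" using r False by (simp add: \<rho>_def)
  have inball: "x + t *s v \<in> cball x r" if "t \<in> cball 0 \<rho>" for t
    using that False r by (simp add: \<rho>_def dist_norm norm_smult_complex field_simps)
  let ?g = "\<lambda>t. f (x + t *s v)"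
  have hol: "?g holomorphic_on cball 0 \<rho>"
    using hol_line_holomorphic[OF f] inball r by blast
  have "norm ((deriv ^^ 1) ?g 0) \<le> fact 1 * B / \<rho> ^ 1"
  proof (rule Cauchy_inequality[OF _ _ \<rho>])
    show "?g holomorphic_on ball 0 \<rho>" using hol by (rule holomorphic_on_subset) auto
    show "continuous_on (cball 0 \<rho>) ?g" using hol by (rule holomorphic_on_imp_continuous_on)
    show "norm (?g t) \<le> B" if "norm (0 - t) = \<rho>" for t
      using B inball that by auto
  qed
  moreover have "deriv ?g 0 = frechet_derivative f (at x) v"
    using hol_line_derivative[OF f, of x 0 v] subsetD[OF r(2), of x] r(1)
    by (auto intro!: DERIV_imp_deriv)
  ultimately show ?thesis by (simp add: \<rho>_def)
qed

text \<open>First-order Taylor expansion on the same line. On the disc of half the radius, Cauchy's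
inequality bounds the second derivative by \<open>2 B / (\<rho>/2)\<^sup>2\<close>, which is where the factor 8 comes from.\<close>

lemma hol_remainder_bound:
  assumes f: "hol_fun_on U f" and r: "r > 0" "cball x r \<subseteq> U"
    and B: "\<And>y. y \<in> cball x r \<Longrightarrow> norm (f y) \<le> B"
    and t: "2 * (norm t * norm v) \<le> r"
  shows "norm (f (x + t *s v) - f x - t * frechet_derivative f (at x) v)
           \<le> 8 * B * (norm v)\<^sup>2 / r\<^sup>2 * (norm t)\<^sup>2"
proof (cases "v = 0")
  case True
  have "x \<in> U" using r by auto
  then have "frechet_derivative f (at x) 0 = 0"
    using hol_fun_on_derivative(1)[OF f] has_derivative_bounded_linear linear_simps(3) by blast
  then show ?thesis using True by simp
next
  case False
  define \<rho> where "\<rho> = r / norm v"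
  have \<rho>: "\<rho> > 0" using r False by (simp add: \<rho>_def)
  have inball: "x + t *s v \<in> cball x r" if "t \<in> cball 0 \<rho>" for t
    using that False r by (simp add: \<rho>_def dist_norm norm_smult_complex field_simps)
  let ?g = "\<lambda>t. f (x + t *s v)"
  have hol: "?g holomorphic_on cball 0 \<rho>"
    using hol_line_holomorphic[OF f] inball r by blast
  have holb: "?g holomorphic_on ball 0 \<rho>" using hol by (rule holomorphic_on_subset) auto
  have t': "t \<in> cball 0 (\<rho>/2)" using t False by (simp add: \<rho>_def field_simps)
  have sub: "cball s (\<rho>/2) \<subseteq> cball 0 \<rho>" if "s \<in> cball 0 (\<rho>/2)" for s :: complex
    using that by (intro cball_subset_cball_iff[THEN iffD2]) (auto simp: dist_norm)
  have "norm ((deriv ^^ 0) ?g t - (\<Sum>i\<le>1. (deriv ^^ i) ?g 0 * (t-0) ^ i / (fact i)))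
      \<le> (8 * B / \<rho>\<^sup>2) * norm (t - 0)^(Suc 1) / fact 1"
  proof (rule complex_Taylor[where S = "cball 0 (\<rho>/2)"])
    show "((deriv ^^ i) ?g has_field_derivative (deriv ^^ Suc i) ?g s) (at s within cball 0 (\<rho>/2))"
      if "s \<in> cball 0 (\<rho>/2)" for s i
    proof -
      have "s \<in> ball 0 \<rho>" using that \<rho> by auto
      then show ?thesis
        using holomorphic_derivI[OF holomorphic_higher_deriv[OF holb open_ball, of i] open_ball]
        by (auto intro: has_field_derivative_at_within)
    qed
    show "norm ((deriv ^^ Suc 1) ?g s) \<le> 8 * B / \<rho>\<^sup>2" if s: "s \<in> cball 0 (\<rho>/2)" for s
    proof -
      have "norm ((deriv ^^ Suc 1) ?g s) \<le> fact (Suc 1) * B / (\<rho>/2) ^ (Suc 1)"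
      proof (rule Cauchy_inequality)
        show "?g holomorphic_on ball s (\<rho>/2)"
          using hol sub[OF s] ball_subset_cball by (metis holomorphic_on_subset order_trans)
        show "continuous_on (cball s (\<rho>/2)) ?g"
          using hol sub[OF s] holomorphic_on_imp_continuous_on holomorphic_on_subset by blast
        show "norm (?g u) \<le> B" if "norm (s - u) = \<rho>/2" for u
        proof -
          have "u \<in> cball s (\<rho>/2)" using that by (simp add: dist_norm)
          then show ?thesis using B inball sub[OF s] by blast
        qed
      qed (use \<rho> in auto)
      then show ?thesis by (simp add: power2_eq_square field_simps numeral_2_eq_2)
    qed
  qed (use t' \<rho> in auto)
  moreover have "deriv ?g 0 = frechet_derivative f (at x) v"
    using hol_line_derivative[OF f, of x 0 v] subsetD[OF r(2), of x] r(1)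
    by (auto intro!: DERIV_imp_deriv)
  ultimately show ?thesis
    by (simp add: \<rho>_def power2_eq_square mult_ac diff_diff_eq)
qed

text \<open>By Cauchy's inequality the derivatives of a uniformly convergent sequence are uniformly
Cauchy on a smaller ball, so the limit can be differentiated termwise, and complex
linearity survives the limit.\<close>

lemma hol_uniform_limit:
  fixes f :: "nat \<Rightarrow> complex^'n \<Rightarrow> complex"
  assumes r: "r > 0" and f: "\<And>n. hol_fun_on (ball x0 (2*r)) (f n)"
    and lim: "uniform_limit (ball x0 (2*r)) f g sequentially"
  shows "hol_fun_on (ball x0 r) g"
proof -
  let ?D = "\<lambda>n x. frechet_derivative (f n) (at x)"
  have sub: "ball x0 r \<subseteq> ball x0 (2*r)" using r by auto
  have cauchy: "\<exists>N. \<forall>m\<ge>N. \<forall>n\<ge>N. \<forall>x\<in>ball x0 r. \<forall>h. norm (?D n x h - ?D m x h) \<le> e * norm h"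
    if e: "e > 0" for e
  proof -
    have "\<forall>\<^sub>F n in sequentially. \<forall>y\<in>ball x0 (2*r). dist (f n y) (g y) < e * r / 4"
      using uniform_limitD[OF lim, of "e * r / 4"] e r by simp
    then obtain N where N: "\<And>n y. n \<ge> N \<Longrightarrow> y \<in> ball x0 (2*r) \<Longrightarrow> dist (f n y) (g y) < e * r / 4"
      unfolding eventually_sequentially by blast
    have "norm (?D n x h - ?D m x h) \<le> e * norm h"
      if "m \<ge> N" "n \<ge> N" "x \<in> ball x0 r" for m n x h
    proof -
      have x: "x \<in> ball x0 (2*r)" using that sub by auto
      have "norm (frechet_derivative (\<lambda>y. f n y - f m y) (at x) h) \<le> (e * r / 2) / (r/2) * norm h"
      proof (rule hol_derivative_bound[OF hol_fun_on_diff[OF f f]])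
        show "cball x (r/2) \<subseteq> ball x0 (2*r)"
        proof
          fix y assume "y \<in> cball x (r/2)"
          then show "y \<in> ball x0 (2*r)"
            using that(3) r dist_triangle[of x0 y x] by auto
        qed
        then show "norm (f n y - f m y) \<le> e * r / 2" if "y \<in> cball x (r/2)" for y
          using N[of n y] N[of m y] dist_triangle2[of "f n y" "f m y" "g y"] \<open>m \<ge> N\<close> \<open>n \<ge> N\<close> that
          by (force simp: dist_norm)
      qed (use r in auto)
      moreover have "frechet_derivative (\<lambda>y. f n y - f m y) (at x) h = ?D n x h - ?D m x h"
        using frechet_derivative_at[OF has_derivative_diff[OF hol_fun_on_derivative(1)[OF f x] hol_fun_on_derivative(1)[OF f x]], of n m]
        by metis
      ultimately show ?thesis using r by simp
    qed
    then show ?thesis by blast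
  qed
  define g' where "g' x h = lim (\<lambda>n. ?D n x h)" for x h
  have g': "(\<lambda>n. ?D n x h) \<longlonglongrightarrow> g' x h" if x: "x \<in> ball x0 r" for x h
  proof -
    have "Cauchy (\<lambda>n. ?D n x h)"
    proof (rule CauchyI)
      fix e :: real assume "e > 0"
      then have "e / (norm h + 1) > 0" by (simp add: add_nonneg_pos)
      from cauchy[OF this] x obtain N where
        N: "\<And>m n. m \<ge> N \<Longrightarrow> n \<ge> N \<Longrightarrow> norm (?D m x h - ?D n x h) \<le> e / (norm h + 1) * norm h"
        by blast
      have "e / (norm h + 1) * norm h < e"
        using \<open>e / (norm h + 1) > 0\<close> mult_strict_left_mono[of "norm h" "norm h + 1" "e / (norm h + 1)"]
          norm_ge_zero[of h] by (auto simp: add_nonneg_eq_0_iff)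
      then show "\<exists>M. \<forall>m\<ge>M. \<forall>n\<ge>M. norm (?D m x h - ?D n x h) < e"
        using N by (meson le_less_trans)
    qed
    then show ?thesis by (simp add: g'_def Cauchy_convergent_iff convergent_LIMSEQ_iff)
  qed
  have "\<exists>g2. \<forall>x\<in>ball x0 r. (\<lambda>n. f n x) \<longlonglongrightarrow> g2 x \<and> (g2 has_derivative g' x) (at x within ball x0 r)"
  proof (rule has_derivative_sequence[OF convex_ball, of x0 r f ?D g' x0 "g x0"])
    show "(f n has_derivative ?D n x) (at x within ball x0 r)" if "x \<in> ball x0 r" for n x
      using has_derivative_at_withinI[OF hol_fun_on_derivative(1)[OF f, of x n]] that sub by auto
    show "\<forall>\<^sub>F n in sequentially. \<forall>x\<in>ball x0 r. \<forall>h. norm (?D n x h - g' x h) \<le> e * norm h" if "e > 0" for e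
    proof -
      obtain N where N: "\<And>m n x h. m \<ge> N \<Longrightarrow> n \<ge> N \<Longrightarrow> x \<in> ball x0 r \<Longrightarrow> norm (?D n x h - ?D m x h) \<le> e * norm h"
        using cauchy[OF \<open>e > 0\<close>] by blast
      have "norm (?D n x h - g' x h) \<le> e * norm h" if "n \<ge> N" "x \<in> ball x0 r" for n x h
      proof (rule LIMSEQ_le_const2)
        show "(\<lambda>m. norm (?D n x h - ?D m x h)) \<longlonglongrightarrow> norm (?D n x h - g' x h)"
          by (intro tendsto_intros g' that)
        show "\<exists>N. \<forall>m\<ge>N. norm (?D n x h - ?D m x h) \<le> e * norm h" using N that by blast
      qed
      then show ?thesis unfolding eventually_sequentially by blast
    qed
    show "(\<lambda>n. f n x0) \<longlonglongrightarrow> g x0" using tendsto_uniform_limitI[OF lim] r by auto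
  qed (use r in auto)
  then obtain g2 where g2: "\<And>x. x \<in> ball x0 r \<Longrightarrow> (\<lambda>n. f n x) \<longlonglongrightarrow> g2 x"
    "\<And>x. x \<in> ball x0 r \<Longrightarrow> (g2 has_derivative g' x) (at x within ball x0 r)" by blast
  have "hol_fun_on (ball x0 r) g2"
  proof (rule hol_fun_onI[where f' = g'])
    show "(g2 has_derivative g' x) (at x)" if "x \<in> ball x0 r" for x
      using g2(2)[OF that] at_within_open[OF that open_ball] by simp
    show "g' x (c *s h) = c * g' x h" if x: "x \<in> ball x0 r" for x c h
    proof (rule LIMSEQ_unique[OF g'[OF x]])
      have "x \<in> ball x0 (2*r)" using x sub by auto
      then show "(\<lambda>n. ?D n x (c *s h)) \<longlonglongrightarrow> c * g' x h"
        by (simp add: hol_fun_on_derivative(2)[OF f] tendsto_mult_left[OF g'[OF x]])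
    qed
  qed auto
  moreover have "g2 x = g x" if "x \<in> ball x0 r" for x
    using LIMSEQ_unique[OF g2(1)[OF that]] tendsto_uniform_limitI[OF lim, of x] that sub by auto
  ultimately show ?thesis by (rule hol_fun_on_cong)
qed

text \<open>A directional derivative is the locally uniform limit of difference quotients, which are
holomorphic; the remainder estimate gives the uniformity.\<close>

lemma hol_fun_on_frechet_derivative:
  assumes f: "hol_fun_on U f"
  shows "hol_fun_on U (\<lambda>x. frechet_derivative f (at x) v)"
proof (rule hol_fun_on_local)
  fix x0 assume "x0 \<in> U"
  moreover have "open U" using f by (simp add: hol_fun_on_def)
  ultimately obtain e where e: "e > 0" "cball x0 e \<subseteq> U" by (meson open_contains_cball)
  define r where "r = e / 4"
  have r: "r > 0" "cball x0 (4*r) \<subseteq> U" using e by (auto simp: r_def)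
  have "compact (f ` cball x0 (4*r))"
    using hol_fun_on_continuous[OF f] r by (intro compact_continuous_image) (auto intro: continuous_on_subset)
  then obtain B where B: "\<And>y. y \<in> cball x0 (4*r) \<Longrightarrow> norm (f y) \<le> B"
    using compact_imp_bounded bounded_iff by (metis imageI)
  have sub: "cball x (2*r) \<subseteq> cball x0 (4*r)" if "x \<in> ball x0 (2*r)" for x
    using that r by (intro cball_subset_cball_iff[THEN iffD2]) (auto simp: dist_commute)
  \<comment> \<open>Step sizes of the difference quotients; dropping the first \<open>N\<close> keeps the shifted points inside \<open>U\<close>.\<close>
  define t where "t n = inverse (complex_of_nat (Suc n))" for n
  have t0: "t n \<noteq> 0" for n by (simp add: t_def del: of_nat_Suc)
  have tlim: "t \<longlonglongrightarrow> 0"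
    unfolding t_def by (rule LIMSEQ_Suc) (rule lim_inverse_n)
  have "(\<lambda>n. 2 * (norm (t n) * norm v)) \<longlonglongrightarrow> 2 * (norm (0::complex) * norm v)"
    by (intro tendsto_intros tlim)
  then have "\<forall>\<^sub>F n in sequentially. 2 * (norm (t n) * norm v) < 2 * r"
    by (rule order_tendstoD) (use r in auto)
  then obtain N where N: "\<And>n. n \<ge> N \<Longrightarrow> 2 * (norm (t n) * norm v) < 2 * r"
    unfolding eventually_sequentially by blast
  define q where "q n x = (f (x + t (n + N) *s v) - f x) / t (n + N)" for n x
  have "hol_fun_on (ball x0 r) (\<lambda>x. frechet_derivative f (at x) v)"
  proof (rule hol_uniform_limit[OF r(1), of x0 q])
    fix n
    let ?w = "t (n + N) *s v"
    have w: "norm ?w \<le> r" using N[of "n + N"] by (simp add: norm_smult_complex)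
    have inU: "x \<in> U" "x + ?w \<in> U" if "x \<in> ball x0 (2*r)" for x
    proof -
      have "x + ?w \<in> cball x (2*r)" using w r by (simp add: dist_norm)
      then show "x + ?w \<in> U" using sub[OF that] r by blast
      show "x \<in> U" using subsetD[OF sub[OF that], of x] r by (auto simp: dist_norm)
    qed
    have "hol_fun_on (ball x0 (2*r)) (\<lambda>x. f (x + ?w))"
    proof (rule hol_fun_onI[where f' = "\<lambda>x. frechet_derivative f (at (x + ?w))"])
      fix x assume x: "x \<in> ball x0 (2*r)"
      have "((\<lambda>x. x + ?w) has_derivative (\<lambda>h. h)) (at x)"
        by (auto intro!: derivative_eq_intros)
      from has_derivative_compose[OF this hol_fun_on_derivative(1)[OF f inU(2)[OF x]]]
      show "((\<lambda>x. f (x + ?w)) has_derivative frechet_derivative f (at (x + ?w))) (at x)" .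
      show "frechet_derivative f (at (x + ?w)) (c *s h) = c * frechet_derivative f (at (x + ?w)) h" for c h
        using hol_fun_on_derivative(2)[OF f inU(2)[OF x]] .
    qed auto
    moreover have "hol_fun_on (ball x0 (2*r)) f"
      using hol_fun_on_subset[OF f open_ball] inU by blast
    ultimately show "hol_fun_on (ball x0 (2*r)) (q n)"
      unfolding q_def by (intro hol_fun_on_divide hol_fun_on_diff hol_fun_on_const) (auto simp: t0)
  next
    show "uniform_limit (ball x0 (2*r)) q (\<lambda>x. frechet_derivative f (at x) v) sequentially"
    proof (rule uniform_limitI)
      fix \<epsilon> :: real assume \<epsilon>: "\<epsilon> > 0"
      define C where "C = 8 * B * (norm v)\<^sup>2 / (2*r)\<^sup>2"
      have bd: "dist (q n x) (frechet_derivative f (at x) v) \<le> C * norm (t (n + N))"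
        if x: "x \<in> ball x0 (2*r)" for n x
      proof -
        let ?t = "t (n + N)"
        have "norm (f (x + ?t *s v) - f x - ?t * frechet_derivative f (at x) v) \<le> C * (norm ?t)\<^sup>2"
          unfolding C_def
          by (rule hol_remainder_bound[OF f]) (use r sub[OF x] B N[of "n + N"] in \<open>auto simp: subset_iff\<close>)
        moreover have "q n x - frechet_derivative f (at x) v
            = (f (x + ?t *s v) - f x - ?t * frechet_derivative f (at x) v) / ?t"
          using t0 by (simp add: q_def diff_divide_distrib)
        ultimately show ?thesis
          using t0[of "n + N"] by (simp add: dist_norm norm_divide divide_le_eq power2_eq_square mult_ac)
      qed
      have "(\<lambda>n. C * norm (t (n + N))) \<longlonglongrightarrow> C * norm (0::complex)"
        by (intro tendsto_intros LIMSEQ_ignore_initial_segment tlim)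
      then have "\<forall>\<^sub>F n in sequentially. C * norm (t (n + N)) < \<epsilon>"
        by (rule order_tendstoD) (use \<epsilon> in auto)
      then show "\<forall>\<^sub>F n in sequentially. \<forall>x\<in>ball x0 (2*r). dist (q n x) (frechet_derivative f (at x) v) < \<epsilon>"
        by eventually_elim (use bd le_less_trans in blast)
    qed
  qed
  moreover have "ball x0 r \<subseteq> U" "x0 \<in> ball x0 r" using r by auto
  ultimately show "\<exists>V. x0 \<in> V \<and> V \<subseteq> U \<and> hol_fun_on V (\<lambda>x. frechet_derivative f (at x) v)" by blast
qed

text \<open>The bilinear (not Hermitian) pairing, so that \<open>cdot (cgrad p z)\<close> is the differential of \<open>p\<close>.\<close>

abbreviation cdot :: "complex^'n \<Rightarrow> complex^'n \<Rightarrow> complex" where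
  "cdot a v \<equiv> (\<Sum>i\<in>UNIV. a $ i * v $ i)"

lemma cdot_add: "cdot a (v + w) = cdot a v + cdot a w"
  by (simp add: distrib_left sum.distrib)

lemma cdot_scale: "cdot a (c *s v) = c * cdot a v"
  by (simp add: sum_distrib_left mult_ac)

lemma cdot_diff: "cdot a (v - w) = cdot a v - cdot a w"
  by (simp add: right_diff_distrib sum_subtractf)

lemma cdot_axis: "cdot a (axis i 1) = a $ i"
  by (simp add: axis_def if_distrib[of "(*) _"] cong: if_cong)

section \<open>Homogeneous polynomials\<close>

lemma homogeneous_poly_hol:
  assumes "homogeneous_poly d p" shows "hol_fun_on UNIV p"
proof -
  obtain c where p: "p = (\<lambda>z. \<Sum>\<alpha> | sum \<alpha> UNIV = d. c \<alpha> * (\<Prod>i\<in>UNIV. z $ i ^ \<alpha> i))"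
    using assms unfolding homogeneous_poly_def by blast
  show ?thesis unfolding p
    by (intro hol_fun_on_sum hol_fun_on_mult hol_fun_on_const hol_fun_on_prod hol_fun_on_power hol_fun_on_nth open_UNIV)
qed

lemma homogeneous_poly_scale:
  assumes "homogeneous_poly d p" shows "p (c *s z) = c ^ d * p z"
proof -
  obtain k where p: "p = (\<lambda>z. \<Sum>\<alpha> | sum \<alpha> UNIV = d. k \<alpha> * (\<Prod>i\<in>UNIV. z $ i ^ \<alpha> i))"
    using assms unfolding homogeneous_poly_def by blast
  show ?thesis unfolding p
    by (auto simp: sum_distrib_left power_mult_distrib prod.distrib power_sum[symmetric] mult_ac intro!: sum.cong)
qed

lemma homogeneous_poly_derivative:
  assumes "homogeneous_poly d p"
  shows "frechet_derivative p (at z) h = cdot (cgrad p z) h"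
    and "(p has_derivative cdot (cgrad p z)) (at z)"
proof -
  note hol = homogeneous_poly_hol[OF assms]
  note D = hol_fun_on_derivative(1)[OF hol UNIV_I, of z]
  have ax: "axis i t = t *s axis i (1::complex)" for i :: 'a and t
    by (simp add: vec_eq_iff axis_def)
  have g: "cgrad p z $ i = frechet_derivative p (at z) (axis i 1)" for i
  proof -
    have "((\<lambda>t. p (z + axis i t)) has_field_derivative frechet_derivative p (at z) (axis i 1)) (at 0)"
      using hol_line_derivative[OF hol UNIV_I, where x = z and t = 0 and v = "axis i 1"]
      by (simp add: ax[symmetric, where i = i] del: vector_smult_lzero) (simp add: ax[where i = i and t = 0])
    then show ?thesis by (simp add: cgrad_def DERIV_imp_deriv)
  qed
  interpret bounded_linear "frechet_derivative p (at z)" using D by (rule has_derivative_bounded_linear)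
  show eq: "frechet_derivative p (at z) h = cdot (cgrad p z) h" for h
  proof -
    have "h = (\<Sum>i\<in>UNIV. h $ i *s axis i 1)" by (simp add: basis_expansion)
    then have "frechet_derivative p (at z) h = (\<Sum>i\<in>UNIV. frechet_derivative p (at z) (h $ i *s axis i 1))"
      by (metis (mono_tags, lifting) sum sum.cong)
    then show ?thesis by (simp add: g hol_fun_on_derivative(2)[OF hol UNIV_I] mult.commute)
  qed
  show "(p has_derivative cdot (cgrad p z)) (at z)"
    using D unfolding eq[abs_def] .
qed

lemma homogeneous_poly_cgrad_continuous:
  assumes "homogeneous_poly d p" shows "continuous_on UNIV (cgrad p)"
proof -
  have "cgrad p z $ i = frechet_derivative p (at z) (axis i 1)" for z i
    by (simp only: homogeneous_poly_derivative(1)[OF assms] cdot_axis)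
  then have "cgrad p = (\<lambda>z. \<chi> i. frechet_derivative p (at z) (axis i 1))"
    by (intro ext) (simp only: vec_eq_iff vec_lambda_beta simp_thms)
  moreover have "continuous_on UNIV (\<lambda>z. \<chi> i. frechet_derivative p (at z) (axis i 1))"
    by (intro continuous_on_vec_lambda hol_fun_on_continuous hol_fun_on_frechet_derivative
        homogeneous_poly_hol[OF assms])
  ultimately show ?thesis by simp
qed

lemma smult_has_derivative:
  "((\<lambda>z. c *s z) has_derivative (\<lambda>h. c *s h)) (at (z::complex^'n))"
  by (rule bounded_linear_imp_has_derivative, rule linear_conv_bounded_linear[THEN iffD1], rule linearI)
     (auto simp: vec_eq_iff algebra_simps)

text \<open>Differentiate \<open>p (c z) = c\<^sup>d p z\<close> and cancel one factor \<open>c\<close>.\<close>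

lemma homogeneous_poly_cgrad_scale:
  assumes p: "homogeneous_poly d p" and "d > 0" "c \<noteq> 0"
  shows "cgrad p (c *s z) = c ^ (d - 1) *s cgrad p z"
proof -
  have D1: "((\<lambda>z. p (c *s z)) has_derivative (\<lambda>h. cdot (cgrad p (c *s z)) (c *s h))) (at z)"
    using has_derivative_compose[OF smult_has_derivative homogeneous_poly_derivative(2)[OF p]] .
  have D2: "((\<lambda>z. p (c *s z)) has_derivative (\<lambda>h. c ^ d * cdot (cgrad p z) h)) (at z)"
    unfolding homogeneous_poly_scale[OF p]
    by (intro has_derivative_mult_right homogeneous_poly_derivative(2)[OF p])
  have eq: "cdot (cgrad p (c *s z)) (c *s h) = c ^ d * cdot (cgrad p z) h" for h
    using fun_cong[OF has_derivative_unique[OF D1 D2]] .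
  have "c * cgrad p (c *s z) $ i = c ^ d * cgrad p z $ i" for i
    using eq[of "axis i 1"] unfolding cdot_scale cdot_axis .
  moreover have "c ^ d = c * c ^ (d - 1)" using \<open>d > 0\<close> by (cases d) auto
  ultimately show ?thesis using \<open>c \<noteq> 0\<close> by (simp add: vec_eq_iff mult.assoc)
qed

text \<open>Euler's relation: differentiate \<open>p (t z) = t\<^sup>d p z\<close> at \<open>t = 1\<close>.\<close>

lemma homogeneous_poly_euler:
  assumes p: "homogeneous_poly d p"
  shows "cdot (cgrad p z) z = of_nat d * p z"
proof -
  have "((\<lambda>t. p (0 + t *s z)) has_field_derivative cdot (cgrad p z) z) (at 1)"
    using hol_line_derivative[OF homogeneous_poly_hol[OF p] UNIV_I, where x = 0 and t = 1 and v = z]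
    by (simp add: homogeneous_poly_derivative(1)[OF p])
  moreover have "((\<lambda>t. p (0 + t *s z)) has_field_derivative of_nat d * p z) (at 1)"
    by (auto simp: homogeneous_poly_scale[OF p] intro!: derivative_eq_intros)
  ultimately show ?thesis by (rule DERIV_unique)
qed

section \<open>Points of projective space and their representatives\<close>

lemma cline_eq_iff:
  assumes "v \<noteq> 0"
  shows "cline v = cline w \<longleftrightarrow> (\<exists>c. c \<noteq> 0 \<and> w = c *s v)"
proof
  assume eq: "cline v = cline w"
  have "w = 1 *s w" "v = 1 *s v" by simp_all
  then have "w \<in> cline v" "v \<in> cline w" using eq unfolding cline_def by blast+
  then obtain c d where "w = c *s v" "v = d *s w" unfolding cline_def by blast
  then show "\<exists>c. c \<noteq> 0 \<and> w = c *s v" using assms by (cases "c = 0") auto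
next
  assume "\<exists>c. c \<noteq> 0 \<and> w = c *s v"
  then obtain c where c: "c \<noteq> 0" "w = c *s v" by blast
  have "d *s v = (d / c) *s w" "d *s w = (d * c) *s v" for d
    using c by (auto simp: vec_eq_iff)
  then show "cline v = cline w" unfolding cline_def by blast
qed

lemma cline_scale: "c \<noteq> 0 \<Longrightarrow> cline (c *s v) = cline v"
  by (cases "v = 0") (use cline_eq_iff[of v "c *s v"] in auto)

lemma in_zero_locus_iff:
  assumes "homogeneous_poly d p" "z \<noteq> 0"
  shows "cline z \<in> zero_locus p \<longleftrightarrow> p z = 0"
proof
  assume "cline z \<in> zero_locus p"
  then obtain w where w: "w \<noteq> 0" "p w = 0" "cline w = cline z" unfolding zero_locus_def by force
  then obtain c where "z = c *s w" using cline_eq_iff by blast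
  then show "p z = 0" using w by (simp add: homogeneous_poly_scale[OF assms(1)])
qed (use assms in \<open>auto simp: zero_locus_def\<close>)

lemma cone_zero_loci:
  assumes "homogeneous_poly d q" "homogeneous_poly e f"
  shows "cone (zero_locus q \<inter> zero_locus f) = {z. z \<noteq> 0 \<and> q z = 0 \<and> f z = 0}"
  using in_zero_locus_iff[OF assms(1)] in_zero_locus_iff[OF assms(2)] by (auto simp: cone_def)

lemma zero_locus_subset_proj_space: "zero_locus p \<subseteq> proj_space"
  by (auto simp: zero_locus_def proj_space_def)

section \<open>Holomorphic charts of a smooth complete intersection\<close>

lemma nonzero_minor:
  fixes a b :: "complex^'n"
  assumes "\<And>s t. s *s a + t *s b = 0 \<Longrightarrow> s = 0 \<and> t = 0"
  obtains j k where "a $ j * b $ k - a $ k * b $ j \<noteq> 0"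
proof -
  have "a \<noteq> 0" using assms[of 1 0] by auto
  then obtain j where j: "a $ j \<noteq> 0" by (auto simp: vec_eq_iff)
  have "\<exists>k. a $ j * b $ k - a $ k * b $ j \<noteq> 0"
  proof (rule ccontr)
    assume "\<nexists>k. a $ j * b $ k - a $ k * b $ j \<noteq> 0"
    then have "(- (b $ j)) *s a + a $ j *s b = 0" by (simp add: vec_eq_iff algebra_simps)
    then show False using assms j by blast
  qed
  then show ?thesis using that by blast
qed

lemma solve_2x2:
  fixes a b c d x y :: complex
  assumes "a * x + b * y = 0" "c * x + d * y = 0" "a * d - b * c \<noteq> 0"
  shows "x = 0 \<and> y = 0"
proof -
  have "(a * d - b * c) * x = d * (a * x + b * y) - b * (c * x + d * y)"
    "(a * d - b * c) * y = a * (c * x + d * y) - c * (a * x + b * y)"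
    by (simp_all add: algebra_simps)
  then show ?thesis using assms by simp
qed

lemma sum_two_support:
  fixes a v :: "complex^'n"
  assumes "j \<noteq> k" "\<And>i. i \<noteq> j \<Longrightarrow> i \<noteq> k \<Longrightarrow> v $ i = 0"
  shows "cdot a v = a $ j * v $ j + a $ k * v $ k"
proof -
  have "cdot a v = (\<Sum>i\<in>{j,k}. a $ i * v $ i)"
    by (rule sum.mono_neutral_right) (use assms in auto)
  then show ?thesis using assms by simp
qed

text \<open>Some \<open>2 \<times> 2\<close> minor of the Jacobian, in columns \<open>j\<close> and \<open>k\<close> say, is nonzero at \<open>z0\<close>. Replacing the
coordinates \<open>j\<close> and \<open>k\<close> by \<open>q\<close> and \<open>f\<close> gives a local coordinate system \<open>\<Phi>\<close> of \<open>\<complex>\<^sup>6\<close> in which the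
cone over \<open>X\<close> is a coordinate subspace. By Euler's relation a further coordinate \<open>m\<close> is nonzero
at \<open>z0\<close>; fixing its value picks one representative of each nearby point, and the three remaining
coordinates parametrise \<open>X\<close>. The inverse of this chart is given by quotients of coordinates.\<close>

lemma local_chart:
  fixes q f :: "complex^6 \<Rightarrow> complex"
  assumes q: "homogeneous_poly d q" and f: "homogeneous_poly e f"
    and X: "X = zero_locus q \<inter> zero_locus f"
    and z0: "z0 \<noteq> 0" "q z0 = 0" "f z0 = 0"
    and indep: "\<And>a b. a *s cgrad q z0 + b *s cgrad f z0 = 0 \<Longrightarrow> a = 0 \<and> b = 0"
  shows "\<exists>(U :: (complex^3) set) \<phi>. hol_chart X U \<phi> \<and> cline z0 \<in> \<phi> ` U"
proof -
  obtain j k where minor: "cgrad q z0 $ j * cgrad f z0 $ k - cgrad q z0 $ k * cgrad f z0 $ j \<noteq> 0"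
    using nonzero_minor[OF indep] by blast
  then have jk: "j \<noteq> k" by auto
  obtain m where m: "m \<noteq> j" "m \<noteq> k" "z0 $ m \<noteq> 0"
  proof -
    have "\<exists>m. m \<noteq> j \<and> m \<noteq> k \<and> z0 $ m \<noteq> 0"
    proof (rule ccontr)
      assume "\<not> ?thesis"
      then have z: "z0 $ i = 0" if "i \<noteq> j" "i \<noteq> k" for i using that by blast
      have "cgrad q z0 $ j * z0 $ j + cgrad q z0 $ k * z0 $ k = 0"
        "cgrad f z0 $ j * z0 $ j + cgrad f z0 $ k * z0 $ k = 0"
        using homogeneous_poly_euler[OF q, of z0] homogeneous_poly_euler[OF f, of z0] z0
        by (simp_all add: sum_two_support[OF jk z])
      from solve_2x2[OF this minor] z have "z0 = 0" by (metis vec_eq_iff zero_index)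
      with z0 show False by simp
    qed
    then show thesis using that by blast
  qed
  have "card (UNIV - {m,j,k}) = card (UNIV :: 3 set)"
    using m jk by (subst card_Diff_subset) auto
  then obtain \<epsilon> where \<epsilon>: "bij_betw \<epsilon> (UNIV :: 3 set) (UNIV - {m,j,k})"
    using finite_same_card_bij[of "UNIV :: 3 set" "UNIV - {m,j,k}"] by auto
  have \<epsilon>ne: "\<epsilon> l \<noteq> m" "\<epsilon> l \<noteq> j" "\<epsilon> l \<noteq> k" for l using \<epsilon> by (auto simp: bij_betw_def)
  have inv_\<epsilon>: "inv \<epsilon> (\<epsilon> l) = l" for l using \<epsilon> by (simp add: bij_betw_def)
  have \<epsilon>_inv: "\<epsilon> (inv \<epsilon> i) = i" if "i \<noteq> m" "i \<noteq> j" "i \<noteq> k" for i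
    using \<epsilon> that f_inv_into_f[of i \<epsilon> UNIV] by (auto simp: bij_betw_def)
  define \<Phi> where "\<Phi> w = (\<chi> i. if i = j then q w else if i = k then f w else w $ i)" for w
  define \<Phi>' where "\<Phi>' w h = (\<chi> i. if i = j then cdot (cgrad q w) h else if i = k then cdot (cgrad f w) h else h $ i)" for w h
  have \<Phi>'_deriv: "(\<Phi> has_derivative \<Phi>' w) (at w)" for w
  proof (rule has_derivative_vecI)
    fix i
    show "((\<lambda>x. \<Phi> x $ i) has_derivative (\<lambda>h. \<Phi>' w h $ i)) (at w)"
      using homogeneous_poly_derivative(2)[OF q, of w] homogeneous_poly_derivative(2)[OF f, of w]
        bounded_linear_imp_has_derivative[OF bounded_linear_vec_nth]
      by (cases "i = j"; cases "i = k") (simp_all add: \<Phi>_def \<Phi>'_def)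
  qed
  then have bl: "bounded_linear (\<Phi>' w)" for w by (rule has_derivative_bounded_linear)
  define D where "D w = Blinfun (\<Phi>' w)" for w
  have D: "blinfun_apply (D w) = \<Phi>' w" for w
    unfolding D_def using bl by (rule bounded_linear_Blinfun_apply)
  have contD: "continuous_on UNIV D"
  proof (rule continuous_on_blinfun_componentwise)
    fix b :: "complex^6"
    have cg: "continuous_on UNIV (\<lambda>w. cgrad q w $ i)" "continuous_on UNIV (\<lambda>w. cgrad f w $ i)" for i
      by (intro continuous_on_component homogeneous_poly_cgrad_continuous[OF q] homogeneous_poly_cgrad_continuous[OF f])+
    show "continuous_on UNIV (\<lambda>w. blinfun_apply (D w) b)"
      unfolding D \<Phi>'_def
    proof (rule continuous_on_vec_lambda)
      fix i
      show "continuous_on UNIV (\<lambda>w. if i = j then cdot (cgrad q w) b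
          else if i = k then cdot (cgrad f w) b else b $ i)"
        by (cases "i = j"; cases "i = k") (auto intro!: continuous_intros cg)
    qed
  qed
  have "inj (\<Phi>' z0)"
  proof (rule injI)
    fix v w assume eq: "\<Phi>' z0 v = \<Phi>' z0 w"
    have nth: "\<Phi>' z0 v $ i = \<Phi>' z0 w $ i" for i using eq by simp
    have z: "(v - w) $ i = 0" if "i \<noteq> j" "i \<noteq> k" for i using nth[of i] that by (simp add: \<Phi>'_def)
    have S: "cdot a (v - w) = a $ j * (v - w) $ j + a $ k * (v - w) $ k" for a
      using sum_two_support[OF jk z] .
    have "cdot (cgrad q z0) (v - w) = 0" "cdot (cgrad f z0) (v - w) = 0"
      using nth[of j] nth[of k] jk unfolding cdot_diff by (simp_all add: \<Phi>'_def)
    then have "(v - w) $ j = 0 \<and> (v - w) $ k = 0"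
      unfolding S by (rule solve_2x2) (rule minor)
    with z have "v - w = 0" by (metis vec_eq_iff zero_index)
    then show "v = w" by simp
  qed
  then obtain L where L: "linear L" "L \<circ> \<Phi>' z0 = id"
    using linear_injective_left_inverse[of "\<Phi>' z0"] bl by (auto simp: bounded_linear.linear)
  have invD: "Blinfun L o\<^sub>L D z0 = id_blinfun"
    using L by (intro blinfun_eqI)
      (simp add: D bounded_linear_Blinfun_apply linear_conv_bounded_linear[symmetric] fun_eq_iff)
  obtain U' V g where U': "open U'" "z0 \<in> U'" and V: "open V" "\<Phi> z0 \<in> V"
    and hom: "homeomorphism U' V \<Phi> g"
    and g: "\<And>y. y \<in> V \<Longrightarrow> (g has_derivative inv (\<Phi>' (g y))) (at y)"
      "\<And>y. y \<in> V \<Longrightarrow> bij (\<Phi>' (g y))"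
  proof (rule inverse_function_theorem[OF open_UNIV _ contD UNIV_I invD])
    show "(\<Phi> has_derivative blinfun_apply (D w)) (at w)" for w unfolding D by (rule \<Phi>'_deriv)
    fix U' V g g'
    assume *: "open U'" "z0 \<in> U'" "open V" "\<Phi> z0 \<in> V" "homeomorphism U' V \<Phi> g"
      "\<And>y. y \<in> V \<Longrightarrow> (g has_derivative g' y) (at y)"
      "\<And>y. y \<in> V \<Longrightarrow> g' y = inv (blinfun_apply (D (g y)))"
      "\<And>y. y \<in> V \<Longrightarrow> bij (blinfun_apply (D (g y)))"
    show thesis by (rule that[OF *(1-5)]) (use *(6-8) in \<open>auto simp: D\<close>)
  qed
  have g'_scale: "inv (\<Phi>' (g y)) (c *s h) = c *s inv (\<Phi>' (g y)) h" if yV: "y \<in> V" for y c h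
  proof -
    obtain a where a: "h = \<Phi>' (g y) a" using g(2)[OF yV] by (metis bij_pointE)
    have "\<Phi>' (g y) (c *s a) = c *s \<Phi>' (g y) a"
      by (simp add: \<Phi>'_def vec_eq_iff sum_distrib_left mult_ac)
    then show ?thesis
      using g(2)[OF yV] a by (metis bij_inv_eq_iff)
  qed
  define \<mu> where "\<mu> = z0 $ m"
  have \<mu>: "\<mu> \<noteq> 0" using m by (simp add: \<mu>_def)
  define \<iota> :: "complex^3 \<Rightarrow> complex^6" where
    "\<iota> u = (\<chi> i. if i = m then \<mu> else if i = j \<or> i = k then 0 else u $ inv \<epsilon> i)" for u
  define \<iota>' :: "complex^3 \<Rightarrow> complex^6" where
    "\<iota>' u = (\<chi> i. if i = m \<or> i = j \<or> i = k then 0 else u $ inv \<epsilon> i)" for u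
  have \<iota>_deriv: "(\<iota> has_derivative \<iota>') (at u)" for u
  proof (rule has_derivative_vecI)
    fix i
    show "((\<lambda>x. \<iota> x $ i) has_derivative (\<lambda>h. \<iota>' h $ i)) (at u)"
      using bounded_linear_imp_has_derivative[OF bounded_linear_vec_nth[of "inv \<epsilon> i"]]
      by (cases "i = m"; cases "i = j \<or> i = k") (simp_all add: \<iota>_def \<iota>'_def)
  qed
  define U where "U = \<iota> -` V"
  have "continuous_on UNIV \<iota>"
    using \<iota>_deriv has_derivative_continuous by (metis continuous_at_imp_continuous_on)
  then have openU: "open U" unfolding U_def using V(1) by (rule open_vimage[rotated])
  define F where "F u = g (\<iota> u)" for u
  have \<Phi>F: "\<Phi> (F u) = \<iota> u" "F u \<in> U'" if "u \<in> U" for u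
    using hom that by (auto simp: homeomorphism_def F_def U_def)
  have Fm: "F u $ m = \<mu>" and Fq: "q (F u) = 0" and Ff: "f (F u) = 0" and Fe: "F u $ \<epsilon> l = u $ l"
    if "u \<in> U" for u l
  proof -
    have nth: "\<Phi> (F u) $ i = \<iota> u $ i" for i using \<Phi>F(1)[OF that] by simp
    show "F u $ m = \<mu>" "q (F u) = 0" "f (F u) = 0" "F u $ \<epsilon> l = u $ l"
      using nth[of m] nth[of j] nth[of k] nth[of "\<epsilon> l"] m jk \<epsilon>ne[of l] inv_\<epsilon>[of l]
      by (auto simp: \<Phi>_def \<iota>_def)
  qed
  have F0: "F u \<noteq> 0" if "u \<in> U" for u using Fm[OF that] \<mu> by auto
  have holF: "hol_map_on U F"
    unfolding hol_map_on_iff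
  proof (intro conjI ballI openU)
    fix u assume "u \<in> U"
    then have "\<iota> u \<in> V" by (simp add: U_def)
    have "(F has_derivative (\<lambda>h. inv (\<Phi>' (g (\<iota> u))) (\<iota>' h))) (at u)"
      unfolding F_def using has_derivative_compose[OF \<iota>_deriv g(1)[OF \<open>\<iota> u \<in> V\<close>]] .
    moreover have "\<iota>' (c *s h) = c *s \<iota>' h" for c h by (simp add: \<iota>'_def vec_eq_iff)
    ultimately show "\<exists>F'. (F has_derivative F') (at u) \<and> (\<forall>c h. F' (c *s h) = c *s F' h)"
      using g'_scale[OF \<open>\<iota> u \<in> V\<close>] by (intro exI conjI) auto
  qed
  define \<phi> where "\<phi> u = cline (F u)" for u
  have solve: "F (\<chi> l. w $ \<epsilon> l) = w \<and> (\<chi> l. w $ \<epsilon> l) \<in> U"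
    if "w \<in> U'" "q w = 0" "f w = 0" "w $ m = \<mu>" for w
  proof -
    have "\<Phi> w = \<iota> (\<chi> l. w $ \<epsilon> l)"
      using that m jk by (auto simp: \<Phi>_def \<iota>_def vec_eq_iff \<epsilon>_inv)
    moreover have "\<Phi> w \<in> V" "g (\<Phi> w) = w" using hom that by (auto simp: homeomorphism_def)
    ultimately show ?thesis by (simp add: F_def U_def)
  qed
  have coneX: "cone X = {z. z \<noteq> 0 \<and> q z = 0 \<and> f z = 0}"
    unfolding X by (rule cone_zero_loci[OF q f])
  have \<phi>X: "\<phi> ` U \<subseteq> X"
    using F0 Fq Ff by (auto simp: \<phi>_def X in_zero_locus_iff[OF q] in_zero_locus_iff[OF f])
  have inj: "inj_on \<phi> U"
  proof (rule inj_onI)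
    fix u v assume uv: "u \<in> U" "v \<in> U" "\<phi> u = \<phi> v"
    then obtain c where c: "F v = c *s F u" using cline_eq_iff[OF F0] unfolding \<phi>_def by blast
    then have "\<mu> = c * \<mu>" using Fm uv by (metis vector_smult_component)
    then have "F v = F u" using c \<mu> by simp
    then show "u = v" using Fe uv by (metis vec_eq_iff)
  qed
  have rep: "\<exists>c u. c \<noteq> 0 \<and> u \<in> U \<and> z = c *s F u \<and> cline z = \<phi> u" if "z \<in> cone (\<phi> ` U)" for z
  proof -
    from that obtain u where "u \<in> U" "cline z = \<phi> u" by (auto simp: cone_def)
    moreover then obtain c where "c \<noteq> 0" "z = c *s F u" using cline_eq_iff[OF F0] unfolding \<phi>_def by metis
    ultimately show ?thesis by blast
  qed
  have opn: "openin (top_of_set (cone X)) (cone (\<phi> ` U))"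
  proof -
    define W where "W = {z. z $ m \<noteq> 0} \<inter> (\<lambda>z. (\<mu> / z $ m) *s z) -` U'"
    have om: "open {z :: complex^6. z $ m \<noteq> 0}"
      by (intro open_Collect_neq continuous_intros)
    have "continuous_on {z :: complex^6. z $ m \<noteq> 0} (\<lambda>z. (\<mu> / z $ m) *s z)"
      unfolding vector_scalar_mult_def by (intro continuous_intros) auto
    then have "open W" unfolding W_def using om U'(1) by (rule continuous_open_preimage)
    moreover have "cone (\<phi> ` U) = cone X \<inter> W"
    proof (intro set_eqI iffI)
      fix z assume z: "z \<in> cone (\<phi> ` U)"
      then have "z \<in> cone X" using \<phi>X by (auto simp: cone_def)
      moreover from rep[OF z] obtain c u where cu: "c \<noteq> 0" "u \<in> U" "z = c *s F u" by blast
      then have "z $ m = c * \<mu>" using Fm by simp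
      then have "z \<in> W" using cu \<mu> \<Phi>F(2)[OF cu(2)] by (simp add: W_def vector_smult_assoc)
      ultimately show "z \<in> cone X \<inter> W" by blast
    next
      fix z assume z: "z \<in> cone X \<inter> W"
      let ?w = "(\<mu> / z $ m) *s z"
      have zm: "z $ m \<noteq> 0" "?w \<in> U'" using z by (auto simp: W_def)
      moreover have "q ?w = 0" "f ?w = 0" using z coneX
        by (auto simp: homogeneous_poly_scale[OF q] homogeneous_poly_scale[OF f])
      moreover have "?w $ m = \<mu>" using zm by simp
      ultimately have *: "F (\<chi> l. ?w $ \<epsilon> l) = ?w" "(\<chi> l. ?w $ \<epsilon> l) \<in> U"
        using solve[of ?w] by blast+
      have "cline z = cline ?w" using cline_scale[of "\<mu> / z $ m" z] zm \<mu> by simp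
      then have "cline z \<in> \<phi> ` U" unfolding \<phi>_def using * by force
      then show "z \<in> cone (\<phi> ` U)" using z coneX by (simp add: cone_def)
    qed
    ultimately show ?thesis by (auto simp: openin_open)
  qed
  have lifts: "locally_lifts hol_map_on U \<phi>"
    unfolding locally_lifts_def
  proof
    fix u assume "u \<in> U"
    then show "\<exists>V F. open V \<and> u \<in> V \<and> hol_map_on V F \<and> (\<forall>y\<in>V \<inter> U. F y \<noteq> 0 \<and> \<phi> y = cline (F y))"
      using openU holF F0 by (intro exI[of _ U] exI[of _ F]) (auto simp: \<phi>_def)
  qed
  have extends: "locally_extends hol_map_on (cone (\<phi> ` U)) (inv_into U \<phi> \<circ> cline)"
    unfolding locally_extends_def
  proof
    let ?V = "{z :: complex^6. z $ m \<noteq> 0}"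
    let ?G = "\<lambda>z. (\<chi> l. \<mu> * z $ \<epsilon> l / z $ m) :: complex^3"
    fix z assume z: "z \<in> cone (\<phi> ` U)"
    have oV: "open ?V" by (intro open_Collect_neq continuous_intros)
    have "hol_map_on ?V ?G"
      unfolding hol_map_on_def vec_lambda_beta
      by (intro allI hol_fun_on_divide hol_fun_on_mult hol_fun_on_const hol_fun_on_nth oV) auto
    moreover have "y $ m \<noteq> 0 \<and> (inv_into U \<phi> \<circ> cline) y = ?G y" if y: "y \<in> cone (\<phi> ` U)" for y
    proof -
      from rep[OF y] obtain c u where cu: "c \<noteq> 0" "u \<in> U" "y = c *s F u" "cline y = \<phi> u" by blast
      then show ?thesis using \<mu> Fm[OF cu(2)] Fe[OF cu(2)] inv_into_f_f[OF inj cu(2)]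
        by (simp add: vec_eq_iff)
    qed
    ultimately show "\<exists>V F. open V \<and> z \<in> V \<and> hol_map_on V F \<and>
        (\<forall>y\<in>V \<inter> cone (\<phi> ` U). (inv_into U \<phi> \<circ> cline) y = F y)"
      using oV z by (intro exI[of _ ?V] exI[of _ ?G]) blast
  qed
  have "hol_chart X U \<phi>"
    unfolding hol_chart_def using openU inj \<phi>X opn lifts extends by blast
  moreover have "cline z0 \<in> \<phi> ` U"
    using solve[of z0] U'(2) z0 unfolding \<phi>_def \<mu>_def by force
  ultimately show ?thesis by blast
qed

theorem smooth_intersection_projective_threefold:
  fixes q f :: "complex^6 \<Rightarrow> complex"
  assumes q: "homogeneous_poly d q" and f: "homogeneous_poly e f"
    and smooth: "smooth_intersection q f"
  shows "projective_threefold (zero_locus q \<inter> zero_locus f)"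
  unfolding projective_threefold_def
proof (intro conjI ballI)
  let ?X = "zero_locus q \<inter> zero_locus f"
  show "?X \<subseteq> proj_space" using zero_locus_subset_proj_space by blast
  have "continuous_on UNIV q" "continuous_on UNIV f"
    using q f homogeneous_poly_hol hol_fun_on_continuous by blast+
  then have "closed {z. q z = 0 \<and> f z = 0}"
    by (intro closed_Collect_conj closed_Collect_eq continuous_on_const)
  moreover have "cone (proj_space :: (complex^6) set set) = {z. z \<noteq> 0}"
    by (auto simp: cone_def proj_space_def)
  ultimately show "closedin (top_of_set (cone proj_space)) (cone ?X)"
    unfolding cone_zero_loci[OF q f] closedin_closed by blast
  fix p assume "p \<in> ?X"
  then obtain z where z: "p = cline z" "z \<noteq> 0" "q z = 0" unfolding zero_locus_def by blast
  with \<open>p \<in> ?X\<close> have "f z = 0" using in_zero_locus_iff[OF f] by blast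
  with z local_chart[OF q f refl z(2)] smooth
  show "\<exists>(U :: (complex^3) set) \<phi>. hol_chart ?X U \<phi> \<and> p \<in> \<phi> ` U"
    unfolding smooth_intersection_def by blast
qed

section \<open>Determinants of six vectors\<close>

lemma exhaust_6: "(i::6) = 0 \<or> i = 1 \<or> i = 2 \<or> i = 3 \<or> i = 4 \<or> i = 5"
proof (induct i)
  case (of_int z)
  then have "z = 0 \<or> z = 1 \<or> z = 2 \<or> z = 3 \<or> z = 4 \<or> z = 5" by fastforce
  then show ?case by auto
qed

lemma UNIV_6: "(UNIV :: 6 set) = {0, 1, 2, 3, 4, 5}"
  using exhaust_6 by auto

lemma sum_6: "sum g (UNIV :: 6 set) = g 0 + g 1 + g 2 + g 3 + g 4 + g 5"
  unfolding UNIV_6 by (simp add: add_ac)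

text \<open>The determinant as a function of the family of rows, so that multilinearity can be expressed
by function updates.\<close>

abbreviation rdet :: "('n \<Rightarrow> complex^'n) \<Rightarrow> complex" where
  "rdet w \<equiv> det (\<chi> i. w i)"

lemma rdet_upd_add: "rdet (w(k := x + y)) = rdet (w(k := x)) + rdet (w(k := y))"
  using det_row_add[of k "\<lambda>_. x" "\<lambda>_. y" w] by (simp add: fun_upd_def)

lemma rdet_upd_scale: "rdet (w(k := c *s x)) = c * rdet (w(k := x))"
  using det_row_mul[of k c "\<lambda>_. x" w] by (simp add: fun_upd_def)

lemma rdet_identical: "i \<noteq> j \<Longrightarrow> w i = w j \<Longrightarrow> rdet w = 0"
  by (rule det_identical_rows[of i j]) (auto simp: row_def vec_eq_iff)

definition six :: "complex^6 \<Rightarrow> (3 \<Rightarrow> complex^6) \<Rightarrow> complex^6 \<Rightarrow> complex^6 \<Rightarrow> 6 \<Rightarrow> complex^6" where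
  "six z v m n = (\<lambda>_. z)(1 := v 1, 2 := v 2, 3 := v 3, 4 := m, 5 := n)"

lemma six_simps:
  "six z v m n 0 = z" "six z v m n 1 = v 1" "six z v m n 2 = v 2" "six z v m n 3 = v 3"
  "six z v m n 4 = m" "six z v m n 5 = n"
  by (simp_all add: six_def)

lemma all_6: "(\<forall>i::6. P i) \<longleftrightarrow> P 0 \<and> P 1 \<and> P 2 \<and> P 3 \<and> P 4 \<and> P 5"
  by (metis exhaust_6)

text \<open>The top exterior power in rank three: of the 27 terms of the expansion only the six with distinct
arguments survive, and their signs are those in the determinant.\<close>

lemma alternating_trilinear:
  fixes T :: "complex^'n \<Rightarrow> complex^'n \<Rightarrow> complex^'n \<Rightarrow> complex"
  assumes add: "\<And>a b c d. T (a + b) c d = T a c d + T b c d"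
    "\<And>a b c d. T c (a + b) d = T c a d + T c b d"
    "\<And>a b c d. T c d (a + b) = T c d a + T c d b"
  and scale: "\<And>k b c d. T (k *s b) c d = k * T b c d"
    "\<And>k b c d. T c (k *s b) d = k * T c b d"
    "\<And>k b c d. T c d (k *s b) = k * T c d b"
  and alt: "\<And>a b. T a a b = 0" "\<And>a b. T a b a = 0" "\<And>a b. T b a a = 0"
  shows "T (\<Sum>j\<in>UNIV. A $ j $ 1 *s v j) (\<Sum>j\<in>UNIV. A $ j $ 2 *s v j) (\<Sum>j\<in>UNIV. A $ j $ 3 *s v j)
    = det (A :: complex^3^3) * T (v 1) (v 2) (v 3)"
proof -
  have "T a b c + T b a c = 0" "T a c b + T b c a = 0" "T c a b + T c b a = 0" for a b c
    using alt(1)[of "a + b" c, unfolded add, unfolded alt] alt(2)[of "a + b" c, unfolded add, unfolded alt]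
      alt(3)[of c "a + b", unfolded add, unfolded alt]
    by (simp_all add: add.commute)
  then have "T b a c = - T a b c" "T b c a = - T a c b" "T c b a = - T c a b" for a b c
    by (simp_all add: eq_neg_iff_add_eq_0 add.commute)
  then have swap: "T (v 2) (v 1) (v 3) = - T (v 1) (v 2) (v 3)" "T (v 1) (v 3) (v 2) = - T (v 1) (v 2) (v 3)"
    "T (v 3) (v 2) (v 1) = - T (v 1) (v 2) (v 3)"
    "T (v 2) (v 3) (v 1) = T (v 1) (v 2) (v 3)" "T (v 3) (v 1) (v 2) = T (v 1) (v 2) (v 3)"
    by (metis minus_minus)+
  show ?thesis
    unfolding sum_3 add scale alt swap det_3 by (simp add: algebra_simps)
qed

lemma rdet_six_linear_combination:
  "rdet (six z (\<lambda>i. \<Sum>j\<in>UNIV. A $ j $ i *s v j) m n) = det (A :: complex^3^3) * rdet (six z v m n)"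
proof -
  define T where "T a b c = rdet ((\<lambda>_. z)(1 := a, 2 := b, 3 := c, 4 := m, 5 := n))" for a b c
  have T1: "T a b c = rdet ((\<lambda>_. z)(2 := b, 3 := c, 4 := m, 5 := n, 1 := a))"
    and T2: "T a b c = rdet ((\<lambda>_. z)(1 := a, 3 := c, 4 := m, 5 := n, 2 := b))"
    and T3: "T a b c = rdet ((\<lambda>_. z)(1 := a, 2 := b, 4 := m, 5 := n, 3 := c))" for a b c
    unfolding T_def by (auto intro!: arg_cong[of _ _ rdet] simp: fun_eq_iff)
  have "T (\<Sum>j\<in>UNIV. A $ j $ 1 *s v j) (\<Sum>j\<in>UNIV. A $ j $ 2 *s v j) (\<Sum>j\<in>UNIV. A $ j $ 3 *s v j)
    = det A * T (v 1) (v 2) (v 3)"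
  proof (rule alternating_trilinear)
    show "T (a + b) c d = T a c d + T b c d" "T (k *s b) c d = k * T b c d" for a b c d k
      unfolding T1 by (simp_all only: rdet_upd_add rdet_upd_scale)
    show "T c (a + b) d = T c a d + T c b d" "T c (k *s b) d = k * T c b d" for a b c d k
      unfolding T2 by (simp_all only: rdet_upd_add rdet_upd_scale)
    show "T c d (a + b) = T c d a + T c d b" "T c d (k *s b) = k * T c d b" for a b c d k
      unfolding T3 by (simp_all only: rdet_upd_add rdet_upd_scale)
    show "T a a b = 0" "T a b a = 0" "T b a a = 0" for a b
      unfolding T_def by (rule rdet_identical[of 1 2] rdet_identical[of 1 3] rdet_identical[of 2 3]; simp)+
  qed
  then show ?thesis by (simp add: T_def six_def)
qed

text \<open>Effect of replacing a lift \<open>z\<close> by \<open>c z\<close>: the partial derivatives become \<open>c v\<^sub>i\<close> plus multiples of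
\<open>z\<close>, and the latter do not contribute.\<close>

lemma rdet_six_scale:
  "rdet (six (c *s z) (\<lambda>i. \<beta> i *s z + c *s v i) m n) = c ^ 4 * rdet (six z v m n)"
proof -
  define W where "W a b1 b2 b3 = rdet ((\<lambda>_. m)(0 := a, 1 := b1, 2 := b2, 3 := b3, 5 := n))" for a b1 b2 b3
  have six: "rdet (six a b m n) = W a (b 1) (b 2) (b 3)" for a b
    unfolding W_def six_def using exhaust_6
    by (intro arg_cong[of _ _ rdet]) (simp add: fun_eq_iff all_6)
  have W0: "W a b1 b2 b3 = rdet ((\<lambda>_. m)(1 := b1, 2 := b2, 3 := b3, 5 := n, 0 := a))"
    and W1: "W a b1 b2 b3 = rdet ((\<lambda>_. m)(0 := a, 2 := b2, 3 := b3, 5 := n, 1 := b1))"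
    and W2: "W a b1 b2 b3 = rdet ((\<lambda>_. m)(0 := a, 1 := b1, 3 := b3, 5 := n, 2 := b2))"
    and W3: "W a b1 b2 b3 = rdet ((\<lambda>_. m)(0 := a, 1 := b1, 2 := b2, 5 := n, 3 := b3))" for a b1 b2 b3
    unfolding W_def by (auto intro!: arg_cong[of _ _ rdet] simp: fun_eq_iff)
  have s0: "W (k *s a) b1 b2 b3 = k * W a b1 b2 b3" for k a b1 b2 b3
    unfolding W0 by (simp only: rdet_upd_scale)
  have s1: "W z (k *s z + l *s b1) b2 b3 = l * W z b1 b2 b3" for k l b1 b2 b3
  proof -
    have "W z z b2 b3 = 0" unfolding W_def by (rule rdet_identical[of 0 1]; simp)
    then show ?thesis unfolding W1 by (simp only: rdet_upd_scale rdet_upd_add mult_zero_right add_0_left)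
  qed
  have s2: "W z b1 (k *s z + l *s b2) b3 = l * W z b1 b2 b3" for k l b1 b2 b3
  proof -
    have "W z b1 z b3 = 0" unfolding W_def by (rule rdet_identical[of 0 2]; simp)
    then show ?thesis unfolding W2 by (simp only: rdet_upd_scale rdet_upd_add mult_zero_right add_0_left)
  qed
  have s3: "W z b1 b2 (k *s z + l *s b3) = l * W z b1 b2 b3" for k l b1 b2 b3
  proof -
    have "W z b1 b2 z = 0" unfolding W_def by (rule rdet_identical[of 0 3]; simp)
    then show ?thesis unfolding W3 by (simp only: rdet_upd_scale rdet_upd_add mult_zero_right add_0_left)
  qed
  show ?thesis unfolding six s0 s1 s2 s3 by (simp add: power4_eq_xxxx mult_ac)
qed

lemma matrix_vector_mult_rows: "(\<chi> i. w i) *v x = (\<chi> i. cdot x (w i))"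
  by (simp add: matrix_vector_mult_def mult.commute)

text \<open>Independent linear forms cannot both vanish on all but one member of a basis: the combination of
them that vanishes on the remaining member as well would be zero.\<close>

lemma rdet_two_forms:
  fixes a b :: "complex^'n"
  assumes "\<And>s t. s *s a + t *s b = 0 \<Longrightarrow> s = 0 \<and> t = 0"
    and "\<And>i. i \<noteq> k \<Longrightarrow> cdot a (w i) = 0 \<and> cdot b (w i) = 0"
  shows "rdet w = 0"
proof (rule ccontr)
  assume "rdet w \<noteq> 0"
  then obtain B where B: "B ** (\<chi> i. w i) = mat 1"
    unfolding invertible_det_nz[symmetric] invertible_def by blast
  have ker: "x = 0" if "\<And>i. cdot x (w i) = 0" for x
  proof -
    have "(\<chi> i. w i) *v x = 0" using that by (simp add: matrix_vector_mult_rows vec_eq_iff)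
    then have "(B ** (\<chi> i. w i)) *v x = 0" by (simp flip: matrix_vector_mul_assoc)
    then show ?thesis by (simp add: B)
  qed
  have lin: "cdot (s *s a + t *s b) v = s * cdot a v + t * cdot b v" for s t v
    by (simp add: sum_distrib_left sum.distrib algebra_simps)
  have "cdot (cdot b (w k) *s a + (- cdot a (w k)) *s b) (w i) = 0" for i
    unfolding lin using assms(2)[of i] by (cases "i = k") (simp_all only: mult_zero_right, simp_all)
  then have "cdot b (w k) *s a + (- cdot a (w k)) *s b = 0" by (rule ker)
  from assms(1)[OF this] have "cdot a (w k) = 0" by simp
  then have "cdot a (w i) = 0" for i using assms(2) by (cases "i = k") blast+
  then have "a = 0" by (rule ker)
  then show False using assms(1)[of 1 0] by simp
qed

lemma rdet_independent:
  assumes "\<And>c. (\<Sum>i\<in>UNIV. c i *s w i) = 0 \<Longrightarrow> (\<forall>i. c i = 0)"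
  shows "rdet w \<noteq> 0"
proof -
  have "\<exists>B. (\<chi> i. w i) ** B = mat 1"
    unfolding matrix_right_invertible_independent_rows using assms by (simp add: row_def vec_lambda_eta)
  then show ?thesis using invertible_right_inverse invertible_det_nz by blast
qed

section \<open>The residue of the standard volume form\<close>

text \<open>The residue depends only on the value and the first derivative of a lift, so differentiability
at one point suffices. This matters for coordinate changes, whose derivative is given at
a single point only.\<close>

definition jet_lift ::
  "(complex^3 \<Rightarrow> (complex^6) set) \<Rightarrow> complex^3 \<Rightarrow> (complex^3 \<Rightarrow> complex^6) \<Rightarrow> (complex^3 \<Rightarrow> complex^6) \<Rightarrow> bool" where
  "jet_lift \<phi> x F F' \<longleftrightarrow> (F has_derivative F') (at x) \<and> (\<forall>\<^sub>F y in nhds x. F y \<noteq> 0 \<and> \<phi> y = cline (F y))"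

abbreviation partials :: "(complex^3 \<Rightarrow> complex^6) \<Rightarrow> 3 \<Rightarrow> complex^6" where
  "partials F' \<equiv> \<lambda>i. F' (axis i 1)"

lemma jet_liftD: "jet_lift \<phi> x F F' \<Longrightarrow> F x \<noteq> 0 \<and> \<phi> x = cline (F x)"
  unfolding jet_lift_def using eventually_nhds_x_imp_x by blast

text \<open>Two lifts differ by the scalar function \<open>l\<close>, the quotient of a nonvanishing coordinate.\<close>

lemma jet_lift_unique:
  assumes F: "jet_lift \<phi> x F F'" and G: "jet_lift \<phi> x G G'"
  obtains c \<beta> where "c \<noteq> 0" "G x = c *s F x" "\<And>h. G' h = \<beta> h *s F x + c *s F' h"
proof -
  have dF: "(F has_derivative F') (at x)" and dG: "(G has_derivative G') (at x)"
    using F G by (auto simp: jet_lift_def)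
  obtain m where m: "F x $ m \<noteq> 0" using jet_liftD[OF F] by (metis vec_eq_iff zero_index)
  define l where "l y = G y $ m / F y $ m" for y
  have dFm: "((\<lambda>y. F y $ m) has_derivative (\<lambda>h. F' h $ m)) (at x)"
    and dGm: "((\<lambda>y. G y $ m) has_derivative (\<lambda>h. G' h $ m)) (at x)"
    by (intro bounded_linear.has_derivative[OF bounded_linear_vec_nth] dF dG)+
  obtain l' where l': "(l has_derivative l') (at x)"
    using has_derivative_divide[OF dGm dFm m] unfolding l_def by blast
  have liftF: "\<forall>\<^sub>F y in nhds x. F y \<noteq> 0 \<and> \<phi> y = cline (F y)"
    and liftG: "\<forall>\<^sub>F y in nhds x. G y \<noteq> 0 \<and> \<phi> y = cline (G y)"
    using F G by (auto simp: jet_lift_def)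
  have ev: "\<forall>\<^sub>F y in nhds x. (F y \<noteq> 0 \<and> \<phi> y = cline (F y)) \<and> (G y \<noteq> 0 \<and> \<phi> y = cline (G y)) \<and> F y $ m \<noteq> 0"
  proof (rule eventually_conj[OF liftF eventually_conj[OF liftG]])
    have "isCont (\<lambda>y. F y $ m) x" using dFm by (rule has_derivative_continuous)
    then have "\<forall>\<^sub>F y in at x. F y $ m \<noteq> 0"
      using m by (auto simp: isCont_def intro: tendsto_imp_eventually_ne)
    then show "\<forall>\<^sub>F y in nhds x. F y $ m \<noteq> 0" using m by (simp add: eventually_nhds_conv_at)
  qed
  have eq: "\<forall>\<^sub>F y in nhds x. G y = l y *s F y \<and> l y \<noteq> 0"
    using ev
  proof eventually_elim
    case (elim y)
    then have "cline (F y) = cline (G y)" by metis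
    then obtain c where "c \<noteq> 0" "G y = c *s F y" using elim cline_eq_iff by blast
    then show ?case using elim by (simp add: l_def)
  qed
  have x: "G x = l x *s F x" "l x \<noteq> 0" using eventually_nhds_x_imp_x[OF eq] by auto
  have "((\<lambda>y. l y *s F y) has_derivative (\<lambda>h. l' h *s F x + l x *s F' h)) (at x)"
  proof (rule has_derivative_vecI)
    fix i
    have "((\<lambda>y. l y * F y $ i) has_derivative (\<lambda>h. l x * F' h $ i + l' h * F x $ i)) (at x)"
      by (intro has_derivative_mult l' bounded_linear.has_derivative[OF bounded_linear_vec_nth] dF)
    then show "((\<lambda>y. (l y *s F y) $ i) has_derivative (\<lambda>h. (l' h *s F x + l x *s F' h) $ i)) (at x)"
      by (simp add: add.commute)
  qed
  moreover have "((\<lambda>y. l y *s F y) has_derivative G') (at x)"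
  proof (rule has_derivative_transform_eventually[OF dG])
    show "\<forall>\<^sub>F y in at x. G y = l y *s F y"
      using eq unfolding eventually_nhds_conv_at by (auto elim: eventually_mono)
  qed (use x in auto)
  ultimately have "G' = (\<lambda>h. l' h *s F x + l x *s F' h)" by (rule has_derivative_unique[rotated])
  then show thesis using that[of "l x" l'] x by auto
qed

lemma chart_lift:
  assumes "hol_chart X U \<phi>" "x \<in> U"
  obtains V F where "open V" "x \<in> V" "V \<subseteq> U" "hol_map_on V F"
    "\<And>y. y \<in> V \<Longrightarrow> F y \<noteq> 0 \<and> \<phi> y = cline (F y)"
    "\<And>y. y \<in> V \<Longrightarrow> \<phi> y \<in> X"
proof -
  have U: "open U" and lift: "locally_lifts hol_map_on U \<phi>" and X: "\<phi> ` U \<subseteq> X"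
    using assms(1) by (auto simp: hol_chart_def)
  obtain V F where V: "open V" "x \<in> V" "hol_map_on V F" "\<forall>y\<in>V \<inter> U. F y \<noteq> 0 \<and> \<phi> y = cline (F y)"
    using lift assms(2) unfolding locally_lifts_def by blast
  have "hol_map_on (V \<inter> U) F"
    using V(1,3) U unfolding hol_map_on_def by (auto intro: hol_fun_on_subset)
  then show thesis
    by (intro that[of "V \<inter> U" F]) (use V U X assms(2) in auto)
qed

definition jacobi :: "(complex^3 \<Rightarrow> complex^6) \<Rightarrow> complex^3 \<Rightarrow> complex^3 \<Rightarrow> complex^6" where
  "jacobi F x h = (\<chi> j. frechet_derivative (\<lambda>z. F z $ j) (at x) h)"

lemma jacobi:
  assumes "hol_map_on V F" "x \<in> V"
  shows "(F has_derivative jacobi F x) (at x)" "jacobi F x (c *s h) = c *s jacobi F x h"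
proof -
  have F: "hol_fun_on V (\<lambda>z. F z $ j)" for j using assms unfolding hol_map_on_def by blast
  show "(F has_derivative jacobi F x) (at x)"
    by (rule has_derivative_vecI) (simp add: jacobi_def hol_fun_on_derivative(1)[OF F assms(2)])
  show "jacobi F x (c *s h) = c *s jacobi F x h"
    by (simp add: jacobi_def vec_eq_iff hol_fun_on_derivative(2)[OF F assms(2)])
qed

lemma lift_jet:
  assumes "open V" "hol_map_on V F" "\<And>y. y \<in> V \<Longrightarrow> F y \<noteq> 0 \<and> \<phi> y = cline (F y)" "x \<in> V"
  shows "jet_lift \<phi> x F (jacobi F x)"
  unfolding jet_lift_def
  using jacobi(1)[OF assms(2,4)] eventually_nhds_in_open[OF assms(1,4)] assms(3)
  by (auto elim: eventually_mono)

text \<open>The local inverse \<open>G\<close> of a chart is defined on the cone, hence constant along the ray through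
\<open>F x\<close>. Its derivative kills \<open>F x\<close> and inverts the derivative of \<open>F\<close>.\<close>

lemma chart_partials_independent:
  assumes chart: "hol_chart X U \<phi>" and x: "x \<in> U"
    and V: "open V" "hol_map_on V F" "\<And>y. y \<in> V \<Longrightarrow> F y \<noteq> 0 \<and> \<phi> y = cline (F y)" "V \<subseteq> U" "x \<in> V"
    and sum: "a *s F x + (\<Sum>i\<in>UNIV. b i *s jacobi F x (axis i 1)) = 0"
  shows "a = 0 \<and> (\<forall>i. b i = 0)"
proof -
  have inj: "inj_on \<phi> U" and ext: "locally_extends hol_map_on (cone (\<phi> ` U)) (inv_into U \<phi> \<circ> cline)"
    using chart by (auto simp: hol_chart_def)
  have Fcone: "F y \<in> cone (\<phi> ` U)" if "y \<in> V" for y using V(3)[OF that] V(4) that by (auto simp: cone_def)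
  obtain W G where W: "open W" "F x \<in> W" "hol_map_on W G"
    and G: "\<And>z. z \<in> W \<Longrightarrow> z \<in> cone (\<phi> ` U) \<Longrightarrow> inv_into U \<phi> (cline z) = G z"
    using ext Fcone[OF V(5)] unfolding locally_extends_def by auto
  obtain G' where G': "(G has_derivative G') (at (F x))" "\<And>c h. G' (c *s h) = c *s G' h"
    using W unfolding hol_map_on_iff by blast
  interpret G': bounded_linear G' using G'(1) by (rule has_derivative_bounded_linear)
  note dF = jacobi[OF V(2,5)]
  interpret F': bounded_linear "jacobi F x" using dF(1) by (rule has_derivative_bounded_linear)
  have GF: "G' (jacobi F x h) = h" for h
  proof -
    have 1: "((\<lambda>y. G (F y)) has_derivative (\<lambda>h. G' (jacobi F x h))) (at x)"
      using has_derivative_compose[OF dF(1) G'(1)] .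
    have "open (V \<inter> F -` W)" using hol_map_on_continuous[OF V(2)] V(1) W(1) by (rule continuous_open_preimage)
    moreover have "x \<in> V \<inter> F -` W" using V(5) W(2) by simp
    moreover have "G (F y) = y" if "y \<in> V \<inter> F -` W" for y
      using G[of "F y"] Fcone[of y] V(3)[of y] V(4) that inv_into_f_f[OF inj, of y] by auto
    ultimately have 2: "((\<lambda>y. G (F y)) has_derivative (\<lambda>h. h)) (at x)"
      by (intro has_derivative_transform_within_open[OF has_derivative_ident]) auto
    show ?thesis using fun_cong[OF has_derivative_unique[OF 1 2]] .
  qed
  \<comment> \<open>A real multiple of \<open>F x\<close> represents the same point, so \<open>G\<close> is constant along the ray.\<close>
  have G0: "G' (F x) = 0"
  proof -
    have lin: "((\<lambda>t::real. t *\<^sub>R F x) has_derivative (\<lambda>t. t *\<^sub>R F x)) (at 1)"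
      by (auto intro!: derivative_eq_intros)
    have 1: "((\<lambda>t::real. G (t *\<^sub>R F x)) has_derivative (\<lambda>t. G' (t *\<^sub>R F x))) (at 1)"
      using has_derivative_compose[OF lin, of G G'] G'(1) by simp
    have "open ({0<..} \<inter> (\<lambda>t::real. t *\<^sub>R F x) -` W)"
      using W(1) by (intro continuous_open_preimage continuous_intros) auto
    moreover have "1 \<in> {0<..} \<inter> (\<lambda>t::real. t *\<^sub>R F x) -` W" using W(2) by simp
    moreover have "G (t *\<^sub>R F x) = x" if t: "t \<in> {0<..} \<inter> (\<lambda>t::real. t *\<^sub>R F x) -` W" for t
    proof -
      have eq: "t *\<^sub>R F x = complex_of_real t *s F x" by (simp add: vec_eq_iff) (simp add: scaleR_conv_of_real)
      have "cline (t *\<^sub>R F x) = \<phi> x" unfolding eq using cline_scale[of "complex_of_real t"] t V(3,5) by simp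
      moreover have "t *\<^sub>R F x \<noteq> 0" using t V(3,5) by auto
      ultimately show ?thesis using G[of "t *\<^sub>R F x"] t x inv_into_f_f[OF inj x] by (auto simp: cone_def)
    qed
    ultimately have 2: "((\<lambda>t::real. G (t *\<^sub>R F x)) has_derivative (\<lambda>h. 0)) (at 1)"
      by (intro has_derivative_transform_within_open[OF has_derivative_const[of x]]) auto
    show ?thesis using fun_cong[OF has_derivative_unique[OF 1 2], of 1] by simp
  qed
  define h where "h = (\<chi> i. b i)"
  have hsum: "h = (\<Sum>i\<in>UNIV. b i *s axis i 1)"
    using basis_expansion[of h] by (simp add: h_def)
  have F'h: "jacobi F x h = (\<Sum>i\<in>UNIV. b i *s jacobi F x (axis i 1))"
    unfolding hsum F'.sum by (simp add: dF(2))
  have "G' (a *s F x + jacobi F x h) = h"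
    unfolding G'.add G'(2) G0 GF by simp
  then have "h = 0" using sum by (simp add: F'h G'.zero)
  then have b: "b i = 0" for i by (simp add: h_def vec_eq_iff)
  then have "a *s F x = 0" using sum by simp
  then have "a = 0" using V(3)[OF V(5)] by simp
  then show ?thesis using b by blast
qed

text \<open>By adjunction the canonical bundle is \<open>O(d + e - 6)\<close>, so the degree condition makes it trivial. The
residue below is the corresponding nowhere vanishing section.\<close>

locale bidegree_intersection =
  fixes q f :: "complex^6 \<Rightarrow> complex" and d e :: nat and X :: "(complex^6) set set"
  assumes q: "homogeneous_poly d q" and f: "homogeneous_poly e f"
    and pos: "d > 0" "e > 0" and degree: "d + e = 6"
    and smooth: "smooth_intersection q f"
  defines X_def: "X \<equiv> zero_locus q \<inter> zero_locus f"
begin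

lemma coneX: "cone X = {z. z \<noteq> 0 \<and> q z = 0 \<and> f z = 0}"
  unfolding X_def by (rule cone_zero_loci[OF q f])

lemma cone_independent:
  "z \<in> cone X \<Longrightarrow> a *s cgrad q z + b *s cgrad f z = 0 \<Longrightarrow> a = 0 \<and> b = 0"
  using smooth unfolding coneX smooth_intersection_def by blast

text \<open>The form \<open>dq \<and> df\<close>.\<close>

definition jac :: "complex^6 \<Rightarrow> complex^6 \<Rightarrow> complex^6 \<Rightarrow> complex" where
  "jac z m n = cdot (cgrad q z) m * cdot (cgrad f z) n - cdot (cgrad q z) n * cdot (cgrad f z) m"

text \<open>The quotient of the volume form by \<open>dq \<and> df\<close>, contracted with the Euler field, takes the value
\<open>c\<close> on \<open>v\<close>. Quantifying over all \<open>m\<close> and \<open>n\<close> avoids the choice of a complement of the tangent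
space.\<close>

definition residue_rel :: "complex^6 \<Rightarrow> (3 \<Rightarrow> complex^6) \<Rightarrow> complex \<Rightarrow> bool" where
  "residue_rel z v c \<longleftrightarrow> (\<forall>m n. rdet (six z v m n) = c * jac z m n)"

definition tangent :: "complex^6 \<Rightarrow> complex^6 \<Rightarrow> bool" where
  "tangent z v \<longleftrightarrow> cdot (cgrad q z) v = 0 \<and> cdot (cgrad f z) v = 0"

lemma tangent_self: "z \<in> cone X \<Longrightarrow> tangent z z"
  by (auto simp: tangent_def coneX homogeneous_poly_euler[OF q] homogeneous_poly_euler[OF f])

text \<open>Cramer's rule in the two columns of a nonzero minor.\<close>

lemma dual_vectors:
  assumes "z \<in> cone X"
  obtains m n where "cdot (cgrad q z) m = 1" "cdot (cgrad f z) m = 0"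
    "cdot (cgrad q z) n = 0" "cdot (cgrad f z) n = 1"
proof -
  define a b where "a = cgrad q z" and "b = cgrad f z"
  obtain j k where jk: "a $ j * b $ k - a $ k * b $ j \<noteq> 0" (is "?\<mu> \<noteq> 0")
    using nonzero_minor[OF cone_independent[OF assms]] unfolding a_def b_def by blast
  have D: "cdot v (x *s axis j 1 + y *s axis k 1) = x * v $ j + y * v $ k" for v x y
    by (simp only: cdot_add cdot_scale cdot_axis)
  show thesis
  proof (rule that)
    show "cdot (cgrad q z) ((b $ k / ?\<mu>) *s axis j 1 + (- b $ j / ?\<mu>) *s axis k 1) = 1"
      "cdot (cgrad q z) ((- a $ k / ?\<mu>) *s axis j 1 + (a $ j / ?\<mu>) *s axis k 1) = 0"
      "cdot (cgrad f z) ((b $ k / ?\<mu>) *s axis j 1 + (- b $ j / ?\<mu>) *s axis k 1) = 0"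
      "cdot (cgrad f z) ((- a $ k / ?\<mu>) *s axis j 1 + (a $ j / ?\<mu>) *s axis k 1) = 1"
      unfolding D a_def[symmetric] b_def[symmetric]
      using jk by (simp_all add: divide_simps)
  qed
qed

text \<open>Modulo the common kernel of \<open>dq\<close> and \<open>df\<close>, which contains \<open>z\<close> and the \<open>v i\<close>, every vector is a
combination of the dual vectors \<open>m\<close> and \<open>n\<close>; the determinant ignores kernel components by
\<open>rdet_two_forms\<close>.\<close>

lemma residue_rel_exists:
  assumes z: "z \<in> cone X" and v: "\<And>i. tangent z (v i)"
  shows "\<exists>c. residue_rel z v c"
proof -
  obtain m n where mn: "cdot (cgrad q z) m = 1" "cdot (cgrad f z) m = 0"
    "cdot (cgrad q z) n = 0" "cdot (cgrad f z) n = 1"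
    using dual_vectors[OF z] .
  define B where "B s t = rdet (six z v s t)" for s t
  have B1: "B s t = rdet ((\<lambda>_. z)(1 := v 1, 2 := v 2, 3 := v 3, 5 := t, 4 := s))" for s t
    unfolding B_def six_def by (auto intro!: arg_cong[of _ _ rdet] simp: fun_eq_iff)
  have B2: "B s t = rdet ((\<lambda>_. z)(1 := v 1, 2 := v 2, 3 := v 3, 4 := s, 5 := t))" for s t
    unfolding B_def six_def ..
  have Bl: "B (s + s') t = B s t + B s' t" "B (c *s s) t = c * B s t" for s s' t c
    unfolding B1 by (simp_all only: rdet_upd_add rdet_upd_scale)
  have Br: "B t (s + s') = B t s + B t s'" "B t (c *s s) = c * B t s" for s s' t c
    unfolding B2 by (simp_all only: rdet_upd_add rdet_upd_scale)
  have alt: "B s s = 0" for s unfolding B2 by (rule rdet_identical[of 4 5]) auto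
  have "B m n + B n m = 0"
    using alt[of "m + n", unfolded Bl Br, unfolded alt] by (simp add: add.commute)
  then have swap: "B n m = - B m n" by (simp add: eq_neg_iff_add_eq_0 add.commute)
  have tan: "tangent z (six z v s t i)" if "i \<noteq> 4 \<or> tangent z s" "i \<noteq> 5 \<or> tangent z t" for s t i
    using exhaust_6[of i] that tangent_self[OF z] v by (elim disjE) (simp_all add: six_simps)
  have kerl: "B s t = 0" if "tangent z s" for s t
    unfolding B_def
    by (rule rdet_two_forms[OF cone_independent[OF z], where k = 5])
       (use tan[of _ s t] that in \<open>auto simp: tangent_def\<close>)
  have kerr: "B s t = 0" if "tangent z t" for s t
    unfolding B_def
    by (rule rdet_two_forms[OF cone_independent[OF z], where k = 4])
       (use tan[of _ s t] that in \<open>auto simp: tangent_def\<close>)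
  \<comment> \<open>The component in the common kernel of \<open>dq\<close> and \<open>df\<close>.\<close>
  define r where "r s = s - cdot (cgrad q z) s *s m - cdot (cgrad f z) s *s n" for s
  have r: "tangent z (r s)" for s
    unfolding tangent_def r_def by (simp only: cdot_diff cdot_scale mn) simp
  have dec: "s = cdot (cgrad q z) s *s m + cdot (cgrad f z) s *s n + r s" for s
    by (simp add: r_def)
  have "B s t = B m n * jac z s t" for s t
  proof -
    have "B s t = B (cdot (cgrad q z) s *s m + cdot (cgrad f z) s *s n + r s)
        (cdot (cgrad q z) t *s m + cdot (cgrad f z) t *s n + r t)"
      using dec[of s] dec[of t] by simp
    also have "\<dots> = B m n * jac z s t"
      unfolding Bl Br kerl[OF r] kerr[OF r] alt swap jac_def by (simp add: algebra_simps)
    finally show ?thesis .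
  qed
  then show ?thesis unfolding residue_rel_def B_def by blast
qed

lemma residue_rel_unique:
  assumes "z \<in> cone X" "residue_rel z v c" "residue_rel z v c'"
  shows "c = c'"
proof -
  obtain m n where "cdot (cgrad q z) m = 1" "cdot (cgrad f z) m = 0"
    "cdot (cgrad q z) n = 0" "cdot (cgrad f z) n = 1"
    using dual_vectors[OF assms(1)] .
  then have "jac z m n = 1" by (simp add: jac_def)
  then show ?thesis using assms(2,3) unfolding residue_rel_def by (metis mult.right_neutral)
qed

text \<open>If \<open>z\<close> and the \<open>v i\<close> are independent, adding dual vectors \<open>m, n\<close> gives a basis of \<open>\<complex>\<^sup>6\<close>, because
\<open>dq\<close> and \<open>df\<close> detect the components along \<open>m\<close> and \<open>n\<close>.\<close>

lemma residue_rel_nonzero: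
  assumes z: "z \<in> cone X" and v: "\<And>i. tangent z (v i)" and c: "residue_rel z v c"
    and indep: "\<And>a b. a *s z + (\<Sum>i\<in>UNIV. b i *s v i) = 0 \<Longrightarrow> a = 0 \<and> (\<forall>i. b i = 0)"
  shows "c \<noteq> 0"
proof -
  obtain m n where mn: "cdot (cgrad q z) m = 1" "cdot (cgrad f z) m = 0"
    "cdot (cgrad q z) n = 0" "cdot (cgrad f z) n = 1"
    using dual_vectors[OF z] .
  have "rdet (six z v m n) \<noteq> 0"
  proof (rule rdet_independent)
    fix k :: "6 \<Rightarrow> complex"
    assume "(\<Sum>i\<in>UNIV. k i *s six z v m n i) = 0"
    then have sum: "k 0 *s z + k 1 *s v 1 + k 2 *s v 2 + k 3 *s v 3 + k 4 *s m + k 5 *s n = 0"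
      unfolding sum_6 six_simps .
    have "cdot (cgrad q z) 0 = 0" "cdot (cgrad f z) 0 = 0" by simp_all
    then have k45: "k 4 = 0" "k 5 = 0"
      using tangent_self[OF z] v unfolding sum[symmetric] cdot_add cdot_scale mn tangent_def by simp_all
    define b where "b = (\<lambda>_::3. 0::complex)(1 := k 1, 2 := k 2, 3 := k 3)"
    have "k 0 *s z + (\<Sum>i\<in>UNIV. b i *s v i) = 0"
      using sum k45 by (simp add: sum_3 b_def add_ac)
    from indep[OF this] have "k 0 = 0" "b 1 = 0" "b 2 = 0" "b 3 = 0" by auto
    then show "\<forall>i. k i = 0" using k45 by (simp add: all_6 b_def)
  qed
  moreover have "rdet (six z v m n) = c * 1" using c mn by (simp add: residue_rel_def jac_def)
  ultimately show ?thesis by auto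
qed

text \<open>The only place where \<open>d + e = 6\<close> enters: \<open>(d - 1) + (e - 1) = 4\<close> is the weight found in
\<open>rdet_six_scale\<close>.\<close>

lemma jac_scale:
  assumes "c \<noteq> 0" shows "jac (c *s z) m n = c ^ 4 * jac z m n"
proof -
  have left: "cdot (k *s a) v = k * cdot a v" for k and a v :: "complex^6"
    by (simp add: sum_distrib_left mult_ac)
  have "c ^ 4 = c ^ (d - 1) * c ^ (e - 1)"
    using pos degree by (simp add: power_add[symmetric])
  then show ?thesis
    unfolding jac_def homogeneous_poly_cgrad_scale[OF q pos(1) assms]
      homogeneous_poly_cgrad_scale[OF f pos(2) assms] left by (simp add: algebra_simps)
qed

lemma residue_rel_jet_lift:
  assumes "jet_lift \<phi> x F F'" "jet_lift \<phi> x G G'" "residue_rel (F x) (partials F') c"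
  shows "residue_rel (G x) (partials G') c"
proof -
  obtain k \<beta> where k: "k \<noteq> 0" "G x = k *s F x" "\<And>h. G' h = \<beta> h *s F x + k *s F' h"
    by (rule jet_lift_unique[OF assms(1,2)]) blast
  show ?thesis
    using assms(3) unfolding residue_rel_def k(2,3) jac_scale[OF k(1)] rdet_six_scale by simp
qed

text \<open>A lift stays in the cone, so \<open>q\<close> and \<open>f\<close> vanish along it.\<close>

lemma jet_lift_tangent:
  assumes "jet_lift \<phi> x F F'" "\<forall>\<^sub>F y in nhds x. \<phi> y \<in> X"
  shows "F x \<in> cone X" "tangent (F x) (F' h)"
proof -
  have dF: "(F has_derivative F') (at x)" using assms by (simp add: jet_lift_def)
  have "\<forall>\<^sub>F y in nhds x. (F y \<noteq> 0 \<and> \<phi> y = cline (F y)) \<and> \<phi> y \<in> X"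
    by (rule eventually_conj) (use assms in \<open>auto simp: jet_lift_def\<close>)
  then have ev: "\<forall>\<^sub>F y in nhds x. F y \<in> cone X"
    by eventually_elim (auto simp: cone_def)
  show "F x \<in> cone X" using eventually_nhds_x_imp_x[OF ev] .
  then have x0: "q (F x) = 0" "f (F x) = 0" by (auto simp: coneX)
  have "cdot (cgrad p (F x)) (F' h) = 0"
    if p: "homogeneous_poly k p" "p (F x) = 0" and p0: "\<And>z. z \<in> cone X \<Longrightarrow> p z = 0" for p k
  proof -
    have 1: "((\<lambda>y. p (F y)) has_derivative (\<lambda>h. cdot (cgrad p (F x)) (F' h))) (at x)"
      using has_derivative_compose[OF dF homogeneous_poly_derivative(2)[OF p(1)]] .
    have 2: "((\<lambda>y. p (F y)) has_derivative (\<lambda>h. 0)) (at x)"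
      by (rule has_derivative_transform_eventually[OF has_derivative_const])
         (use ev p p0 in \<open>auto simp: eventually_nhds_conv_at elim: eventually_mono\<close>)
    show ?thesis using fun_cong[OF has_derivative_unique[OF 1 2]] .
  qed
  from this[OF q x0(1)] this[OF f x0(2)] show "tangent (F x) (F' h)"
    unfolding tangent_def coneX by simp
qed

definition residue_form :: "(complex^3 \<Rightarrow> (complex^6) set) \<Rightarrow> complex^3 \<Rightarrow> complex" where
  "residue_form \<phi> x = (THE c. \<forall>F F'. jet_lift \<phi> x F F' \<longrightarrow> residue_rel (F x) (partials F') c)"

lemma residue_form:
  assumes F: "jet_lift \<phi> x F F'" and X: "\<forall>\<^sub>F y in nhds x. \<phi> y \<in> X"
  shows "residue_rel (F x) (partials F') (residue_form \<phi> x)"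
proof -
  note t = jet_lift_tangent[OF F X]
  obtain c where c: "residue_rel (F x) (partials F') c"
    using residue_rel_exists[OF t(1), of "partials F'"] t(2) by blast
  have "residue_form \<phi> x = c"
    unfolding residue_form_def
  proof (rule the_equality)
    show "\<forall>F F'. jet_lift \<phi> x F F' \<longrightarrow> residue_rel (F x) (partials F') c"
      using residue_rel_jet_lift[OF F _ c] by blast
    show "k = c" if "\<forall>F F'. jet_lift \<phi> x F F' \<longrightarrow> residue_rel (F x) (partials F') k" for k
      using residue_rel_unique[OF t(1) _ c] that F by blast
  qed
  with c show ?thesis by simp
qed

lemma residue_form_nonzero:
  assumes "hol_chart X U \<phi>" "x \<in> U" shows "residue_form \<phi> x \<noteq> 0"
proof -
  obtain V F where V: "open V" "x \<in> V" "V \<subseteq> U" "hol_map_on V F"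
    "\<And>y. y \<in> V \<Longrightarrow> F y \<noteq> 0 \<and> \<phi> y = cline (F y)" "\<And>y. y \<in> V \<Longrightarrow> \<phi> y \<in> X"
    by (rule chart_lift[OF assms]) blast
  have jet: "jet_lift \<phi> x F (jacobi F x)" using lift_jet[OF V(1,4,5,2)] .
  have ev: "\<forall>\<^sub>F y in nhds x. \<phi> y \<in> X"
    using eventually_nhds_in_open[OF V(1,2)] V(6) by (auto elim: eventually_mono)
  show ?thesis
    using residue_rel_nonzero[OF jet_lift_tangent[OF jet ev] residue_form[OF jet ev]
        chart_partials_independent[OF assms V(1,4,5,3,2)]] by blast
qed

text \<open>Near a point, one lift and one pair of dual vectors serve for all parameters, which makes the
residue a quotient of holomorphic functions.\<close>

lemma residue_form_hol:
  assumes "hol_chart X U \<phi>" shows "hol_fun_on U (residue_form \<phi>)"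
proof (rule hol_fun_on_local)
  fix x assume x: "x \<in> U"
  obtain V F where V: "open V" "x \<in> V" "V \<subseteq> U" "hol_map_on V F"
    "\<And>y. y \<in> V \<Longrightarrow> F y \<noteq> 0 \<and> \<phi> y = cline (F y)" "\<And>y. y \<in> V \<Longrightarrow> \<phi> y \<in> X"
    by (rule chart_lift[OF assms x]) blast
  have ev: "\<forall>\<^sub>F y in nhds u. \<phi> y \<in> X" if "u \<in> V" for u
    using eventually_nhds_in_open[OF V(1) that] V(6) by (auto elim: eventually_mono)
  have jet: "jet_lift \<phi> y F (jacobi F y)" if "y \<in> V" for y using lift_jet[OF V(1,4,5) that] .
  obtain m n where mn: "cdot (cgrad q (F x)) m = 1" "cdot (cgrad f (F x)) m = 0"
    "cdot (cgrad q (F x)) n = 0" "cdot (cgrad f (F x)) n = 1"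
    using dual_vectors[OF jet_lift_tangent(1)[OF jet[OF V(2)] ev[OF V(2)]]] .
  have gradhol: "hol_fun_on UNIV (\<lambda>z. cdot (cgrad p z) h)" if "homogeneous_poly k p" for p k h
    unfolding homogeneous_poly_derivative(1)[OF that, symmetric]
    by (rule hol_fun_on_frechet_derivative) (rule homogeneous_poly_hol[OF that])
  have jachol: "hol_fun_on V (\<lambda>y. jac (F y) m n)"
    unfolding jac_def
    by (intro hol_fun_on_diff hol_fun_on_mult hol_fun_on_compose[OF gradhol[OF q] V(4)]
        hol_fun_on_compose[OF gradhol[OF f] V(4)]) auto
  define W where "W = V \<inter> (\<lambda>y. jac (F y) m n) -` (- {0})"
  have "open W"
    unfolding W_def using hol_fun_on_continuous[OF jachol] V(1)
    by (rule continuous_open_preimage) auto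
  have WV: "W \<subseteq> V" by (auto simp: W_def)
  have "x \<in> W" using V(2) mn by (simp add: W_def jac_def)
  have Fhol: "hol_fun_on V (\<lambda>y. F y $ j)" for j using V(4) unfolding hol_map_on_def by blast
  have "hol_fun_on V (\<lambda>y. rdet (six (F y) (partials (jacobi F y)) m n))"
  proof (rule hol_fun_on_det[OF V(1)])
    fix i j :: 6
    show "hol_fun_on V (\<lambda>y. (\<chi> i. six (F y) (partials (jacobi F y)) m n i) $ i $ j)"
      using exhaust_6[of i]
      by (elim disjE; simp add: six_simps jacobi_def Fhol hol_fun_on_frechet_derivative[OF Fhol] hol_fun_on_const[OF V(1)])
  qed
  then have "hol_fun_on W (\<lambda>y. rdet (six (F y) (partials (jacobi F y)) m n) / jac (F y) m n)"
    by (intro hol_fun_on_divide hol_fun_on_subset[OF _ \<open>open W\<close> WV] jachol) (auto simp: W_def)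
  moreover have "rdet (six (F y) (partials (jacobi F y)) m n) / jac (F y) m n = residue_form \<phi> y" if "y \<in> W" for y
    using residue_form[OF jet ev, of y] that WV by (auto simp: residue_rel_def W_def)
  ultimately have "hol_fun_on W (residue_form \<phi>)" by (rule hol_fun_on_cong)
  then show "\<exists>V. x \<in> V \<and> V \<subseteq> U \<and> hol_fun_on V (residue_form \<phi>)"
    using \<open>x \<in> W\<close> WV V(3) by blast
qed

text \<open>A lift of \<open>\<psi>\<close> composed with the coordinate change is a lift of \<open>\<phi>\<close>, and its partial derivatives
are those of the lift of \<open>\<psi>\<close> combined by the matrix \<open>A\<close>.\<close>

lemma residue_form_transform:
  assumes \<phi>: "hol_chart X U \<phi>" and \<psi>: "hol_chart X V \<psi>" and x: "x \<in> U" and y: "y \<in> V"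
    and xy: "\<phi> x = \<psi> y"
    and A: "((\<lambda>u. inv_into V \<psi> (\<phi> u)) has_derivative (\<lambda>h. A *v h)) (at x)"
  shows "residue_form \<phi> x = residue_form \<psi> y * det A"
proof -
  let ?\<tau> = "\<lambda>u. inv_into V \<psi> (\<phi> u)"
  have inj: "inj_on \<psi> V" and opn: "openin (top_of_set (cone X)) (cone (\<psi> ` V))"
    using \<psi> by (auto simp: hol_chart_def)
  have \<tau>x: "?\<tau> x = y" using inv_into_f_f[OF inj y] xy by simp
  obtain U1 F where F: "open U1" "x \<in> U1" "hol_map_on U1 F"
    "\<And>y. y \<in> U1 \<Longrightarrow> F y \<noteq> 0 \<and> \<phi> y = cline (F y)" "\<And>y. y \<in> U1 \<Longrightarrow> \<phi> y \<in> X"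
    using chart_lift[OF \<phi> x] by metis
  obtain V1 G where G: "open V1" "y \<in> V1" "hol_map_on V1 G"
    "\<And>y. y \<in> V1 \<Longrightarrow> G y \<noteq> 0 \<and> \<psi> y = cline (G y)" "\<And>y. y \<in> V1 \<Longrightarrow> \<psi> y \<in> X"
    using chart_lift[OF \<psi> y] by metis
  have X\<phi>: "\<forall>\<^sub>F u in nhds x. \<phi> u \<in> X"
    using eventually_nhds_in_open[OF F(1,2)] F(5) by (auto elim: eventually_mono)
  have X\<psi>: "\<forall>\<^sub>F u in nhds y. \<psi> u \<in> X"
    using eventually_nhds_in_open[OF G(1,2)] G(5) by (auto elim: eventually_mono)
  have jetG: "jet_lift \<psi> y G (jacobi G y)" using lift_jet[OF G(1,3,4,2)] .
  have "jet_lift \<phi> x (\<lambda>u. G (?\<tau> u)) (\<lambda>h. jacobi G y (A *v h))"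
    unfolding jet_lift_def
  proof
    show "((\<lambda>u. G (?\<tau> u)) has_derivative (\<lambda>h. jacobi G y (A *v h))) (at x)"
      using has_derivative_compose[OF A, of G "jacobi G y"] jacobi(1)[OF G(3,2)] \<tau>x by simp
    obtain T where T: "open T" "cone (\<psi> ` V) = cone X \<inter> T" using opn by (auto simp: openin_open)
    have "F x \<in> T" using T(2) F(2,4) xy y by (auto simp: cone_def)
    moreover have "open (U1 \<inter> F -` T)"
      using hol_map_on_continuous[OF F(3)] F(1) T(1) by (rule continuous_open_preimage)
    ultimately have 1: "\<forall>\<^sub>F u in nhds x. u \<in> U1 \<inter> F -` T"
      using F(2) by (intro eventually_nhds_in_open) auto
    have "isCont ?\<tau> x" using A by (rule has_derivative_continuous)
    then have "(?\<tau> \<longlongrightarrow> y) (nhds x)" using \<tau>x tendsto_at_iff_tendsto_nhds[of ?\<tau> x] by (simp add: isCont_def)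
    then have 2: "\<forall>\<^sub>F u in nhds x. ?\<tau> u \<in> V1" using G(1,2) by (rule topological_tendstoD)
    from 1 2 show "\<forall>\<^sub>F u in nhds x. G (?\<tau> u) \<noteq> 0 \<and> \<phi> u = cline (G (?\<tau> u))"
    proof eventually_elim
      case (elim u)
      then have "F u \<in> cone X" using F(4,5)[of u] by (auto simp: cone_def)
      then have "F u \<in> cone (\<psi> ` V)" using T elim by blast
      then have "\<phi> u \<in> \<psi> ` V" using F(4)[of u] elim by (auto simp: cone_def)
      then have "\<psi> (?\<tau> u) = \<phi> u" by (rule f_inv_into_f)
      then show ?case using G(4)[OF elim(2)] by simp
    qed
  qed
  from residue_form[OF this X\<phi>]
  have res\<phi>: "residue_rel (G y) (\<lambda>i. jacobi G y (A *v axis i 1)) (residue_form \<phi> x)"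
    unfolding \<tau>x .
  interpret G': bounded_linear "jacobi G y"
    using jacobi(1)[OF G(3,2)] by (rule has_derivative_bounded_linear)
  have "A *v axis i 1 = (\<Sum>j\<in>UNIV. A $ j $ i *s axis j 1)" for i
    using basis_expansion[of "column i A"] by (simp add: matrix_vector_mult_def column_def cdot_axis)
  then have col: "jacobi G y (A *v axis i 1) = (\<Sum>j\<in>UNIV. A $ j $ i *s jacobi G y (axis j 1))" for i
    by (simp add: G'.sum jacobi(2)[OF G(3,2)])
  have "residue_rel (G y) (\<lambda>i. jacobi G y (A *v axis i 1)) (residue_form \<psi> y * det A)"
    using residue_form[OF jetG X\<psi>]
    unfolding residue_rel_def col rdet_six_linear_combination by simp
  then show ?thesis
    using residue_rel_unique[OF jet_lift_tangent(1)[OF jetG X\<psi>] res\<phi>] by simp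
qed

theorem calabi_yau: "calabi_yau_threefold X"
proof -
  have "projective_threefold X"
    unfolding X_def using smooth_intersection_projective_threefold[OF q f smooth] .
  moreover have "canonical_class_torsion X"
    unfolding canonical_class_torsion_def
  proof (intro exI[of _ "1::nat"] conjI exI[of _ "\<lambda>U \<phi> x. residue_form \<phi> x"])
  qed (use residue_form_hol residue_form_nonzero residue_form_transform in auto)
  ultimately show ?thesis by (simp add: calabi_yau_threefold_def)
qed

end

section \<open>Diagonal forms\<close>

definition diag_form :: "nat \<Rightarrow> ('m::finite \<Rightarrow> complex) \<Rightarrow> complex^'m \<Rightarrow> complex" where
  "diag_form d c z = (\<Sum>i\<in>UNIV. c i * z $ i ^ d)"

text \<open>The coefficient of the exponent \<open>d e\<^sub>i\<close> is \<open>c i\<close>. Summing over \<open>i\<close> in the coefficient function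
covers \<open>d = 0\<close>, where all these exponents coincide.\<close>

lemma homogeneous_poly_diag_form: "homogeneous_poly d (diag_form d (c :: 'm::finite \<Rightarrow> complex))"
proof -
  define \<delta> where "\<delta> i = (\<lambda>j::'m. if j = i then d else 0)" for i
  define S where "S = {\<alpha> :: 'm \<Rightarrow> nat. sum \<alpha> UNIV = d}"
  have "\<alpha> i \<le> d" if "sum \<alpha> UNIV = d" for \<alpha> :: "'m \<Rightarrow> nat" and i
    using member_le_sum[of i UNIV \<alpha>] that by simp
  then have "S \<subseteq> (UNIV :: 'm set) \<rightarrow>\<^sub>E {..d}" by (auto simp: S_def)
  then have fin: "finite S" by (rule finite_subset) (simp add: finite_PiE)
  have \<delta>S: "\<delta> i \<in> S" for i by (simp add: S_def \<delta>_def)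
  have mon: "(\<Prod>j\<in>UNIV. z $ j ^ \<delta> i j) = z $ i ^ d" for z :: "complex^'m" and i
    by (simp add: \<delta>_def if_distrib[of "\<lambda>k. _ ^ k"] cong: if_cong)
  have "diag_form d c z = (\<Sum>\<alpha>\<in>S. (\<Sum>i\<in>UNIV. if \<alpha> = \<delta> i then c i else 0) * (\<Prod>j\<in>UNIV. z $ j ^ \<alpha> j))" for z
  proof -
    have "(\<Sum>\<alpha>\<in>S. (\<Sum>i\<in>UNIV. if \<alpha> = \<delta> i then c i else 0) * (\<Prod>j\<in>UNIV. z $ j ^ \<alpha> j))
        = (\<Sum>i\<in>UNIV. \<Sum>\<alpha>\<in>S. if \<alpha> = \<delta> i then c i * (\<Prod>j\<in>UNIV. z $ j ^ \<alpha> j) else 0)"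
      unfolding sum_distrib_right by (subst sum.swap) (auto intro!: sum.cong)
    also have "\<dots> = (\<Sum>i\<in>UNIV. c i * z $ i ^ d)"
      using fin \<delta>S by (simp add: mon)
    finally show ?thesis by (simp add: diag_form_def)
  qed
  then show ?thesis
    unfolding homogeneous_poly_def S_def
    by (intro exI[of _ "\<lambda>\<alpha>. \<Sum>i\<in>UNIV. if \<alpha> = \<delta> i then c i else 0"] ext)
qed

lemma cgrad_diag_form: "cgrad (diag_form d c) z = (\<chi> i. of_nat d * c i * z $ i ^ (d - 1))"
proof -
  have "((\<lambda>t. diag_form d c (z + axis i t)) has_field_derivative of_nat d * c i * z $ i ^ (d - 1)) (at 0)" for i
  proof -
    have "((\<lambda>t. \<Sum>j\<in>UNIV. c j * (z + axis i t) $ j ^ d) has_field_derivative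
        (\<Sum>j\<in>UNIV. if j = i then of_nat d * c i * z $ i ^ (d - 1) else 0)) (at 0)"
    proof (rule DERIV_sum)
      fix j
      show "((\<lambda>t. c j * (z + axis i t) $ j ^ d) has_field_derivative
          (if j = i then of_nat d * c i * z $ i ^ (d - 1) else 0)) (at 0)"
        by (cases "j = i") (auto simp: axis_def intro!: derivative_eq_intros)
    qed
    then show ?thesis by (simp add: diag_form_def)
  qed
  then show ?thesis by (simp add: cgrad_def vec_eq_iff DERIV_imp_deriv)
qed

lemma smooth_hypersurface_diag_form:
  assumes "\<And>i. a i \<noteq> 0" shows "smooth_hypersurface (diag_form 2 a)"
  using assms by (auto simp: smooth_hypersurface_def cgrad_diag_form vec_eq_iff)

text \<open>If \<open>s dq + t df = 0\<close> at \<open>z\<close> with \<open>t \<noteq> 0\<close>, then \<open>z\<^sub>i\<^sup>2 = - s/(2t) a\<^sub>i/b\<^sub>i\<close> for all \<open>i\<close> in the support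
of \<open>z\<close>, and substituting this into the quadric gives a multiple of the excluded sum.\<close>

lemma smooth_intersection_diag_forms:
  assumes a: "\<And>i. a i \<noteq> 0" and b: "\<And>i. b i \<noteq> 0"
    and sums: "\<And>I. I \<noteq> {} \<Longrightarrow> (\<Sum>i\<in>I. (a i)\<^sup>2 / b i) \<noteq> 0"
  shows "smooth_intersection (diag_form 2 a) (diag_form 4 b)"
  unfolding smooth_intersection_def
proof (intro allI impI)
  fix z s t
  assume z: "z \<noteq> 0 \<and> diag_form 2 a z = 0 \<and> diag_form 4 b z = 0"
    and "s *s cgrad (diag_form 2 a) z + t *s cgrad (diag_form 4 b) z = 0"
  then have eq: "s * (2 * a i * z $ i) + t * (4 * b i * z $ i ^ 3) = 0" for i
    by (simp add: cgrad_diag_form vec_eq_iff)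
  define I where "I = {i. z $ i \<noteq> 0}"
  from z have I: "I \<noteq> {}" by (auto simp: I_def vec_eq_iff)
  then obtain k where k: "z $ k \<noteq> 0" by (auto simp: I_def)
  show "s = 0 \<and> t = 0"
  proof (cases "t = 0")
    case True
    then show ?thesis using eq[of k] a k by simp
  next
    case False
    have sq: "(z $ i)\<^sup>2 = - s / (2 * t) * (a i / b i)" if "i \<in> I" for i
    proof -
      have "2 * z $ i * (s * a i + 2 * t * b i * (z $ i)\<^sup>2) = 0"
        using eq[of i] by (simp add: algebra_simps power2_eq_square power3_eq_cube)
      then have "s * a i + 2 * t * b i * (z $ i)\<^sup>2 = 0" using that by (simp add: I_def)
      then show ?thesis using False b[of i] by (simp add: field_simps) (metis add_eq_0_iff)
    qed
    have "0 = (\<Sum>i\<in>UNIV. a i * (z $ i)\<^sup>2)" using z by (simp add: diag_form_def)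
    also have "\<dots> = (\<Sum>i\<in>I. a i * (z $ i)\<^sup>2)"
      by (rule sum.mono_neutral_right) (auto simp: I_def)
    also have "\<dots> = (\<Sum>i\<in>I. - s / (2 * t) * ((a i)\<^sup>2 / b i))"
    proof (rule sum.cong)
      show "a i * (z $ i)\<^sup>2 = - s / (2 * t) * ((a i)\<^sup>2 / b i)" if "i \<in> I" for i
        unfolding sq[OF that] by (simp add: power2_eq_square)
    qed simp
    also have "\<dots> = - s / (2 * t) * (\<Sum>i\<in>I. (a i)\<^sup>2 / b i)" by (simp add: sum_distrib_left)
    finally have "s = 0" using False sums[OF I] by simp
    then show ?thesis using sq[of k] k by (simp add: I_def)
  qed
qed

definition coeff2 :: "6 \<Rightarrow> complex" where
  "coeff2 = (\<lambda>i. if i = 0 \<or> i = 1 then 1 else -1)"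

text \<open>The reciprocals of the coefficients are proportional to \<open>9, 1, -3\<close>. As \<open>9 i + j - 3 k\<close> vanishes for
\<open>i, j, k \<le> 2\<close> only if \<open>i = j = k = 0\<close>, the intersection with the quadric is smooth. A second
constraint comes from the real locus: the term of \<open>x\<^sub>0, x\<^sub>1\<close> must be dominated by that of \<open>x\<^sub>4, x\<^sub>5\<close>,
as in \<open>three_torus_positive\<close>.\<close>

definition coeff4 :: "6 \<Rightarrow> complex" where
  "coeff4 = (\<lambda>i. if i = 0 \<or> i = 1 then 1 else if i = 2 \<or> i = 3 then 9 else -3)"

abbreviation quadric :: "complex^6 \<Rightarrow> complex" where "quadric \<equiv> diag_form 2 coeff2"
abbreviation quartic :: "complex^6 \<Rightarrow> complex" where "quartic \<equiv> diag_form 4 coeff4"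
abbreviation threefold :: "(complex^6) set set" where "threefold \<equiv> zero_locus quadric \<inter> zero_locus quartic"

lemma quadric_eq: "quadric z = (z $ 0)\<^sup>2 + (z $ 1)\<^sup>2 - (z $ 2)\<^sup>2 - (z $ 3)\<^sup>2 - (z $ 4)\<^sup>2 - (z $ 5)\<^sup>2"
  by (simp add: diag_form_def sum_6 coeff2_def)

lemma quartic_eq:
  "quartic z = z $ 0 ^ 4 + z $ 1 ^ 4 + 9 * (z $ 2 ^ 4 + z $ 3 ^ 4) - 3 * (z $ 4 ^ 4 + z $ 5 ^ 4)"
  by (simp add: diag_form_def sum_6 coeff4_def)

lemma smooth_quadric_quartic: "smooth_intersection quadric quartic"
proof (rule smooth_intersection_diag_forms)
  show "coeff2 i \<noteq> 0" "coeff4 i \<noteq> 0" for i by (simp_all add: coeff2_def coeff4_def)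
  fix I :: "6 set" assume "I \<noteq> {}"
  have "(\<Sum>i\<in>I. (coeff2 i)\<^sup>2 / coeff4 i) = (\<Sum>i\<in>UNIV. if i \<in> I then (coeff2 i)\<^sup>2 / coeff4 i else 0)"
    by (simp add: sum.If_cases)
  also have "\<dots> = (if 0 \<in> I then 1 else 0) + (if 1 \<in> I then 1 else 0)
      + (if 2 \<in> I then 1/9 else 0) + (if 3 \<in> I then 1/9 else 0)
      + (if 4 \<in> I then -1/3 else 0) + (if 5 \<in> I then -1/3 else 0)"
    by (simp add: sum_6 coeff2_def coeff4_def)
  also have "\<dots> \<noteq> 0"
  proof -
    have "0 \<in> I \<or> 1 \<in> I \<or> 2 \<in> I \<or> 3 \<in> I \<or> 4 \<in> I \<or> 5 \<in> I"
      using \<open>I \<noteq> {}\<close> exhaust_6 by (metis ex_in_conv)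
    then show ?thesis
      by (cases "0 \<in> I"; cases "1 \<in> I"; cases "2 \<in> I"; cases "3 \<in> I"; cases "4 \<in> I"; cases "5 \<in> I") simp_all
  qed
  finally show "(\<Sum>i\<in>I. (coeff2 i)\<^sup>2 / coeff4 i) \<noteq> 0" .
qed

interpretation threefold: bidegree_intersection quadric quartic 2 4 threefold
  by unfold_locales (auto intro: homogeneous_poly_diag_form smooth_quadric_quartic)

section \<open>Complex conjugation\<close>

definition conj_line :: "(complex^'m) set \<Rightarrow> (complex^'m) set" where
  "conj_line p = cnj_vec ` p"

lemma cnj_vec_cnj_vec [simp]: "cnj_vec (cnj_vec z) = z"
  by (simp add: cnj_vec_def vec_eq_iff)

lemma cnj_vec_eq_0_iff [simp]: "cnj_vec z = 0 \<longleftrightarrow> z = 0"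
  by (simp add: cnj_vec_def vec_eq_iff)

lemma conj_line_cline: "conj_line (cline z) = cline (cnj_vec z)"
proof -
  have "cnj_vec (c *s z) = cnj c *s cnj_vec z" for c
    by (simp add: cnj_vec_def vec_eq_iff)
  then have "conj_line (cline z) = {cnj c *s cnj_vec z | c. True}"
    by (auto simp: conj_line_def cline_def image_def)
  also have "\<dots> = cline (cnj_vec z)"
    unfolding cline_def by (auto intro: exI[of _ "cnj _"])
  finally show ?thesis .
qed

text \<open>Conjugation lifts globally to the antiholomorphic map \<open>cnj_vec\<close>.\<close>

lemma real_structure_conj_line:
  assumes "X \<subseteq> proj_space" and inv: "\<And>z. z \<in> cone X \<Longrightarrow> cnj_vec z \<in> cone X"
  shows "real_structure X conj_line"
proof -
  have X: "\<exists>z. z \<noteq> 0 \<and> p = cline z \<and> z \<in> cone X" if "p \<in> X" for p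
    using that assms(1) by (auto simp: proj_space_def cone_def)
  have "conj_line p \<in> X \<and> conj_line (conj_line p) = p" if "p \<in> X" for p
  proof -
    from X[OF that] obtain z where z: "p = cline z" "z \<in> cone X" by blast
    then show ?thesis using inv[OF z(2)] by (simp add: conj_line_cline cone_def)
  qed
  moreover have "locally_lifts antihol_map_on (cone X) (conj_line \<circ> cline)"
    unfolding locally_lifts_def antihol_map_on_def
    by (intro ballI exI[of _ UNIV] exI[of _ cnj_vec])
       (auto simp: hol_map_on_ident conj_line_cline cone_def)
  ultimately show ?thesis unfolding real_structure_def by blast
qed

text \<open>If \<open>cnj z = c z\<close>, then \<open>z + cnj z = (1 + c) z\<close> is a real representative unless \<open>c = -1\<close>, in which
case \<open>z\<close> is purely imaginary.\<close>

lemma real_representative: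
  assumes "z \<noteq> 0" "conj_line (cline z) = cline z"
  obtains x :: "complex^'m" where "x \<noteq> 0" "cline z = cline x" "\<And>i. x $ i \<in> \<real>"
proof -
  have "cline z = cline (cnj_vec z)" using assms by (simp add: conj_line_cline)
  then obtain c where c: "c \<noteq> 0" "cnj_vec z = c *s z" using cline_eq_iff[OF assms(1)] by blast
  then have cn: "cnj (z $ i) = c * z $ i" for i
    by (metis cnj_vec_def vec_lambda_beta vector_smult_component)
  show thesis
  proof (cases "c = -1")
    case False
    then have "1 + c \<noteq> 0" by (metis add_eq_0_iff add.commute)
    moreover have "((1 + c) *s z) $ i \<in> \<real>" for i
    proof -
      have "((1 + c) *s z) $ i = z $ i + cnj (z $ i)" by (simp add: cn algebra_simps)
      then show ?thesis by (simp add: complex_add_cnj)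
    qed
    moreover from calculation(1) have "(1 + c) *s z \<noteq> 0" using assms(1) by (simp only: vector_mul_eq_0 simp_thms)
    ultimately show thesis using that[of "(1 + c) *s z"] cline_scale[of "1 + c" z] by metis
  next
    case True
    have "(\<i> *s z) $ i \<in> \<real>" for i
      using cn[of i] True by (simp add: complex_is_Real_iff complex_eq_iff)
    then show thesis using that[of "\<i> *s z"] assms(1) cline_scale[of \<i> z] by simp
  qed
qed

lemma cone_threefold_cnj:
  assumes "z \<in> cone threefold" shows "cnj_vec z \<in> cone threefold"
proof -
  have "quadric (cnj_vec z) = cnj (quadric z)" "quartic (cnj_vec z) = cnj (quartic z)"
    by (simp_all add: quadric_eq quartic_eq cnj_vec_def)
  then show ?thesis using assms by (simp add: threefold.coneX)
qed

section \<open>The real points form a torus\<close>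

text \<open>The value of \<open>(Re e)\<^sup>4 + (Im e)\<^sup>4\<close> at a unit complex number \<open>e\<close> with square \<open>w\<close>. Its dependence on \<open>e\<^sup>2\<close>
alone is what makes the quartic well defined in the coordinates of the torus.\<close>

definition circle_quartic :: "complex \<Rightarrow> real" where "circle_quartic w = 1 - (Im w)\<^sup>2 / 2"

lemma circle_quartic_bounds: "norm w = 1 \<Longrightarrow> 1/2 \<le> circle_quartic w \<and> circle_quartic w \<le> 1"
  using abs_Im_le_cmod[of w] abs_square_le_1[of "Im w"] by (simp add: circle_quartic_def)

lemma norm_Re_Im_sgn: "norm E * Re (sgn E) = Re E" "norm E * Im (sgn E) = Im E"
  by (cases "E = 0"; simp add: sgn_eq)+

lemma circle_quartic_sgn: "norm E ^ 4 * circle_quartic ((sgn E)\<^sup>2) = Re E ^ 4 + Im E ^ 4"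
proof (cases "E = 0")
  case False
  define a b where "a = Re (sgn E)" and "b = Im (sgn E)"
  have "norm (sgn E) = 1" using False by (simp add: norm_sgn)
  then have "a\<^sup>2 + b\<^sup>2 = 1" unfolding a_def b_def by (metis cmod_power2 one_power2)
  then have "1 = (a\<^sup>2 + b\<^sup>2)\<^sup>2" by simp
  also have "\<dots> = a ^ 4 + b ^ 4 + 2 * a\<^sup>2 * b\<^sup>2" by algebra
  finally have ab: "1 = a ^ 4 + b ^ 4 + 2 * a\<^sup>2 * b\<^sup>2" .
  have Im2: "Im (z\<^sup>2) = 2 * Re z * Im z" for z by (simp add: power2_eq_square)
  have "circle_quartic ((sgn E)\<^sup>2) = 1 - (2 * a * b)\<^sup>2 / 2"
    unfolding circle_quartic_def Im2 a_def[symmetric] b_def[symmetric] ..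
  then have "circle_quartic ((sgn E)\<^sup>2) = a ^ 4 + b ^ 4"
    by (subst (asm) ab) (simp add: power_mult_distrib)
  then have "norm E ^ 4 * circle_quartic ((sgn E)\<^sup>2) = (norm E * a) ^ 4 + (norm E * b) ^ 4"
    by (simp add: power_mult_distrib distrib_left)
  then show ?thesis by (simp only: a_def b_def norm_Re_Im_sgn)
qed simp

text \<open>For unit complex numbers \<open>e0\<close> and \<open>e\<close> with \<open>w0 = e0\<^sup>2\<close> and \<open>w = e/e0\<close> these are \<open>e0 Re e\<close> and
\<open>e0 Im e\<close> (see \<open>turned_unit\<close>): multiplication by \<open>e0\<close> makes the real coordinates of \<open>e\<close>
independent of the common sign of \<open>e0\<close> and \<open>e\<close>.\<close>

definition turned_re :: "complex \<Rightarrow> complex \<Rightarrow> complex" where "turned_re w0 w = (w0 * w + cnj w) / 2"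
definition turned_im :: "complex \<Rightarrow> complex \<Rightarrow> complex" where "turned_im w0 w = (w0 * w - cnj w) / (2 * \<i>)"

lemma turned: "turned_re w0 w + \<i> * turned_im w0 w = w0 * w" "turned_re w0 w - \<i> * turned_im w0 w = cnj w"
  by (simp_all add: turned_re_def turned_im_def field_simps)

lemma turned_power2:
  assumes "norm w = 1" shows "(turned_re w0 w)\<^sup>2 + (turned_im w0 w)\<^sup>2 = w0"
proof -
  have "(turned_re w0 w)\<^sup>2 + (turned_im w0 w)\<^sup>2 = (turned_re w0 w + \<i> * turned_im w0 w) * (turned_re w0 w - \<i> * turned_im w0 w)"
    by (simp add: algebra_simps power2_eq_square)
  also have "\<dots> = w0 * (w * cnj w)" unfolding turned by simp
  finally show ?thesis using assms by (simp add: complex_norm_square[symmetric])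
qed

text \<open>The sum of fourth powers is the square of the sum of squares minus twice the squared product,
and the product is \<open>w0/2\<close> times the imaginary part of \<open>w\<^sup>2 w0\<close>.\<close>

lemma turned_power4:
  assumes "norm w = 1" "norm w0 = 1"
  shows "(turned_re w0 w) ^ 4 + (turned_im w0 w) ^ 4 = w0\<^sup>2 * of_real (circle_quartic (w\<^sup>2 * w0))"
proof -
  have c: "w0 * cnj w0 = 1" using assms by (simp add: complex_norm_square[symmetric])
  have "4 * \<i> * (turned_re w0 w * turned_im w0 w) = (w0 * w)\<^sup>2 - (cnj w)\<^sup>2"
    unfolding turned[of w0 w, symmetric] by (simp add: algebra_simps power2_eq_square)
  also have "\<dots> = w0 * (w\<^sup>2 * w0) - w0 * cnj w0 * (cnj w)\<^sup>2" by (simp add: c power2_eq_square mult_ac)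
  also have "\<dots> = w0 * (w\<^sup>2 * w0 - cnj (w\<^sup>2 * w0))" by (simp add: algebra_simps)
  also have "\<dots> = 4 * \<i> * (w0 * of_real (Im (w\<^sup>2 * w0)) / 2)" unfolding complex_diff_cnj by (simp del: times_complex.sel)
  finally have pm: "turned_re w0 w * turned_im w0 w = w0 * of_real (Im (w\<^sup>2 * w0)) / 2"
    by (simp add: mult_ac del: times_complex.sel)
  have "(turned_re w0 w) ^ 4 + (turned_im w0 w) ^ 4 = ((turned_re w0 w)\<^sup>2 + (turned_im w0 w)\<^sup>2)\<^sup>2 - 2 * (turned_re w0 w * turned_im w0 w)\<^sup>2"
    by (simp add: algebra_simps power2_eq_square power4_eq_xxxx)
  then show ?thesis
    unfolding turned_power2[OF assms(1)] pm circle_quartic_def of_real_diff of_real_divide of_real_power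
    by (simp add: right_diff_distrib power_mult_distrib power_divide del: times_complex.sel)
qed

lemma turned_unit:
  assumes "norm e0 = 1"
  shows "turned_re (e0\<^sup>2) (e / e0) = e0 * of_real (Re e)" "turned_im (e0\<^sup>2) (e / e0) = e0 * of_real (Im e)"
proof -
  have c: "e0 * cnj e0 = 1" "e0 \<noteq> 0" using assms by (auto simp: complex_norm_square[symmetric])
  then have "inverse e0 = cnj e0" by (metis inverse_unique)
  then have w: "e0\<^sup>2 * (e / e0) = e0 * e" "cnj (e / e0) = e0 * cnj e"
    using c by (simp_all add: divide_inverse power2_eq_square mult_ac)
  show "turned_re (e0\<^sup>2) (e / e0) = e0 * of_real (Re e)"
    unfolding turned_re_def w distrib_left[symmetric] complex_add_cnj by simp
  show "turned_im (e0\<^sup>2) (e / e0) = e0 * of_real (Im e)"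
    unfolding turned_im_def w right_diff_distrib[symmetric] complex_diff_cnj by (simp add: field_simps)
qed

type_synonym triple = "complex \<times> complex \<times> complex"

text \<open>In terms of \<open>w0 = e0\<^sup>2\<close>, \<open>w1 = e1/e0\<close>, \<open>w2 = e2/e0\<close>, the quartic at a real vector with directions
\<open>e0, e1, e2\<close> and radii \<open>r0, r1, r2\<close> is \<open>weight0 r0\<^sup>4 + weight1 r1\<^sup>4 - weight2 r2\<^sup>4\<close>.\<close>

definition weight0 :: "triple \<Rightarrow> real" where "weight0 W = circle_quartic (fst W)"
definition weight1 :: "triple \<Rightarrow> real" where "weight1 W = 9 * circle_quartic ((fst (snd W))\<^sup>2 * fst W)"
definition weight2 :: "triple \<Rightarrow> real" where "weight2 W = 3 * circle_quartic ((snd (snd W))\<^sup>2 * fst W)"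

text \<open>With \<open>D, A, B\<close> for the three weights and \<open>S\<close> for this root, the equations \<open>R = P + Q\<close> and
\<open>D R\<^sup>2 + A P\<^sup>2 = B Q\<^sup>2\<close> for the squared radii are solved by
\<open>R : P : Q = (B + S) : (B - D) : (D + S)\<close>. The root \<open>P/R\<close> of the quadratic equation is taken with
rationalised numerator, \<open>(B - D)/(B + S)\<close>, which remains valid when \<open>A = B\<close> and the equation is
linear.\<close>

definition disc_root :: "triple \<Rightarrow> real" where
  "disc_root W = sqrt (weight1 W * (weight2 W - weight0 W) + weight2 W * weight0 W)"

definition torus_lift :: "triple \<Rightarrow> complex^6" where
  "torus_lift W = (let r0 = of_real (sqrt (weight2 W + disc_root W));
     r1 = of_real (sqrt (weight2 W - weight0 W));
     r2 = of_real (sqrt (weight0 W + disc_root W));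
     w0 = fst W; w1 = fst (snd W); w2 = snd (snd W) in
     (\<chi> i. if i = 0 then r0 * turned_re w0 1 else if i = 1 then r0 * turned_im w0 1
       else if i = 2 then r1 * turned_re w0 w1 else if i = 3 then r1 * turned_im w0 w1
       else if i = 4 then r2 * turned_re w0 w2 else r2 * turned_im w0 w2))"

lemma torus_lift_nth:
  "torus_lift W $ 0 = of_real (sqrt (weight2 W + disc_root W)) * turned_re (fst W) 1"
  "torus_lift W $ 1 = of_real (sqrt (weight2 W + disc_root W)) * turned_im (fst W) 1"
  "torus_lift W $ 2 = of_real (sqrt (weight2 W - weight0 W)) * turned_re (fst W) (fst (snd W))"
  "torus_lift W $ 3 = of_real (sqrt (weight2 W - weight0 W)) * turned_im (fst W) (fst (snd W))"
  "torus_lift W $ 4 = of_real (sqrt (weight0 W + disc_root W)) * turned_re (fst W) (snd (snd W))"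
  "torus_lift W $ 5 = of_real (sqrt (weight0 W + disc_root W)) * turned_im (fst W) (snd (snd W))"
  by (simp_all add: torus_lift_def Let_def)

text \<open>An open neighbourhood of the torus on which all radicands occurring in \<open>torus_lift\<close> are positive.\<close>

definition lift_domain :: "triple set" where
  "lift_domain = {W. 0 < weight2 W - weight0 W \<and>
     0 < weight1 W * (weight2 W - weight0 W) + weight2 W * weight0 W \<and>
     0 < weight2 W + disc_root W \<and> 0 < weight0 W + disc_root W}"

lemma three_torus_norm:
  "W \<in> three_torus \<longleftrightarrow> norm (fst W) = 1 \<and> norm (fst (snd W)) = 1 \<and> norm (snd (snd W)) = 1"
  by (auto simp: three_torus_def mem_Times_iff)

lemma three_torus_bounds:
  assumes "W \<in> three_torus"
  shows "1/2 \<le> weight0 W" "weight0 W \<le> 1" "9/2 \<le> weight1 W" "3/2 \<le> weight2 W"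
  using assms circle_quartic_bounds[of "fst W"] circle_quartic_bounds[of "(fst (snd W))\<^sup>2 * fst W"] circle_quartic_bounds[of "(snd (snd W))\<^sup>2 * fst W"]
  by (simp_all add: three_torus_norm weight0_def weight1_def weight2_def norm_mult norm_power)

lemma three_torus_positive:
  assumes "W \<in> three_torus"
  shows "0 < weight2 W - weight0 W" "0 < weight1 W * (weight2 W - weight0 W) + weight2 W * weight0 W" "0 < disc_root W" "0 < weight2 W + disc_root W" "0 < weight0 W + disc_root W"
proof -
  note b = three_torus_bounds[OF assms]
  show 1: "0 < weight2 W - weight0 W" using b by simp
  show 2: "0 < weight1 W * (weight2 W - weight0 W) + weight2 W * weight0 W" using b 1 by (intro add_pos_pos mult_pos_pos) auto
  then show 3: "0 < disc_root W" by (simp add: disc_root_def)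
  show "0 < weight2 W + disc_root W" "0 < weight0 W + disc_root W" using b 3 by auto
qed

lemma three_torus_lift_domain: "three_torus \<subseteq> lift_domain"
  using three_torus_positive by (auto simp: lift_domain_def)

lemma disc_root_power2: "W \<in> three_torus \<Longrightarrow> (disc_root W)\<^sup>2 = weight1 W * (weight2 W - weight0 W) + weight2 W * weight0 W"
  using three_torus_positive(2)[of W] by (simp add: disc_root_def)

lemma radii_identity:
  assumes "W \<in> three_torus"
  shows "weight0 W * (weight2 W + disc_root W)\<^sup>2 + weight1 W * (weight2 W - weight0 W)\<^sup>2 = weight2 W * (weight0 W + disc_root W)\<^sup>2"
  using disc_root_power2[OF assms] by algebra

lemma torus_lift_cone:
  assumes W: "W \<in> three_torus" shows "torus_lift W \<in> cone threefold"
proof -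
  note pos = three_torus_positive[OF W]
  obtain w0 w1 w2 where Weq: "W = (w0, w1, w2)" by (cases W)
  have n: "norm w0 = 1" "norm w1 = 1" "norm w2 = 1" using W by (auto simp: three_torus_norm Weq)
  have sq: "(of_real (sqrt x) :: complex)\<^sup>2 = of_real x" "(of_real (sqrt x) :: complex) ^ 4 = of_real (x\<^sup>2)" if "0 < x" for x
  proof -
    show 1: "(of_real (sqrt x) :: complex)\<^sup>2 = of_real x" using that by (simp flip: of_real_power)
    have "(of_real (sqrt x) :: complex) ^ 4 = ((of_real (sqrt x) :: complex)\<^sup>2)\<^sup>2" by (simp flip: power_mult)
    then show "(of_real (sqrt x) :: complex) ^ 4 = of_real (x\<^sup>2)" unfolding 1 by simp
  qed
  have r2: "(of_real (sqrt x) * turned_re w0 w)\<^sup>2 + (of_real (sqrt x) * turned_im w0 w)\<^sup>2 = of_real x * w0" if "0 < x" "norm w = 1" for x w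
    unfolding power_mult_distrib sq(1)[OF that(1)] distrib_left[symmetric] turned_power2[OF that(2)] ..
  have r4: "(of_real (sqrt x) * turned_re w0 w) ^ 4 + (of_real (sqrt x) * turned_im w0 w) ^ 4
      = of_real (x\<^sup>2 * circle_quartic (w\<^sup>2 * w0)) * w0\<^sup>2" if "0 < x" "norm w = 1" for x w
    unfolding power_mult_distrib sq(2)[OF that(1)] distrib_left[symmetric] turned_power4[OF that(2) n(1)] by simp
  have fW: "fst W = w0" "fst (snd W) = w1" "snd (snd W) = w2" by (simp_all add: Weq)
  have qd: "quadric z = ((z $ 0)\<^sup>2 + (z $ 1)\<^sup>2) - ((z $ 2)\<^sup>2 + (z $ 3)\<^sup>2) - ((z $ 4)\<^sup>2 + (z $ 5)\<^sup>2)" for z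
    by (simp add: quadric_eq)
  have "quadric (torus_lift W) = of_real (weight2 W + disc_root W) * w0 - of_real (weight2 W - weight0 W) * w0 - of_real (weight0 W + disc_root W) * w0"
    unfolding qd torus_lift_nth fW by (simp only: r2[OF pos(4) norm_one] r2[OF pos(1) n(2)] r2[OF pos(5) n(3)])
  then have q: "quadric (torus_lift W) = 0" by (simp add: algebra_simps)
  have "quartic (torus_lift W) = of_real ((weight2 W + disc_root W)\<^sup>2 * circle_quartic w0) * w0\<^sup>2
      + 9 * (of_real ((weight2 W - weight0 W)\<^sup>2 * circle_quartic (w1\<^sup>2 * w0)) * w0\<^sup>2) - 3 * (of_real ((weight0 W + disc_root W)\<^sup>2 * circle_quartic (w2\<^sup>2 * w0)) * w0\<^sup>2)"
    unfolding quartic_eq torus_lift_nth using r4[OF pos(4), of 1] r4[OF pos(1) n(2)] r4[OF pos(5) n(3)]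
    by (simp add: Weq)
  also have "\<dots> = of_real (weight0 W * (weight2 W + disc_root W)\<^sup>2 + weight1 W * (weight2 W - weight0 W)\<^sup>2 - weight2 W * (weight0 W + disc_root W)\<^sup>2) * w0\<^sup>2"
    by (simp add: weight0_def weight1_def weight2_def Weq algebra_simps)
  finally have f: "quartic (torus_lift W) = 0" using radii_identity[OF W] by simp
  have "torus_lift W $ 0 + \<i> * torus_lift W $ 1 = of_real (sqrt (weight2 W + disc_root W)) * (turned_re w0 1 + \<i> * turned_im w0 1)"
    unfolding torus_lift_nth fW by (simp add: algebra_simps)
  then have "torus_lift W $ 0 + \<i> * torus_lift W $ 1 = of_real (sqrt (weight2 W + disc_root W)) * w0"
    by (simp only: turned(1) mult_1_right)
  moreover have "of_real (sqrt (weight2 W + disc_root W)) * w0 \<noteq> 0" using n pos(4) by auto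
  ultimately have "torus_lift W \<noteq> 0" by auto
  then show ?thesis using q f by (simp add: threefold.coneX)
qed

text \<open>As \<open>torus_lift W\<close> is \<open>e0\<close> times a real vector and \<open>fst W = e0\<^sup>2\<close>, conjugation multiplies it by
\<open>cnj (e0\<^sup>2)\<close>. In particular it represents a real point.\<close>

lemma torus_lift_cnj:
  assumes W: "W \<in> three_torus" shows "cnj_vec (torus_lift W) = cnj (fst W) *s torus_lift W"
proof -
  have c: "fst W * cnj (fst W) = 1" using W by (simp add: three_torus_norm complex_norm_square[symmetric])
  have "cnj (turned_re (fst W) w) = cnj (fst W) * turned_re (fst W) w" "cnj (turned_im (fst W) w) = cnj (fst W) * turned_im (fst W) w" for w
    using c by (simp_all add: turned_re_def turned_im_def algebra_simps divide_simps)
  then show ?thesis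
    unfolding vec_eq_iff all_6 by (simp add: cnj_vec_def torus_lift_nth)
qed

text \<open>The inverse of the parametrisation in homogeneous coordinates: for a multiple of a real vector
with directions \<open>e\<^sub>j\<close> the entries are \<open>e\<^sub>0\<^sup>2\<close>, \<open>e\<^sub>1/e\<^sub>0\<close> and \<open>e\<^sub>2/e\<^sub>0\<close>.\<close>

definition torus_angles :: "complex^6 \<Rightarrow> triple" where
  "torus_angles z = ((z $ 0 + \<i> * z $ 1) / (z $ 0 - \<i> * z $ 1),
     sgn ((z $ 2 + \<i> * z $ 3) / (z $ 0 + \<i> * z $ 1)), sgn ((z $ 4 + \<i> * z $ 5) / (z $ 0 + \<i> * z $ 1)))"

definition angles_domain :: "(complex^6) set" where
  "angles_domain = {z. z $ 0 + \<i> * z $ 1 \<noteq> 0 \<and> z $ 0 - \<i> * z $ 1 \<noteq> 0 \<and> z $ 2 + \<i> * z $ 3 \<noteq> 0 \<and> z $ 4 + \<i> * z $ 5 \<noteq> 0}"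

lemma torus_angles_lift:
  assumes W: "W \<in> three_torus" and c: "c \<noteq> 0"
  shows "c *s torus_lift W \<in> angles_domain" "torus_angles (c *s torus_lift W) = W"
proof -
  note pos = three_torus_positive[OF W]
  obtain w0 w1 w2 where Weq: "W = (w0, w1, w2)" by (cases W)
  have n: "norm w0 = 1" "norm w1 = 1" "norm w2 = 1" using W by (auto simp: three_torus_norm Weq)
  then have nz: "w0 \<noteq> 0" "w1 \<noteq> 0" "w2 \<noteq> 0" by auto
  have lin: "c * (r * a) + \<i> * (c * (r * b)) = c * r * (a + \<i> * b)" "c * (r * a) - \<i> * (c * (r * b)) = c * r * (a - \<i> * b)"
    for r a b :: complex by (simp_all add: algebra_simps)
  define r0 r1 r2 where "r0 = sqrt (weight2 W + disc_root W)" and "r1 = sqrt (weight2 W - weight0 W)" and "r2 = sqrt (weight0 W + disc_root W)"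
  have r: "r0 > 0" "r1 > 0" "r2 > 0" using pos by (simp_all add: r0_def r1_def r2_def)
  have E: "(c *s torus_lift W) $ 0 + \<i> * (c *s torus_lift W) $ 1 = c * of_real r0 * w0"
    "(c *s torus_lift W) $ 0 - \<i> * (c *s torus_lift W) $ 1 = c * of_real r0"
    "(c *s torus_lift W) $ 2 + \<i> * (c *s torus_lift W) $ 3 = c * of_real r1 * (w0 * w1)"
    "(c *s torus_lift W) $ 4 + \<i> * (c *s torus_lift W) $ 5 = c * of_real r2 * (w0 * w2)"
    unfolding vector_smult_component torus_lift_nth lin turned r0_def r1_def r2_def by (simp_all add: Weq)
  show "c *s torus_lift W \<in> angles_domain" unfolding angles_domain_def mem_Collect_eq E using c r nz by simp
  have s: "sgn (c * of_real r * (w0 * w) / (c * of_real r0 * w0)) = w" if "r > 0" "norm w = 1" for r w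
  proof -
    have "c * of_real r * (w0 * w) / (c * of_real r0 * w0) = of_real (r / r0) * w"
      using c nz by (simp add: field_simps)
    moreover have "sgn (of_real (r / r0) * w) = w"
    proof -
      have "sgn (complex_of_real (r / r0)) = 1" unfolding sgn_of_real using that \<open>r0 > 0\<close> by simp
      moreover have "sgn w = w" using that by (simp add: sgn_eq)
      ultimately show ?thesis by (simp only: sgn_mult mult_1_left)
    qed
    ultimately show ?thesis by simp
  qed
  show "torus_angles (c *s torus_lift W) = W"
    unfolding torus_angles_def E s[OF r(2) n(2)] s[OF r(3) n(3)] using c r by (simp add: Weq)
qed

text \<open>For fixed \<open>R\<close>, moving mass from \<open>Q\<close> to \<open>P\<close> strictly increases \<open>A P\<^sup>2 - B Q\<^sup>2\<close>, so at most one
nonnegative solution exists, and the known one is \<open>(B - D, D + S)\<close> up to scale.\<close>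

lemma real_point_radii:
  fixes R P Q D A B S :: real
  assumes pos: "D > 0" "A > 0" "B > D" "S > 0" "R > 0" "P \<ge> 0" "Q \<ge> 0"
    and S: "D * (B + S)\<^sup>2 + A * (B - D)\<^sup>2 = B * (D + S)\<^sup>2"
    and RPQ: "R = P + Q" "D * R\<^sup>2 + A * P\<^sup>2 = B * Q\<^sup>2"
  shows "P * (B + S) = R * (B - D)" "Q * (B + S) = R * (D + S)"
proof -
  have B: "B > 0" "B + S > 0" "D + S > 0" using pos by auto
  \<comment> \<open>Both \<open>(P, Q)\<close> and the explicit solution, brought to the same \<open>R\<close>, satisfy the quartic equation.\<close>
  have key: "A * (P * (B + S))\<^sup>2 - B * (Q * (B + S))\<^sup>2 = A * (R * (B - D))\<^sup>2 - B * (R * (D + S))\<^sup>2"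
    using S RPQ(2) by algebra
  have sum: "P * (B + S) + Q * (B + S) = R * (B - D) + R * (D + S)" using RPQ(1) by algebra
  have "\<not> P * (B + S) < R * (B - D)"
  proof
    assume less: "P * (B + S) < R * (B - D)"
    then have "R * (D + S) < Q * (B + S)" using sum by simp
    then have "(R * (D + S))\<^sup>2 < (Q * (B + S))\<^sup>2" using pos B by (intro power_strict_mono) auto
    moreover have "(P * (B + S))\<^sup>2 < (R * (B - D))\<^sup>2" using less pos B by (intro power_strict_mono) auto
    ultimately have "A * (P * (B + S))\<^sup>2 < A * (R * (B - D))\<^sup>2" "B * (R * (D + S))\<^sup>2 < B * (Q * (B + S))\<^sup>2"
      using pos B by simp_all
    then show False using key by linarith
  qed
  moreover have "\<not> R * (B - D) < P * (B + S)"
  proof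
    assume less: "R * (B - D) < P * (B + S)"
    then have "Q * (B + S) < R * (D + S)" using sum by simp
    then have "(Q * (B + S))\<^sup>2 < (R * (D + S))\<^sup>2" using pos B by (intro power_strict_mono) auto
    moreover have "(R * (B - D))\<^sup>2 < (P * (B + S))\<^sup>2" using less pos B by (intro power_strict_mono) auto
    ultimately have "A * (R * (B - D))\<^sup>2 < A * (P * (B + S))\<^sup>2" "B * (Q * (B + S))\<^sup>2 < B * (R * (D + S))\<^sup>2"
      using pos B by simp_all
    then show False using key by linarith
  qed
  ultimately show "P * (B + S) = R * (B - D)" by simp
  then show "Q * (B + S) = R * (D + S)" using sum by simp
qed

lemma power4_sum_bounds:
  fixes a b :: real
  shows "a ^ 4 + b ^ 4 \<le> (a\<^sup>2 + b\<^sup>2)\<^sup>2" "(a\<^sup>2 + b\<^sup>2)\<^sup>2 \<le> 2 * (a ^ 4 + b ^ 4)"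
proof -
  have 1: "(a\<^sup>2 + b\<^sup>2)\<^sup>2 = a ^ 4 + b ^ 4 + 2 * (a * b)\<^sup>2" by algebra
  then show "a ^ 4 + b ^ 4 \<le> (a\<^sup>2 + b\<^sup>2)\<^sup>2" by simp
  have "(a\<^sup>2 + b\<^sup>2)\<^sup>2 = 2 * (a ^ 4 + b ^ 4) - (a\<^sup>2 - b\<^sup>2)\<^sup>2" by algebra
  then show "(a\<^sup>2 + b\<^sup>2)\<^sup>2 \<le> 2 * (a ^ 4 + b ^ 4)" by simp
qed

text \<open>The directions of a real solution give the point of the torus, provided that all three radii are
nonzero. The bounds on the weights ensure this: if \<open>P = 0\<close>, the last term of the
quartic dominates the first; if \<open>Q = 0\<close>, no negative term is left.\<close>

lemma real_point_on_torus:
  assumes x: "x \<in> cone threefold" and real: "\<And>i. x $ i \<in> \<real>"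
  shows "\<exists>W\<in>three_torus. cline x = cline (torus_lift W)"
proof -
  define t where "t i = Re (x $ i)" for i
  have xt: "x $ i = of_real (t i)" for i using real[of i] by (simp add: t_def)
  have "quadric x = of_real ((t 0)\<^sup>2 + (t 1)\<^sup>2 - (t 2)\<^sup>2 - (t 3)\<^sup>2 - (t 4)\<^sup>2 - (t 5)\<^sup>2)"
    "quartic x = of_real (t 0 ^ 4 + t 1 ^ 4 + 9 * (t 2 ^ 4 + t 3 ^ 4) - 3 * (t 4 ^ 4 + t 5 ^ 4))"
    by (simp_all add: quadric_eq quartic_eq xt)
  with x have q: "(t 0)\<^sup>2 + (t 1)\<^sup>2 - (t 2)\<^sup>2 - (t 3)\<^sup>2 - (t 4)\<^sup>2 - (t 5)\<^sup>2 = 0"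
    and f: "t 0 ^ 4 + t 1 ^ 4 + 9 * (t 2 ^ 4 + t 3 ^ 4) - 3 * (t 4 ^ 4 + t 5 ^ 4) = 0"
    and x0: "x \<noteq> 0"
    by (simp_all add: threefold.coneX del: of_real_add of_real_diff)
  define E0 E1 E2 where "E0 = Complex (t 0) (t 1)" and "E1 = Complex (t 2) (t 3)" and "E2 = Complex (t 4) (t 5)"
  define R P Q where "R = (t 0)\<^sup>2 + (t 1)\<^sup>2" and "P = (t 2)\<^sup>2 + (t 3)\<^sup>2" and "Q = (t 4)\<^sup>2 + (t 5)\<^sup>2"
  have nE: "(norm E0)\<^sup>2 = R" "(norm E1)\<^sup>2 = P" "(norm E2)\<^sup>2 = Q"
    by (simp_all add: E0_def E1_def E2_def R_def P_def Q_def cmod_power2)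
  have RPQ: "R = P + Q" using q by (simp add: R_def P_def Q_def)
  have nn: "P \<ge> 0" "Q \<ge> 0" by (simp_all add: P_def Q_def)
  have R: "R > 0"
  proof (rule ccontr)
    assume "\<not> R > 0"
    then have "R = 0" "P = 0" "Q = 0" using nn RPQ by auto
    then have "t i = 0" for i using exhaust_6[of i] by (auto simp: R_def P_def Q_def sum_power2_eq_zero_iff)
    then show False using x0 by (simp add: vec_eq_iff xt)
  qed
  note b = power4_sum_bounds[of "t 0" "t 1"] power4_sum_bounds[of "t 2" "t 3"] power4_sum_bounds[of "t 4" "t 5"]
  have P: "P > 0"
  proof (rule ccontr)
    assume "\<not> P > 0"
    then have "P = 0" "Q = R" using nn RPQ by auto
    then have "t 2 = 0" "t 3 = 0" by (auto simp: P_def sum_power2_eq_zero_iff)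
    then have "t 0 ^ 4 + t 1 ^ 4 = 3 * (t 4 ^ 4 + t 5 ^ 4)" using f by simp
    moreover have "R\<^sup>2 \<le> 2 * (t 4 ^ 4 + t 5 ^ 4)" unfolding \<open>Q = R\<close>[symmetric] Q_def by (rule b(6))
    moreover have "t 0 ^ 4 + t 1 ^ 4 \<le> R\<^sup>2" unfolding R_def by (rule b(1))
    ultimately have "R\<^sup>2 \<le> 0" by linarith
    then show False using R by simp
  qed
  have Q: "Q > 0"
  proof (rule ccontr)
    assume "\<not> Q > 0"
    then have "Q = 0" using nn by auto
    then have "t 4 = 0" "t 5 = 0" by (auto simp: Q_def sum_power2_eq_zero_iff)
    then have "t 0 ^ 4 + t 1 ^ 4 + 9 * (t 2 ^ 4 + t 3 ^ 4) = 0" using f by simp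
    moreover have "u \<le> 0" if "x + 9 * y = 0" "u \<le> 2 * x" "0 \<le> 9 * y" for x y u :: real
      using that by linarith
    moreover have "R\<^sup>2 \<le> 2 * (t 0 ^ 4 + t 1 ^ 4)" "0 \<le> 9 * (t 2 ^ 4 + t 3 ^ 4)" using b by (simp_all add: R_def)
    ultimately have "R\<^sup>2 \<le> 0" by blast
    then show False using R by simp
  qed
  have E: "E0 \<noteq> 0" "E1 \<noteq> 0" "E2 \<noteq> 0" using nE R P Q by auto
  define W where "W = ((sgn E0)\<^sup>2, sgn E1 / sgn E0, sgn E2 / sgn E0)"
  have W: "W \<in> three_torus"
    using E by (simp add: W_def three_torus_norm norm_power norm_divide norm_sgn)
  have s0: "sgn E0 \<noteq> 0" using E by (simp add: sgn_zero_iff)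
  have "weight0 W = circle_quartic ((sgn E0)\<^sup>2)" "weight1 W = 9 * circle_quartic ((sgn E1)\<^sup>2)" "weight2 W = 3 * circle_quartic ((sgn E2)\<^sup>2)"
    using s0 by (simp_all add: weight0_def weight1_def weight2_def W_def power_divide)
  moreover have "R\<^sup>2 * circle_quartic ((sgn E0)\<^sup>2) = t 0 ^ 4 + t 1 ^ 4" "P\<^sup>2 * circle_quartic ((sgn E1)\<^sup>2) = t 2 ^ 4 + t 3 ^ 4"
    "Q\<^sup>2 * circle_quartic ((sgn E2)\<^sup>2) = t 4 ^ 4 + t 5 ^ 4"
    using circle_quartic_sgn[of E0] circle_quartic_sgn[of E1] circle_quartic_sgn[of E2] unfolding nE[symmetric]
    by (simp_all add: E0_def E1_def E2_def)
  ultimately have ABD: "weight0 W * R\<^sup>2 + weight1 W * P\<^sup>2 = weight2 W * Q\<^sup>2"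
    using f by (simp add: mult_ac)
  note bnd = three_torus_bounds[OF W] and pos = three_torus_positive[OF W]
  have rad: "P * (weight2 W + disc_root W) = R * (weight2 W - weight0 W)" "Q * (weight2 W + disc_root W) = R * (weight0 W + disc_root W)"
    using real_point_radii[OF _ _ _ pos(3) R nn radii_identity[OF W] RPQ ABD] bnd pos by auto
  define k where "k = sqrt ((weight2 W + disc_root W) / R)"
  have k: "k > 0" using R pos by (simp add: k_def)
  have kE: "sqrt (weight2 W + disc_root W) = k * norm E0" "sqrt (weight2 W - weight0 W) = k * norm E1" "sqrt (weight0 W + disc_root W) = k * norm E2"
  proof -
    have N: "norm E0 = sqrt R" "norm E1 = sqrt P" "norm E2 = sqrt Q" unfolding nE[symmetric] by simp_all
    have "weight2 W + disc_root W = (weight2 W + disc_root W) / R * R" "weight2 W - weight0 W = (weight2 W + disc_root W) / R * P" "weight0 W + disc_root W = (weight2 W + disc_root W) / R * Q"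
      using R rad by (simp_all add: field_simps)
    then show "sqrt (weight2 W + disc_root W) = k * norm E0" "sqrt (weight2 W - weight0 W) = k * norm E1" "sqrt (weight0 W + disc_root W) = k * norm E2"
      unfolding N k_def real_sqrt_mult[symmetric] by simp_all
  qed
  have e0: "norm (sgn E0) = 1" using E by (simp add: norm_sgn)
  have one: "1 = sgn E0 / sgn E0" using s0 by simp
  have fac: "of_real (k * norm E) * (sgn E0 * of_real (Re (sgn E))) = of_real k * sgn E0 * of_real (Re E)"
    "of_real (k * norm E) * (sgn E0 * of_real (Im (sgn E))) = of_real k * sgn E0 * of_real (Im E)" for E
    unfolding norm_Re_Im_sgn[of E, symmetric] by simp_all
  have fW: "fst W = (sgn E0)\<^sup>2" "fst (snd W) = sgn E1 / sgn E0" "snd (snd W) = sgn E2 / sgn E0"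
    by (simp_all add: W_def)
  have "torus_lift W = (of_real k * sgn E0) *s x"
    unfolding vec_eq_iff all_6 torus_lift_nth kE fW vector_smult_component xt
    by (subst (1 2) one) (simp only: turned_unit[OF e0] fac, simp add: E0_def E1_def E2_def)
  then have "cline (torus_lift W) = cline x" using cline_scale[of "of_real k * sgn E0" x] k s0 by simp
  then show ?thesis using W by metis
qed

section \<open>Smoothness of the parametrisation and its inverse\<close>

lemma Ck_on_circle_quartic:
  assumes "open U" "Ck_on k U g" shows "Ck_on k U (\<lambda>x. circle_quartic (g x))"
proof -
  have "Ck_on k U (\<lambda>x. Im (g x))" using Ck_on_bounded_linear[OF assms(1) bounded_linear_Im assms(2)] .
  then have "Ck_on k U (\<lambda>x. 1 - (Im (g x))\<^sup>2 * (1/2))"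
    by (intro Ck_on_diff Ck_on_mult Ck_on_power Ck_on_const assms(1))
  then show ?thesis by (simp add: circle_quartic_def)
qed

lemma Ck_on_coordinates:
  fixes U :: "triple set"
  assumes "open U"
  shows "Ck_on k U (\<lambda>W. fst W)" "Ck_on k U (\<lambda>W. fst (snd W))" "Ck_on k U (\<lambda>W. snd (snd W))"
  by (intro Ck_on_linear assms bounded_linear_intros)+

lemma Ck_on_weights:
  assumes "open U"
  shows "Ck_on k U weight0" "Ck_on k U weight1" "Ck_on k U weight2"
  unfolding weight0_def[abs_def] weight1_def[abs_def] weight2_def[abs_def]
  by (intro Ck_on_mult Ck_on_circle_quartic Ck_on_power Ck_on_const Ck_on_coordinates assms)+

lemma open_lift_domain: "open lift_domain"
proof -
  have c: "continuous_on UNIV weight0" "continuous_on UNIV weight1" "continuous_on UNIV weight2"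
    using Ck_on_weights[OF open_UNIV, of 0] by auto
  have s: "continuous_on UNIV disc_root" unfolding disc_root_def[abs_def] by (intro continuous_intros c)
  show ?thesis unfolding lift_domain_def
    by (intro open_Collect_conj open_Collect_less continuous_intros c s)
qed

lemma smooth_torus_lift: "smooth_map_on lift_domain torus_lift"
  unfolding smooth_map_on_def
proof (intro conjI allI open_lift_domain)
  fix k
  note o = open_lift_domain
  have S: "Ck_on k lift_domain disc_root"
    unfolding disc_root_def[abs_def]
    by (intro Ck_on_sqrt Ck_on_add Ck_on_mult Ck_on_diff Ck_on_weights o) (auto simp: lift_domain_def)
  have r0: "Ck_on k lift_domain (\<lambda>W. complex_of_real (sqrt (weight2 W + disc_root W)))"
    and r1: "Ck_on k lift_domain (\<lambda>W. complex_of_real (sqrt (weight2 W - weight0 W)))"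
    and r2: "Ck_on k lift_domain (\<lambda>W. complex_of_real (sqrt (weight0 W + disc_root W)))"
    by (intro Ck_on_bounded_linear[OF o bounded_linear_of_real] Ck_on_sqrt Ck_on_add Ck_on_diff Ck_on_weights S o;
        auto simp: lift_domain_def)+
  have rpip: "Ck_on k lift_domain (\<lambda>W. turned_re (fst W) (g W))" "Ck_on k lift_domain (\<lambda>W. turned_im (fst W) (g W))" if "Ck_on k lift_domain g" for g
    unfolding turned_re_def turned_im_def
    by (intro Ck_on_divide Ck_on_add Ck_on_diff Ck_on_mult Ck_on_const Ck_on_coordinates that
        Ck_on_bounded_linear[OF o bounded_linear_cnj] o; simp)+
  show "Ck_on k lift_domain torus_lift"
  proof (rule Ck_on_vec[OF o])
    fix i :: 6
    show "Ck_on k lift_domain (\<lambda>W. torus_lift W $ i)"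
      using exhaust_6[of i]
      by (elim disjE; simp only: torus_lift_nth)
         (intro Ck_on_mult r0 r1 r2 rpip Ck_on_const Ck_on_coordinates o)+
  qed
qed

lemma open_angles_domain: "open angles_domain"
  unfolding angles_domain_def by (intro open_Collect_conj open_Collect_neq continuous_intros)

lemma smooth_torus_angles: "smooth_map_on angles_domain torus_angles"
  unfolding smooth_map_on_def
proof (intro conjI allI open_angles_domain)
  fix k
  note o = open_angles_domain
  have nth: "Ck_on k angles_domain (\<lambda>z. z $ i)" for i by (intro Ck_on_linear o bounded_linear_vec_nth)
  have pl: "Ck_on k angles_domain (\<lambda>z. z $ i + \<i> * z $ j)" "Ck_on k angles_domain (\<lambda>z. z $ i - \<i> * z $ j)" for i j
    by (intro Ck_on_add Ck_on_diff Ck_on_mult Ck_on_const nth o)+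
  have sgn: "Ck_on k angles_domain (\<lambda>z. sgn (g z))"
    if g: "Ck_on k angles_domain g" "\<And>z. z \<in> angles_domain \<Longrightarrow> g z \<noteq> 0" for g :: "complex^6 \<Rightarrow> complex"
  proof -
    have "Ck_on k angles_domain (\<lambda>z. g z / complex_of_real (sqrt ((Re (g z))\<^sup>2 + (Im (g z))\<^sup>2)))"
      by (intro Ck_on_divide g o Ck_on_bounded_linear[OF o bounded_linear_of_real] Ck_on_sqrt Ck_on_add Ck_on_power
          Ck_on_bounded_linear[OF o bounded_linear_Re g(1)] Ck_on_bounded_linear[OF o bounded_linear_Im g(1)])
         (use g(2) in \<open>auto simp: sum_power2_gt_zero_iff complex_eq_iff\<close>)
    then show ?thesis by (simp add: sgn_eq cmod_def)
  qed
  show "Ck_on k angles_domain torus_angles"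
    unfolding torus_angles_def[abs_def]
    by (intro Ck_on_Pair Ck_on_divide sgn pl o) (auto simp: angles_domain_def)
qed

lemma torus_diffeomorphic: "diffeomorphic_to_proj_subset three_torus (real_locus threefold conj_line)"
  unfolding diffeomorphic_to_proj_subset_def
proof (intro exI conjI)
  let ?h = "\<lambda>W. cline (torus_lift W)" and ?L = "real_locus threefold conj_line"
  have inv: "torus_angles z = W" "z \<in> angles_domain" if W: "W \<in> three_torus" and z: "cline z = ?h W" for z W
  proof -
    have "torus_lift W \<noteq> 0" using torus_lift_cone[OF W] by (simp add: cone_def)
    then obtain c where "c \<noteq> 0" "z = c *s torus_lift W" using cline_eq_iff[of "torus_lift W" z] z by auto
    then show "torus_angles z = W" "z \<in> angles_domain" using torus_angles_lift[OF W] by auto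
  qed
  have inj: "inj_on ?h three_torus"
    by (rule inj_onI) (metis inv(1))
  have img: "?h ` three_torus = ?L"
  proof (intro set_eqI iffI)
    fix p assume "p \<in> ?h ` three_torus"
    then obtain W where W: "W \<in> three_torus" "p = cline (torus_lift W)" by blast
    have "cnj (fst W) \<noteq> 0" using W(1) by (auto simp: three_torus_norm)
    then show "p \<in> ?L" using W torus_lift_cone[OF W(1)]
      by (simp add: real_locus_def conj_line_cline torus_lift_cnj cline_scale cone_def)
  next
    fix p assume p: "p \<in> ?L"
    then obtain z where z: "z \<noteq> 0" "p = cline z" by (auto simp: real_locus_def zero_locus_def)
    then have "conj_line (cline z) = cline z" using p by (simp add: real_locus_def)
    from real_representative[OF z(1) this] obtain x
      where x: "x \<noteq> 0" "cline z = cline x" "\<And>i. x $ i \<in> \<real>" by metis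
    have "x \<in> cone threefold" using p z x by (simp add: cone_def real_locus_def)
    from real_point_on_torus[OF this x(3)] show "p \<in> ?h ` three_torus" using z x by auto
  qed
  show "bij_betw ?h three_torus ?L" using inj img by (simp add: bij_betw_def)
  show "locally_lifts smooth_map_on three_torus ?h"
    unfolding locally_lifts_def
  proof
    fix W assume "W \<in> three_torus"
    then show "\<exists>V F. open V \<and> W \<in> V \<and> smooth_map_on V F \<and> (\<forall>y\<in>V \<inter> three_torus. F y \<noteq> 0 \<and> ?h y = cline (F y))"
      using open_lift_domain three_torus_lift_domain smooth_torus_lift torus_lift_cone
      by (intro exI[of _ lift_domain] exI[of _ torus_lift]) (auto simp: cone_def)
  qed
  show "locally_extends smooth_map_on (cone ?L) (inv_into three_torus ?h \<circ> cline)"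
    unfolding locally_extends_def
  proof
    fix z assume z: "z \<in> cone ?L"
    have *: "y \<in> angles_domain \<and> (inv_into three_torus ?h \<circ> cline) y = torus_angles y" if "y \<in> cone ?L" for y
    proof -
      from that have "cline y \<in> ?h ` three_torus" unfolding img by (simp add: cone_def)
      then obtain W where W: "W \<in> three_torus" "cline y = ?h W" by blast
      then show ?thesis using inv[OF W] inv_into_f_f[OF inj W(1)] by simp
    qed
    show "\<exists>V F. open V \<and> z \<in> V \<and> smooth_map_on V F \<and>
        (\<forall>y\<in>V \<inter> cone ?L. (inv_into three_torus ?h \<circ> cline) y = F y)"
      using open_angles_domain smooth_torus_angles * z by (intro exI[of _ angles_domain] exI[of _ torus_angles]) auto
  qed
qed

theorem proposition10p4:
  shows "\<exists>(q :: complex^6 \<Rightarrow> complex) (f :: complex^6 \<Rightarrow> complex) X.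
           homogeneous_poly 2 q \<and> smooth_hypersurface q \<and>
           homogeneous_poly 4 f \<and>
           smooth_intersection q f \<and>
           X = zero_locus q \<inter> zero_locus f \<and>
           calabi_yau_threefold X \<and>
           (\<exists>\<sigma>. real_structure X \<sigma> \<and>
                diffeomorphic_to_proj_subset three_torus (real_locus X \<sigma>))"
proof (intro exI conjI)
  show "smooth_hypersurface quadric"
    by (rule smooth_hypersurface_diag_form) (simp add: coeff2_def)
  show "calabi_yau_threefold threefold" by (rule threefold.calabi_yau)
  show "real_structure threefold conj_line"
    using zero_locus_subset_proj_space by (intro real_structure_conj_line cone_threefold_cnj) blast+
qed (rule homogeneous_poly_diag_form smooth_quadric_quartic refl torus_diffeomorphic)+

end
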